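(* Let $\kappa=\beth_{\beta+1}$, where $\beta$ is an ordinal such that $\beta=0$ or $\operatorname{cf}(\beta)=\omega$. Then for each ordinal $\alpha<\kappa^+$ there is a locally compact, locally countable, $0$-dimensional space $X$ with $\operatorname{ord}_\ell(X)=\kappa\cdot\alpha$.
   Context: A well-ordering $\prec$ of (the underlying set of) a topological space $X$ is left-separating if $\{x\in X: x\prec y\}$ is closed in $X$ for every $y\in X$. A space is left-separated if it has a left-separating well-ordering. For a left-separated space $X$, its left-separating type $\operatorname{ord}_\ell(X)$ is the minimum of the order types of the left-separating well-orderings of $X$; write $\operatorname{ord}_\ell(X)=\infty$ if $X$ is not left-separated. A space is $0$-dimensional if it has a base consisting of clopen sets, and locally countable if every point has a countable neighborhood. The beth numbers are $\beth_0=\omega$, $\beth_{\beta+1}=2^{\beth_\beta}$, and $\beth_\beta=\sup_{\gamma<\beta}\beth_\gamma$ for limit $\beta$; in particular $\beth_1=2^\omega$. The product $\kappa\cdot\alpha$ is ordinal multiplication. *)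

theory Defs
  imports "HOL-Analysis.Analysis"
begin

unbundle cardinal_syntax

text \<open>
  Ordinals are represented by well-orders (reflexive, on their field, on arbitrary types) and are
  compared by the relations \<open>=o\<close>, \<open>\<le>o\<close>, \<open><o\<close>; the ordinal \<open>0\<close> is the empty relation.
  Cardinals are the well-orders satisfying \<^const>\<open>Card_order\<close>.
\<close>

subsection \<open>Ordinals\<close>

text \<open>The ordinal \<open>r + 1\<close>, with \<^const>\<open>None\<close> as the new largest element.\<close>

definition ord_succ :: "'a rel \<Rightarrow> 'a option rel" where
  "ord_succ r = map_prod Some Some ` r \<union> {(x, None) | x. x \<in> insert None (Some ` Field r)}"

text \<open>The ordinal product \<open>r \<cdot> s\<close>, that is, \<open>s\<close> many copies of \<open>r\<close>: the second
  coordinate is the more significant one.\<close>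

definition ord_times :: "'a rel \<Rightarrow> 'b rel \<Rightarrow> ('a \<times> 'b) rel" where
  "ord_times r s = {((x, i), (y, j)). x \<in> Field r \<and> y \<in> Field r \<and>
     ((i, j) \<in> s \<and> i \<noteq> j \<or> i = j \<and> i \<in> Field s \<and> (x, y) \<in> r)}"

text \<open>Unlike the library's \<^const>\<open>cofinal\<close>, this does not ask for strictly larger elements, so that
  successor ordinals have cofinality \<open>1\<close>.\<close>

definition cofinal_subset :: "'a rel \<Rightarrow> 'a set \<Rightarrow> bool" where
  "cofinal_subset r A \<longleftrightarrow> A \<subseteq> Field r \<and> (\<forall>x\<in>Field r. \<exists>y\<in>A. (x, y) \<in> r)"

text \<open>\<open>is_cofinality r c\<close> says that \<open>c = cf(r)\<close>.\<close>

definition is_cofinality :: "'a rel \<Rightarrow> 'c rel \<Rightarrow> bool" where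
  "is_cofinality r c \<longleftrightarrow>
     (\<exists>A. cofinal_subset r A \<and> c =o |A| ) \<and> (\<forall>A. cofinal_subset r A \<longrightarrow> c \<le>o |A| )"

text \<open>
  \<open>is_beth b k\<close> says that \<open>k = \<beth>\<^sub>b\<close>. The function \<open>b \<mapsto> \<beth>\<^sub>b\<close> itself is not definable, since the
  sizes of its values are not bounded by any one type. The smaller beth numbers are taken on the
  type of \<open>k\<close>, which is no restriction because they embed into \<open>k\<close>. For the same reason the
  supremum may be tested against well-orders of that type only. An ordinal smaller than \<open>b\<close>
  is given by the initial segment of \<open>b\<close> strictly below some \<open>i\<close>.
\<close>

abbreviation initial_segment :: "'a rel \<Rightarrow> 'a \<Rightarrow> 'a rel" where
  "initial_segment b i \<equiv> Restr b (underS b i)"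

inductive is_beth :: "'b rel \<Rightarrow> 'k rel \<Rightarrow> bool" where
  zero: "k =o natLeq \<Longrightarrow> is_beth {} k"
| succ: "\<lbrakk>Well_order b; m \<in> Field b; \<forall>i\<in>Field b. (i, m) \<in> b;
          is_beth (initial_segment b m) l; k =o ctwo ^c l\<rbrakk> \<Longrightarrow> is_beth b k"
| limit: "\<lbrakk>Well_order b; Field b \<noteq> {}; \<forall>i\<in>Field b. \<exists>j\<in>Field b. i \<noteq> j \<and> (i, j) \<in> b;
          \<forall>i\<in>Field b. is_beth (initial_segment b i) (f i);
          \<forall>i\<in>Field b. f i \<le>o k;
          \<forall>c :: 'k rel. (\<forall>i\<in>Field b. f i \<le>o c) \<longrightarrow> k \<le>o c\<rbrakk> \<Longrightarrow> is_beth b k"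

subsection \<open>Topological spaces\<close>

definition left_separating :: "'a topology \<Rightarrow> 'a rel \<Rightarrow> bool" where
  "left_separating X r \<longleftrightarrow>
     well_order_on (topspace X) r \<and> (\<forall>y\<in>topspace X. closedin X (underS r y))"

definition left_separated :: "'a topology \<Rightarrow> bool" where
  "left_separated X \<longleftrightarrow> (\<exists>r. left_separating X r)"

text \<open>
  \<open>has_left_type X t\<close> says that \<open>X\<close> is left-separated and that the ordinal \<open>t\<close> is \<open>ord\<^sub>\<ell>(X)\<close>, the
  minimum of the order types of the left-separating well-orderings of \<open>X\<close>. For spaces with
  \<open>ord\<^sub>\<ell>(X) = \<infinity>\<close> it holds for no \<open>t\<close>.
\<close>

definition has_left_type :: "'a topology \<Rightarrow> 'b rel \<Rightarrow> bool" where
  "has_left_type X t \<longleftrightarrow>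
     (\<exists>r. left_separating X r \<and> r =o t) \<and> (\<forall>r. left_separating X r \<longrightarrow> t \<le>o r)"

definition zero_dimensional :: "'a topology \<Rightarrow> bool" where
  "zero_dimensional X \<longleftrightarrow>
     (\<exists>\<B>. (\<forall>B\<in>\<B>. openin X B \<and> closedin X B) \<and> openin X = arbitrary union_of (\<lambda>B. B \<in> \<B>))"

definition locally_countable_space :: "'a topology \<Rightarrow> bool" where
  "locally_countable_space X \<longleftrightarrow>
     (\<forall>x\<in>topspace X. \<exists>U N. openin X U \<and> x \<in> U \<and> U \<subseteq> N \<and> N \<subseteq> topspace X \<and> countable N)"

lemma zero_dimensional_iff_dim_le_0: "zero_dimensional X \<longleftrightarrow> X dim_le 0"
proof
  assume "zero_dimensional X"
  then obtain \<B> where "\<And>B. B \<in> \<B> \<Longrightarrow> openin X B \<and> closedin X B"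
      and "neighbourhood_base_of (\<lambda>B. B \<in> \<B>) X"
    unfolding zero_dimensional_def openin_topology_neighbourhood_base_unique by blast
  then show "X dim_le 0"
    unfolding dimension_le_0_neighbourhood_base_of_clopen
    by (auto elim!: neighbourhood_base_of_mono)
next
  assume "X dim_le 0"
  then have "neighbourhood_base_of (\<lambda>U. U \<in> {U. openin X U \<and> closedin X U}) X"
    unfolding dimension_le_0_neighbourhood_base_of_clopen
    by (rule neighbourhood_base_of_mono) blast
  then have "openin X = arbitrary union_of (\<lambda>U. U \<in> {U. openin X U \<and> closedin X U})"
    by (intro openin_topology_neighbourhood_base_unique[THEN iffD2]) blast
  then show "zero_dimensional X"
    unfolding zero_dimensional_def
    by (intro exI[of _ "{U. openin X U \<and> closedin X U}"] conjI) (blast, assumption)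
qed

lemma left_separated_zero_dimensional_imp_Hausdorff:
  assumes "left_separated X" "zero_dimensional X"
  shows "Hausdorff_space X"
proof -
  obtain r where r: "well_order_on (topspace X) r"
      and cl: "\<And>y. y \<in> topspace X \<Longrightarrow> closedin X (underS r y)"
    using assms(1) unfolding left_separated_def left_separating_def by blast
  have "\<exists>C. closedin X C \<and> (x \<notin> C \<longleftrightarrow> y \<in> C)"
    if xy: "x \<in> topspace X" "y \<in> topspace X" "x \<noteq> y" for x y
  proof -
    have "(x, y) \<in> r \<or> (y, x) \<in> r"
      using r xy unfolding well_order_on_def linear_order_on_def total_on_def by blast
    then have "x \<in> underS r y \<or> y \<in> underS r x"
      using xy by (auto simp: underS_def)
    moreover have "x \<notin> underS r x" "y \<notin> underS r y"
      by (auto simp: underS_def)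
    ultimately show ?thesis
      using cl[OF xy(1)] cl[OF xy(2)] by blast
  qed
  then have "t0_space X"
    unfolding t0_space by blast
  moreover have "regular_space X"
    using assms(2) by (simp add: zero_dimensional_iff_dim_le_0 zero_dimensional_imp_regular_space)
  ultimately show ?thesis
    using regular_t0_imp_Hausdorff_space by blast
qed

end

theory Submission
  imports Defs
begin

text \<open>
  Let \<open>\<lambda> = \<beth>\<^sub>\<beta>\<close>, so that \<open>\<kappa> = 2\<^sup>\<lambda>\<close>. Either \<open>\<lambda> = \<omega>\<close> or \<open>\<lambda>\<close> is a strong limit of cofinality \<open>\<omega>\<close>; in both cases a set \<open>\<Lambda>\<close>
  of size \<open>\<lambda>\<close> is an increasing union of sets \<open>B 0 \<subseteq> B 1 \<subseteq> \<dots>\<close> smaller than \<open>\<lambda>\<close>, and \<open>2\<^sup>\<mu> < \<lambda>\<close> for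
  \<open>\<mu> < \<lambda>\<close> (\<open>beth_successor_strong_limit\<close>). The subsets \<open>d\<close> of \<open>\<Lambda>\<close> are then the branches of a tree whose \<open>n\<close>-th level
  \<open>Pow (B n)\<close> is smaller than \<open>\<lambda>\<close>, the node of \<open>d\<close> at level \<open>n\<close> being \<open>d \<inter> B n\<close>. Only this tree and the
  inequality \<open>cf(2\<^sup>\<lambda>) > \<lambda>\<close> (\<open>Koenig\<close>) enter the construction.

  A well-ordering is left-separating iff every point is the least element of one of its neighbourhoods. An order of
  type at most \<open>\<kappa> \<cdot> \<alpha>\<close> assigns to every point a position in \<open>\<kappa> \<times> \<alpha>\<close>, whose second coordinate is called
  the level of the point. A space of size at most \<open>\<kappa>\<close> on which a function \<open>L\<close> into \<open>\<alpha>\<close> is given such that every point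
  has a neighbourhood on whose other points \<open>L\<close> is larger has a left-separating order of type at most \<open>\<kappa> \<cdot> \<alpha>\<close>: sort by
  \<open>L\<close> first. This is the upper bound. For the lower bound, the space is built from pieces that force points
  onto high levels in every order.

  The pieces are made by recursion on \<open>\<gamma> < \<alpha>\<close> (\<open>stages_exist\<close>). Stage \<open>\<gamma>\<close> is a space with a dense set \<open>N\<close> of at most \<open>\<lambda>\<close> isolated
  points; the points outside \<open>N\<close> have a level function with values at most \<open>\<gamma>\<close>, yet every order of them puts \<open>\<kappa>\<close> of them on
  levels at least \<open>\<gamma>\<close>. It follows that in every order of the whole piece some point of \<open>N\<close> is on a level above \<open>\<gamma>\<close>
  (\<open>stage_top\<close>). Otherwise the at most \<open>\<lambda>\<close> points of \<open>N\<close> on level \<open>\<gamma>\<close> would be bounded there, as \<open>cf(\<kappa>) > \<lambda>\<close>, and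
  since each point has points of \<open>N\<close> behind it, \<open>\<kappa>\<close> points would have to fit below the bound. The sum
  over \<open>\<gamma> < \<alpha>\<close> of the pieces without their sets \<open>N\<close> is the required space: its levels give an order of type at most
  \<open>\<kappa> \<cdot> \<alpha>\<close>, and a shorter order would have fewer than \<open>\<kappa>\<close> positions on or above some level \<open>\<gamma>\<close>.

  If \<open>\<gamma>\<close> is the successor of \<open>\<eta>\<close> (\<open>successor_step\<close>), take \<open>\<kappa>\<close> copies of stage \<open>\<eta>\<close>, one for every branch \<open>d\<close>. By
  \<open>stage_top\<close> each copy has a point on a level at least \<open>\<gamma>\<close>. New isolated points, only \<open>\<lambda>\<close> many, are made dense
  by letting the old isolated points of copy \<open>d\<close> be limits of nodes of \<open>d\<close>; distinct copies stay separated
  because distinct branches have almost disjoint sets of nodes.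

  If \<open>\<gamma>\<close> is a limit or \<open>0\<close> (\<open>limit_step\<close>), the branches themselves are the new points of level \<open>\<gamma>\<close>, the nodes are
  the new isolated points, and copies of the earlier stages are glued to the branches. To every \<open>\<nu> < \<gamma>\<close> and
  every family \<open>E\<close> of at most \<open>\<lambda>\<close> branches with \<open>\<kappa>\<close> limit points belongs a copy of stage \<open>\<nu>\<close>, attached
  at a limit point of its own, such that each isolated point of the copy is the limit of a sequence in \<open>E\<close>. Suppose
  that an order puts fewer than \<open>\<kappa>\<close> points on levels at least \<open>\<gamma>\<close>. A counting argument (\<open>bounded_dense_family\<close>) then yields
  \<open>\<nu> < \<gamma>\<close> and such a family \<open>E\<close> all of whose members are on levels at most \<open>\<nu>\<close>. But the copy for \<open>E\<close> and \<open>\<nu>\<close> has an isolated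
  point on a level above \<open>\<nu>\<close>, and the sequence in \<open>E\<close> that converges to it would have to come after it.

  All spaces are given by the ring of their countable compact open sets.
\<close>

section \<open>Cardinal arithmetic\<close>

(* The notation \<open>=o\<close> for membership would make every equation between order types ambiguous. *)
no_notation Set_Algebras.elt_set_eq (infix "=o" 50)

lemma card_of_less_or_le: "|A| <o |B| \<or> |B| \<le>o |A|"
  by (rule ordLess_or_ordLeq) (rule card_of_Well_order)+

lemma not_card_of_le: "\<not> |B| \<le>o |A| \<longleftrightarrow> |A| <o |B|"
  by (rule not_ordLeq_iff_ordLess) (rule card_of_Well_order)+

lemma card_of_Times_less_infinite:
  assumes "infinite C" "|A| <o |C|" "|B| <o |C|"
  shows "|A \<times> B| <o |C|"
proof (cases "finite A \<and> finite B")
  case True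
  then have "finite (A \<times> B)" by blast
  then show ?thesis
    using assms(1) card_of_less_or_le[of "A \<times> B" C] card_of_ordLeq_infinite[of C "A \<times> B"] by blast
next
  case False
  show ?thesis
  proof (cases "A = {} \<or> B = {}")
    case True
    then have "finite (A \<times> B)" by auto
    then show ?thesis
      using assms(1) card_of_less_or_le[of "A \<times> B" C] card_of_ordLeq_infinite[of C "A \<times> B"] by blast
  next
    case ne: False
    from card_of_Well_order card_of_Well_order have "|A| \<le>o |B| \<or> |B| \<le>o |A|"
      by (rule ordLeq_total)
    then show ?thesis
    proof
      assume le: "|A| \<le>o |B|"
      then have "infinite B" using False card_of_ordLeq_infinite by blast
      then have "|A \<times> B| =o |B|" using card_of_Times_infinite[of B A] le ne by blast
      then show ?thesis using assms(3) ordIso_ordLess_trans by blast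
    next
      assume le: "|B| \<le>o |A|"
      then have "infinite A" using False card_of_ordLeq_infinite by blast
      then have "|A \<times> B| =o |A|" using card_of_Times_infinite[of A B] le ne by blast
      then show ?thesis using assms(2) ordIso_ordLess_trans by blast
    qed
  qed
qed

lemma finite_card_of_less: "\<lbrakk>finite A; infinite C\<rbrakk> \<Longrightarrow> |A| <o |C|"
  using card_of_less_or_le card_of_ordLeq_infinite by blast

lemma card_of_Pow_Times_self:
  assumes "infinite C" shows "|Pow (C \<times> C)| =o |Pow C|"
proof -
  obtain f where "bij_betw f (C \<times> C) C"
    using card_of_Times_same_infinite[OF assms] card_of_ordIso by blast
  then have "bij_betw ((`) f) (Pow (C \<times> C)) (Pow C)" by (rule bij_betw_Pow)
  then show ?thesis using card_of_ordIso by blast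
qed

text \<open>
  Koenig's inequality \<open>cf(2\<^bsup>|C|\<^esup>) > |C|\<close>: identify the power set with \<open>Pow (C \<times> C)\<close> and diagonalize over the sections.
\<close>

lemma Koenig:
  assumes C: "infinite C" and J: "|J| \<le>o |C|" and M: "\<And>j. j \<in> J \<Longrightarrow> |M j| <o |Pow C|"
  shows "|\<Union>j\<in>J. M j| <o |Pow C|"
proof (rule ccontr)
  assume "\<not> ?thesis"
  then have "|Pow C| \<le>o |\<Union>j\<in>J. M j|" using card_of_less_or_le by blast
  then have "|Pow (C \<times> C)| \<le>o |\<Union>j\<in>J. M j|"
    using card_of_Pow_Times_self[OF C] ordIso_ordLeq_trans by blast
  then obtain \<phi> where inj: "inj_on \<phi> (Pow (C \<times> C))" and im: "\<phi> ` Pow (C \<times> C) \<subseteq> (\<Union>j\<in>J. M j)"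
    unfolding card_of_ordLeq[symmetric] by blast
  obtain e where e: "inj_on e J" "e ` J \<subseteq> C" using J unfolding card_of_ordLeq[symmetric] by blast
  \<comment> \<open>\<open>M j\<close> does not exhaust the sections at \<open>e j\<close>; a set that differs from \<open>M j\<close> there for every \<open>j\<close> is in none of them.\<close>
  define Sec where "Sec j = (\<lambda>m. inv_into (Pow (C \<times> C)) \<phi> m `` {e j}) ` M j" for j
  have "\<exists>s. s \<in> Pow C - Sec j" if "j \<in> J" for j
  proof -
    have "|Sec j| \<le>o |M j|" unfolding Sec_def by (rule card_of_image)
    then have "|Sec j| <o |Pow C|" using M[OF that] ordLeq_ordLess_trans by blast
    then have "\<not> Pow C \<subseteq> Sec j" using card_of_mono1 not_ordLess_ordLeq by blast
    then show ?thesis by blast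
  qed
  then have "\<forall>j\<in>J. \<exists>s. s \<in> Pow C - Sec j" by blast
  then obtain s where s: "\<And>j. j \<in> J \<Longrightarrow> s j \<in> Pow C - Sec j" by (rule bchoice[THEN exE]) blast
  define X where "X = {(e j, b) | j b. j \<in> J \<and> b \<in> s j}"
  have X: "X \<in> Pow (C \<times> C)"
  proof (rule PowI, rule subsetI)
    fix v assume "v \<in> X"
    then obtain j b where "j \<in> J" "b \<in> s j" "v = (e j, b)" unfolding X_def by blast
    then show "v \<in> C \<times> C" using s[of j] e(2) by auto
  qed
  then obtain j where j: "j \<in> J" "\<phi> X \<in> M j" using im by blast
  have "inv_into (Pow (C \<times> C)) \<phi> (\<phi> X) = X" using inj X by simp
  moreover have "X `` {e j} = s j" using j(1) inj_onD[OF e(1)] unfolding X_def by auto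
  ultimately have "s j \<in> Sec j" unfolding Sec_def using j(2) by (intro image_eqI[where x = "\<phi> X"]) auto
  then show False using s[OF j(1)] by blast
qed

text \<open>Well-order the index set by its cardinal and choose greedily.\<close>

lemma injective_choice:
  assumes "\<And>i. i \<in> I \<Longrightarrow> |I| \<le>o |F i|"
  shows "\<exists>x. inj_on x I \<and> (\<forall>i\<in>I. x i \<in> F i)"
proof -
  let ?r = "|I|"
  have wo: "Well_order ?r" by (rule card_of_Well_order)
  then have wf: "wf (?r - Id)" using well_order_on_def by blast
  have ex: "\<exists>y. i \<in> I \<longrightarrow> y \<in> F i \<and> y \<notin> f ` underS ?r i" for f :: "'a \<Rightarrow> 'b" and i
  proof (cases "i \<in> I")
    case True
    have "|f ` underS ?r i| \<le>o |underS ?r i|" by (rule card_of_image)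
    also have "|underS ?r i| <o ?r"
      using card_of_underS[OF card_of_Card_order] True by (simp add: Field_card_of)
    also have "?r \<le>o |F i|" using assms True .
    finally have "\<not> F i \<subseteq> f ` underS ?r i" using card_of_mono1 not_ordLess_ordLeq by blast
    then show ?thesis by blast
  qed simp
  have im: "f ` underS ?r i = g ` underS ?r i"
    if "\<And>z. (z, i) \<in> ?r - Id \<Longrightarrow> f z = g z" for f g :: "'a \<Rightarrow> 'b" and i
    using that by (intro image_cong refl) (auto simp: underS_def)
  have "\<exists>x. \<forall>i. i \<in> I \<longrightarrow> x i \<in> F i \<and> x i \<notin> x ` underS ?r i"
  proof (rule dependent_wf_choice[OF wf])
    fix f g :: "'a \<Rightarrow> 'b" and i y assume "\<And>z. (z, i) \<in> ?r - Id \<Longrightarrow> f z = g z"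
    then have "f ` underS ?r i = g ` underS ?r i" by (rule im)
    then show "(i \<in> I \<longrightarrow> y \<in> F i \<and> y \<notin> f ` underS ?r i) = (i \<in> I \<longrightarrow> y \<in> F i \<and> y \<notin> g ` underS ?r i)"
      by (simp only:)
  qed (rule ex)
  then obtain x where x: "\<And>i. i \<in> I \<Longrightarrow> x i \<in> F i \<and> x i \<notin> x ` underS ?r i" by blast
  have "inj_on x I"
  proof (rule inj_onI, rule ccontr)
    fix i j assume ij: "i \<in> I" "j \<in> I" "x i = x j" "i \<noteq> j"
    then have "i \<in> underS ?r j \<or> j \<in> underS ?r i"
      using wo unfolding well_order_on_def linear_order_on_def total_on_def underS_def
      by (auto simp: Field_card_of)
    then show False using x[OF ij(1)] x[OF ij(2)] ij(3) by (metis imageI)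
  qed
  then show ?thesis using x by blast
qed

text \<open>
  A function into a power set is its graph, a subset of \<open>C \<times> C\<close>; in cardinals, \<open>(2\<^sup>\<mu>)\<^sup>\<mu> = 2\<^sup>\<mu>\<close>.
\<close>

lemma card_of_Func_Pow_le:
  assumes "infinite C"
  shows "|Func C (Pow C)| \<le>o |Pow C|"
proof -
  have "|Func C (Pow C)| \<le>o |Pow (C \<times> C)|"
  proof (rule card_of_ordLeqI[of "\<lambda>f. {(a, b). a \<in> C \<and> b \<in> f a}"])
    show "inj_on (\<lambda>f. {(a, b). a \<in> C \<and> b \<in> f a}) (Func C (Pow C))"
    proof (rule inj_onI)
      fix f g :: "'a \<Rightarrow> 'a set" assume fg: "f \<in> Func C (Pow C)" "g \<in> Func C (Pow C)"
        and eq: "{(a, b). a \<in> C \<and> b \<in> f a} = {(a, b). a \<in> C \<and> b \<in> g a}"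
      show "f = g"
      proof
        fix a
        have "b \<in> f a \<longleftrightarrow> b \<in> g a" if "a \<in> C" for b
          using eq that by (auto simp: set_eq_iff)
        then show "f a = g a" using fg unfolding Func_def by (cases "a \<in> C") auto
      qed
    qed
  qed (auto simp: Func_def)
  then show ?thesis using card_of_Pow_Times_self[OF assms] ordLeq_ordIso_trans by blast
qed

section \<open>Rings of countable compact open sets\<close>

text \<open>
  The ring of compact open sets of a zero-dimensional, locally compact, locally countable Hausdorff space determines the
  space. Working with such rings instead of topologies reduces every construction to closure under
  union and difference and to one compactness argument, and closure under difference makes every
  member closed as well as open.
\<close>

definition compact_ring :: "'a set set \<Rightarrow> bool" where
  "compact_ring \<K> \<longleftrightarrow> {} \<in> \<K> \<and> (\<forall>K\<in>\<K>. \<forall>L\<in>\<K>. K \<union> L \<in> \<K> \<and> K - L \<in> \<K>) \<and> (\<forall>K\<in>\<K>. countable K) \<and>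
     (\<forall>K\<in>\<K>. \<forall>\<C>\<subseteq>\<K>. K \<subseteq> \<Union>\<C> \<longrightarrow> (\<exists>\<C>'\<subseteq>\<C>. finite \<C>' \<and> K \<subseteq> \<Union>\<C>'))"

lemma compact_ringI:
  assumes "{} \<in> \<K>" "\<And>K L. \<lbrakk>K \<in> \<K>; L \<in> \<K>\<rbrakk> \<Longrightarrow> K \<union> L \<in> \<K>" "\<And>K L. \<lbrakk>K \<in> \<K>; L \<in> \<K>\<rbrakk> \<Longrightarrow> K - L \<in> \<K>"
    "\<And>K. K \<in> \<K> \<Longrightarrow> countable K"
    "\<And>K \<C>. \<lbrakk>K \<in> \<K>; \<C> \<subseteq> \<K>; K \<subseteq> \<Union>\<C>\<rbrakk> \<Longrightarrow> \<exists>\<C>'\<subseteq>\<C>. finite \<C>' \<and> K \<subseteq> \<Union>\<C>'"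
  shows "compact_ring \<K>"
  unfolding compact_ring_def by (intro conjI ballI allI impI assms(1)) (rule assms(2-); assumption)+

lemma compact_ring_empty: "compact_ring \<K> \<Longrightarrow> {} \<in> \<K>"
  unfolding compact_ring_def by (rule conjunct1)

lemma compact_ring_Un: "\<lbrakk>compact_ring \<K>; K \<in> \<K>; L \<in> \<K>\<rbrakk> \<Longrightarrow> K \<union> L \<in> \<K>"
  and compact_ring_Diff: "\<lbrakk>compact_ring \<K>; K \<in> \<K>; L \<in> \<K>\<rbrakk> \<Longrightarrow> K - L \<in> \<K>"
  unfolding compact_ring_def by (drule conjunct2, drule conjunct1, blast)+

lemma compact_ring_countable: "\<lbrakk>compact_ring \<K>; K \<in> \<K>\<rbrakk> \<Longrightarrow> countable K"
  unfolding compact_ring_def by (drule conjunct2, drule conjunct2, drule conjunct1, blast)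

lemma compact_ring_Int: "\<lbrakk>compact_ring \<K>; K \<in> \<K>; L \<in> \<K>\<rbrakk> \<Longrightarrow> K \<inter> L \<in> \<K>"
  using compact_ring_Diff[of \<K> K "K - L"] compact_ring_Diff[of \<K> K L] by (simp add: Diff_Diff_Int)

lemma compact_ring_UN:
  assumes "compact_ring \<K>" "finite J" "\<And>j. j \<in> J \<Longrightarrow> K j \<in> \<K>"
  shows "(\<Union>j\<in>J. K j) \<in> \<K>"
  using assms(2,3) by induction (auto simp: compact_ring_empty[OF assms(1)] compact_ring_Un[OF assms(1)])

lemma compact_ring_compact:
  assumes K: "compact_ring \<K>" "K \<in> \<K>" and C: "\<C> \<subseteq> \<K>" "K \<subseteq> \<Union>\<C>"
  shows "\<exists>\<C>'\<subseteq>\<C>. finite \<C>' \<and> K \<subseteq> \<Union>\<C>'"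
proof -
  have "\<forall>K\<in>\<K>. \<forall>\<C>\<subseteq>\<K>. K \<subseteq> \<Union>\<C> \<longrightarrow> (\<exists>\<C>'\<subseteq>\<C>. finite \<C>' \<and> K \<subseteq> \<Union>\<C>')"
    using K(1) unfolding compact_ring_def by (elim conjE)
  from this[THEN bspec, OF K(2), THEN spec, THEN mp, OF C(1), THEN mp, OF C(2)] show ?thesis .
qed

lemma compact_ring_subcover:
  assumes "compact_ring \<K>" "K \<in> \<K>" "\<And>j. j \<in> J \<Longrightarrow> C j \<in> \<K>" "K \<subseteq> (\<Union>j\<in>J. C j)"
  obtains J' where "J' \<subseteq> J" "finite J'" "K \<subseteq> (\<Union>j\<in>J'. C j)"
proof -
  have "C ` J \<subseteq> \<K>" "K \<subseteq> \<Union>(C ` J)" using assms(3,4) by auto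
  then have "\<exists>\<C>'\<subseteq>C ` J. finite \<C>' \<and> K \<subseteq> \<Union>\<C>'"
    by (rule compact_ring_compact[OF assms(1,2)])
  then obtain \<C>' where C': "\<C>' \<subseteq> C ` J" "finite \<C>'" "K \<subseteq> \<Union>\<C>'" by (elim exE conjE)
  obtain J' where "J' \<subseteq> J" "finite J'" "\<C>' = C ` J'" using finite_subset_image[OF C'(2,1)] by (elim exE conjE)
  then show ?thesis using that \<open>K \<subseteq> \<Union>\<C>'\<close> by blast
qed

text \<open>
  The discrete space.
\<close>

lemma compact_ring_Fpow: "compact_ring (Fpow A)"
proof (rule compact_ringI)
  fix K \<C> assume K: "K \<in> Fpow A" and C: "K \<subseteq> \<Union>\<C>"
  have "finite K" using K unfolding Fpow_def by simp
  from finite_subset_Union[OF this C] obtain \<F> where "finite \<F>" "\<F> \<subseteq> \<C>" "K \<subseteq> \<Union>\<F>" .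
  then show "\<exists>\<C>'\<subseteq>\<C>. finite \<C>' \<and> K \<subseteq> \<Union>\<C>'" by (intro exI[of _ \<F>] conjI)
qed (auto simp: Fpow_def countable_finite)

lemma Union_Fpow: "\<Union>(Fpow A) = A"
proof (intro equalityI subsetI)
  fix x assume "x \<in> A"
  then have "{x} \<in> Fpow A" unfolding Fpow_def by simp
  then show "x \<in> \<Union>(Fpow A)" by (rule UnionI) simp
qed (auto simp: Fpow_def)

definition sum_ring :: "'i set \<Rightarrow> ('i \<Rightarrow> 'a set set) \<Rightarrow> ('i \<times> 'a) set set" where
  "sum_ring I \<K> = {P. finite (fst ` P) \<and> fst ` P \<subseteq> I \<and> (\<forall>i\<in>I. Pair i -` P \<in> \<K> i)}"

lemma sum_ring_fiber: "\<lbrakk>P \<in> sum_ring I \<K>; i \<in> I\<rbrakk> \<Longrightarrow> Pair i -` P \<in> \<K> i"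
  unfolding sum_ring_def by blast

lemma sum_ring_Pair:
  assumes "\<And>i. i \<in> I \<Longrightarrow> {} \<in> \<K> i" "i \<in> I" "K \<in> \<K> i"
  shows "Pair i ` K \<in> sum_ring I \<K>"
proof -
  have "Pair j -` Pair i ` K = (if j = i then K else {})" for j by auto
  then show ?thesis using assms unfolding sum_ring_def by (auto simp: image_image image_constant_conv)
qed

lemma sum_ring_decomp: "P = (\<Union>i\<in>fst ` P. Pair i ` (Pair i -` P))" by force

lemma Union_sum_ring:
  assumes "\<And>i. i \<in> I \<Longrightarrow> {} \<in> \<K> i"
  shows "\<Union>(sum_ring I \<K>) = (SIGMA i:I. \<Union>(\<K> i))"
proof
  show "(SIGMA i:I. \<Union>(\<K> i)) \<subseteq> \<Union>(sum_ring I \<K>)"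
  proof
    fix x assume "x \<in> (SIGMA i:I. \<Union>(\<K> i))"
    then obtain i y K where "x = (i, y)" "i \<in> I" "K \<in> \<K> i" "y \<in> K" by blast
    then show "x \<in> \<Union>(sum_ring I \<K>)" using sum_ring_Pair[of I \<K> i K] assms by blast
  qed
next
  show "\<Union>(sum_ring I \<K>) \<subseteq> (SIGMA i:I. \<Union>(\<K> i))"
  proof
    fix x assume "x \<in> \<Union>(sum_ring I \<K>)"
    then obtain P where P: "P \<in> sum_ring I \<K>" "x \<in> P" by blast
    then have "fst x \<in> I" unfolding sum_ring_def by blast
    moreover have "snd x \<in> Pair (fst x) -` P" using P by simp
    ultimately have "snd x \<in> \<Union>(\<K> (fst x))" using sum_ring_fiber[OF P(1)] by blast
    then show "x \<in> (SIGMA i:I. \<Union>(\<K> i))" using \<open>fst x \<in> I\<close> by (metis SigmaI prod.collapse)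
  qed
qed

lemma compact_ring_sum_ring:
  assumes K: "\<And>i. i \<in> I \<Longrightarrow> compact_ring (\<K> i)"
  shows "compact_ring (sum_ring I \<K>)"
proof (rule compact_ringI)
  show "{} \<in> sum_ring I \<K>" using K compact_ring_empty unfolding sum_ring_def by auto
next
  fix P P' assume P: "P \<in> sum_ring I \<K>" "P' \<in> sum_ring I \<K>"
  then show "P \<union> P' \<in> sum_ring I \<K>"
    unfolding sum_ring_def by (auto simp: image_Un vimage_Un intro!: compact_ring_Un K)
  have "fst ` (P - P') \<subseteq> fst ` P" by blast
  then show "P - P' \<in> sum_ring I \<K>"
    using P unfolding sum_ring_def
    by (auto simp: vimage_Diff intro!: compact_ring_Diff K intro: finite_subset)
next
  fix P assume P: "P \<in> sum_ring I \<K>"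
  have "countable (\<Union>i\<in>fst ` P. Pair i ` (Pair i -` P))"
  proof (rule countable_UN)
    show "countable (fst ` P)" using P unfolding sum_ring_def by (simp add: countable_finite)
    fix i assume "i \<in> fst ` P"
    then have "i \<in> I" using P unfolding sum_ring_def by blast
    then have "countable (Pair i -` P)" using K sum_ring_fiber[OF P] compact_ring_countable by blast
    then show "countable (Pair i ` (Pair i -` P))" by (rule countable_image)
  qed
  then show "countable P" by (subst sum_ring_decomp)
next
  fix P \<C> assume P: "P \<in> sum_ring I \<K>" "\<C> \<subseteq> sum_ring I \<K>" "P \<subseteq> \<Union>\<C>"
  have "\<exists>\<D>\<subseteq>\<C>. finite \<D> \<and> Pair i -` P \<subseteq> (\<Union>C\<in>\<D>. Pair i -` C)" if "i \<in> fst ` P" for i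
  proof -
    have i: "i \<in> I" using P that unfolding sum_ring_def by blast
    have "Pair i -` P \<subseteq> (\<Union>C\<in>\<C>. Pair i -` C)" using P(3) by blast
    moreover have "Pair i -` C \<in> \<K> i" if "C \<in> \<C>" for C by (rule sum_ring_fiber[OF subsetD[OF P(2) that] i])
    ultimately obtain \<D> where "\<D> \<subseteq> \<C>" "finite \<D>" "Pair i -` P \<subseteq> (\<Union>C\<in>\<D>. Pair i -` C)"
      using compact_ring_subcover[OF K[OF i] sum_ring_fiber[OF P(1) i], of \<C> "\<lambda>C. Pair i -` C"] by blast
    then show ?thesis by (intro exI[of _ \<D>] conjI)
  qed
  from bchoice[OF ballI[OF this]] obtain \<D> where
    "\<forall>i\<in>fst ` P. \<D> i \<subseteq> \<C> \<and> finite (\<D> i) \<and> Pair i -` P \<subseteq> (\<Union>C\<in>\<D> i. Pair i -` C)" by (rule exE)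
  note D = bspec[OF this]
  show "\<exists>\<C>'\<subseteq>\<C>. finite \<C>' \<and> P \<subseteq> \<Union>\<C>'"
  proof (intro exI[of _ "\<Union>i\<in>fst ` P. \<D> i"] conjI)
    show "(\<Union>i\<in>fst ` P. \<D> i) \<subseteq> \<C>" using D by blast
    show "finite (\<Union>i\<in>fst ` P. \<D> i)" using D P(1) unfolding sum_ring_def by blast
    show "P \<subseteq> \<Union>(\<Union>i\<in>fst ` P. \<D> i)"
    proof
      fix x assume x: "x \<in> P"
      then have "snd x \<in> Pair (fst x) -` P" by simp
      then obtain C where "C \<in> \<D> (fst x)" "x \<in> C" using D[of "fst x"] x by fastforce
      then show "x \<in> \<Union>(\<Union>i\<in>fst ` P. \<D> i)" using x by blast
    qed
  qed
qed

text \<open>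
  The disjoint union of a base with ring \<open>\<Q>\<close>, which is to be open, and new points with ring \<open>\<W>\<close>, which are to be closed.
  The set \<open>R w\<close> consists of the points of the base close to the new point \<open>w\<close>: a compact open set \<open>P\<close> of new points becomes
  compact open together with all \<open>R w\<close>, \<open>w \<in> P\<close>, up to a compact error. That the part in the base is clopen is
  expressed by intersecting it with compact open sets.
\<close>

definition attach :: "'q set set \<Rightarrow> 'w set set \<Rightarrow> ('w \<Rightarrow> 'q set) \<Rightarrow> ('q + 'w) set set" where
  "attach \<Q> \<W> R = {M. Inr -` M \<in> \<W> \<and> Inl -` M \<subseteq> \<Union>\<Q> \<and> (\<forall>K\<in>\<Q>. Inl -` M \<inter> K \<in> \<Q>) \<and>
     (\<exists>K\<in>\<Q>. Inl -` M - K = (\<Union>w\<in>Inr -` M. R w) - K)}"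

lemma eq_outside_Un: "\<lbrakk>A - K = B - K; A' - K' = B' - K'\<rbrakk> \<Longrightarrow> (A \<union> A') - (K \<union> K') = (B \<union> B') - (K \<union> K')"
  unfolding set_eq_iff by (intro allI) (simp, metis)

lemma eq_outside_Diff:
  "\<lbrakk>A - K = B - K; A' - K' = B' - K'; B - B' - J = C - J\<rbrakk> \<Longrightarrow> A - A' - (K \<union> K' \<union> J) = C - (K \<union> K' \<union> J)"
  unfolding set_eq_iff by (intro allI) (simp, metis)

text \<open>
  The trace of a compact open set of new points must be clopen in the base, and disjoint compact open sets must have
  traces that are disjoint up to a compact set. This is exactly what makes the trace a homomorphism modulo
  compact sets, hence \<open>attach\<close> closed under differences.
\<close>

locale attachment =
  fixes \<Q> :: "'q set set" and \<W> :: "'w set set" and R :: "'w \<Rightarrow> 'q set"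
  assumes ring_base: "compact_ring \<Q>" and ring_new: "compact_ring \<W>"
    and countable_trace: "\<And>w. countable (R w)" and trace_subset: "\<And>w. R w \<subseteq> \<Union>\<Q>"
    and trace_clopen: "\<And>P K. \<lbrakk>P \<in> \<W>; K \<in> \<Q>\<rbrakk> \<Longrightarrow> (\<Union>w\<in>P. R w) \<inter> K \<in> \<Q>"
    and trace_disjoint: "\<And>P P'. \<lbrakk>P \<in> \<W>; P' \<in> \<W>; P \<inter> P' = {}\<rbrakk> \<Longrightarrow>
      \<exists>K\<in>\<Q>. (\<Union>w\<in>P. R w) \<inter> (\<Union>w\<in>P'. R w) \<subseteq> K"
begin

lemma attachI:
  assumes "K \<in> \<Q>" "Inl -` M - K = (\<Union>w\<in>Inr -` M. R w) - K" "Inr -` M \<in> \<W>" "Inl -` M \<subseteq> \<Union>\<Q>"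
    "\<And>K. K \<in> \<Q> \<Longrightarrow> Inl -` M \<inter> K \<in> \<Q>"
  shows "M \<in> attach \<Q> \<W> R"
  unfolding attach_def by (intro CollectI conjI ballI bexI[of _ K] assms)

lemma attach_trace:
  assumes "M \<in> attach \<Q> \<W> R"
  obtains K where "K \<in> \<Q>" "Inl -` M - K = (\<Union>w\<in>Inr -` M. R w) - K"
  using assms unfolding attach_def mem_Collect_eq by (elim conjE bexE)

lemma attach_new_part: "M \<in> attach \<Q> \<W> R \<Longrightarrow> Inr -` M \<in> \<W>"
  and attach_base_part: "M \<in> attach \<Q> \<W> R \<Longrightarrow> Inl -` M \<subseteq> \<Union>\<Q>"
  unfolding attach_def mem_Collect_eq by (elim conjE, assumption)+

lemma attach_base_clopen: "\<lbrakk>M \<in> attach \<Q> \<W> R; K \<in> \<Q>\<rbrakk> \<Longrightarrow> Inl -` M \<inter> K \<in> \<Q>"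
  unfolding attach_def mem_Collect_eq by (elim conjE) (drule bspec, assumption)

lemma attach_base:
  assumes K: "K \<in> \<Q>" shows "Inl ` K \<in> attach \<Q> \<W> R" (is "?M \<in> _")
proof (rule attachI)
  have eq: "Inl -` ?M = K" "Inr -` ?M = {}" by auto
  show "K \<in> \<Q>" by fact
  show "Inl -` ?M - K = (\<Union>w\<in>Inr -` ?M. R w) - K" unfolding eq by simp
  show "Inr -` ?M \<in> \<W>" unfolding eq using compact_ring_empty[OF ring_new] .
  show "Inl -` ?M \<subseteq> \<Union>\<Q>" unfolding eq using K by blast
  show "Inl -` ?M \<inter> L \<in> \<Q>" if "L \<in> \<Q>" for L unfolding eq using compact_ring_Int[OF ring_base K that] .
qed

lemma attach_new:
  assumes P: "P \<in> \<W>" shows "Inl ` (\<Union>w\<in>P. R w) \<union> Inr ` P \<in> attach \<Q> \<W> R" (is "?M \<in> _")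
proof (rule attachI)
  have eq: "Inl -` ?M = (\<Union>w\<in>P. R w)" "Inr -` ?M = P" by auto
  show "{} \<in> \<Q>" using compact_ring_empty[OF ring_base] .
  show "Inl -` ?M - {} = (\<Union>w\<in>Inr -` ?M. R w) - {}" unfolding eq by simp
  show "Inr -` ?M \<in> \<W>" unfolding eq by fact
  show "Inl -` ?M \<subseteq> \<Union>\<Q>" unfolding eq using trace_subset by blast
  show "Inl -` ?M \<inter> L \<in> \<Q>" if "L \<in> \<Q>" for L unfolding eq using trace_clopen[OF P that] .
qed

lemma Union_attach: "\<Union>(attach \<Q> \<W> R) = Inl ` \<Union>\<Q> \<union> Inr ` \<Union>\<W>"
proof (intro equalityI subsetI)
  fix x assume "x \<in> \<Union>(attach \<Q> \<W> R)"
  then obtain M where M: "M \<in> attach \<Q> \<W> R" "x \<in> M" by blast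
  show "x \<in> Inl ` \<Union>\<Q> \<union> Inr ` \<Union>\<W>"
  proof (cases x)
    case (Inl q)
    then have "q \<in> \<Union>\<Q>" using attach_base_part[OF M(1)] M(2) by auto
    then show ?thesis using Inl by blast
  next
    case (Inr w)
    then have "w \<in> Inr -` M" using M(2) by simp
    then have "w \<in> \<Union>\<W>" using attach_new_part[OF M(1)] by blast
    then show ?thesis using Inr by blast
  qed
next
  fix x assume "x \<in> Inl ` \<Union>\<Q> \<union> Inr ` \<Union>\<W>"
  then consider q K where "x = Inl q" "K \<in> \<Q>" "q \<in> K" | w P where "x = Inr w" "P \<in> \<W>" "w \<in> P" by blast
  then show "x \<in> \<Union>(attach \<Q> \<W> R)"
  proof cases
    case 1
    then show ?thesis using attach_base[of K] by blast
  next
    case 2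
    then show ?thesis using attach_new[of P] by blast
  qed
qed

text \<open>
  Compactness: finitely many members of a cover already cover the new points, and therefore, up to a
  compact set, the trace; the rest of the base part lies in a compact set of the base.
\<close>

lemma compact_ring_attach: "compact_ring (attach \<Q> \<W> R)"
proof (rule compact_ringI)
  show "{} \<in> attach \<Q> \<W> R" using attach_base[OF compact_ring_empty[OF ring_base]] by simp
next
  fix M M' assume M: "M \<in> attach \<Q> \<W> R" and M': "M' \<in> attach \<Q> \<W> R"
  obtain K where K: "K \<in> \<Q>" "Inl -` M - K = (\<Union>w\<in>Inr -` M. R w) - K" using M by (rule attach_trace)
  obtain K' where K': "K' \<in> \<Q>" "Inl -` M' - K' = (\<Union>w\<in>Inr -` M'. R w) - K'" using M' by (rule attach_trace)
  note MW = attach_new_part[OF M] and MQ = attach_base_part[OF M] attach_base_clopen[OF M]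
  note MW' = attach_new_part[OF M'] and MQ' = attach_base_part[OF M'] attach_base_clopen[OF M']
  show "M \<union> M' \<in> attach \<Q> \<W> R"
  proof (rule attachI)
    show "K \<union> K' \<in> \<Q>" using compact_ring_Un[OF ring_base K(1) K'(1)] .
    show "Inl -` (M \<union> M') - (K \<union> K') = (\<Union>w\<in>Inr -` (M \<union> M'). R w) - (K \<union> K')"
      unfolding vimage_Un UN_Un by (rule eq_outside_Un[OF K(2) K'(2)])
    show "Inr -` (M \<union> M') \<in> \<W>" using compact_ring_Un[OF ring_new MW MW'] by simp
    show "Inl -` (M \<union> M') \<subseteq> \<Union>\<Q>" using MQ(1) MQ'(1) by auto
    show "Inl -` (M \<union> M') \<inter> L \<in> \<Q>" if "L \<in> \<Q>" for L
      using compact_ring_Un[OF ring_base MQ(2)[OF that] MQ'(2)[OF that]] by (simp add: Int_Un_distrib2)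
  qed
  \<comment> \<open>The trace of a difference differs from the difference of the traces only inside a compact set, because disjoint compact
    sets have almost disjoint traces.\<close>
  have "Inr -` M - Inr -` M' \<in> \<W>" using compact_ring_Diff[OF ring_new MW MW'] .
  moreover have "(Inr -` M - Inr -` M') \<inter> Inr -` M' = {}" by blast
  ultimately obtain J where J: "J \<in> \<Q>" "(\<Union>w\<in>Inr -` M - Inr -` M'. R w) \<inter> (\<Union>w\<in>Inr -` M'. R w) \<subseteq> J"
    using trace_disjoint[OF _ MW'] by blast
  show "M - M' \<in> attach \<Q> \<W> R"
  proof (rule attachI)
    show "K \<union> K' \<union> J \<in> \<Q>"
      using compact_ring_Un[OF ring_base compact_ring_Un[OF ring_base K(1) K'(1)] J(1)] .
    have "(\<Union>w\<in>Inr -` M. R w) - (\<Union>w\<in>Inr -` M'. R w) - J = (\<Union>w\<in>Inr -` M - Inr -` M'. R w) - J"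
      using J(2) by auto
    then show "Inl -` (M - M') - (K \<union> K' \<union> J) = (\<Union>w\<in>Inr -` (M - M'). R w) - (K \<union> K' \<union> J)"
      unfolding vimage_Diff by (rule eq_outside_Diff[OF K(2) K'(2)])
    show "Inr -` (M - M') \<in> \<W>" using compact_ring_Diff[OF ring_new MW MW'] by (simp add: vimage_Diff)
    show "Inl -` (M - M') \<subseteq> \<Union>\<Q>" using MQ(1) by auto
    show "Inl -` (M - M') \<inter> L \<in> \<Q>" if "L \<in> \<Q>" for L
    proof -
      have "Inl -` (M - M') \<inter> L = Inl -` M \<inter> L - Inl -` M' \<inter> L" by auto
      then show ?thesis using compact_ring_Diff[OF ring_base MQ(2)[OF that] MQ'(2)[OF that]] by simp
    qed
  qed
next
  fix M assume M: "M \<in> attach \<Q> \<W> R"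
  obtain K where K: "K \<in> \<Q>" "Inl -` M - K = (\<Union>w\<in>Inr -` M. R w) - K" using M by (rule attach_trace)
  note MW = attach_new_part[OF M]
  have cW: "countable (Inr -` M)" using compact_ring_countable[OF ring_new MW] .
  have "Inl -` M \<subseteq> (\<Union>w\<in>Inr -` M. R w) \<union> K" using K(2) by blast
  moreover have "countable ((\<Union>w\<in>Inr -` M. R w) \<union> K)"
    using cW countable_trace compact_ring_countable[OF ring_base K(1)] by simp
  ultimately have "countable (Inl -` M)" by (rule countable_subset)
  then have "countable (Inl ` (Inl -` M) \<union> Inr ` (Inr -` M))" using cW by (intro countable_Un countable_image)
  moreover have "M \<subseteq> Inl ` (Inl -` M) \<union> Inr ` (Inr -` M)"
  proof
    fix x assume "x \<in> M"
    then show "x \<in> Inl ` (Inl -` M) \<union> Inr ` (Inr -` M)" by (cases x) auto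
  qed
  ultimately show "countable M" using countable_subset by blast
next
  fix M \<C> assume M: "M \<in> attach \<Q> \<W> R" and C: "\<C> \<subseteq> attach \<Q> \<W> R" "M \<subseteq> \<Union>\<C>"
  obtain K where K: "K \<in> \<Q>" "Inl -` M - K = (\<Union>w\<in>Inr -` M. R w) - K" using M by (rule attach_trace)
  note MW = attach_new_part[OF M] and MQ = attach_base_clopen[OF M]
  have CW: "Inr -` C \<in> \<W>" and CQ: "\<And>K. K \<in> \<Q> \<Longrightarrow> Inl -` C \<inter> K \<in> \<Q>" if "C \<in> \<C>" for C
    using that C(1) attach_new_part attach_base_clopen by blast+
  have "Inr -` M \<subseteq> (\<Union>C\<in>\<C>. Inr -` C)" using C(2) by blast
  then obtain \<D> where D: "\<D> \<subseteq> \<C>" "finite \<D>" "Inr -` M \<subseteq> (\<Union>C\<in>\<D>. Inr -` C)"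
    by (rule compact_ring_subcover[OF ring_new MW CW, rotated]) 
  have "\<exists>K. K \<in> \<Q> \<and> Inl -` C - K = (\<Union>w\<in>Inr -` C. R w) - K" if "C \<in> \<D>" for C
  proof -
    have "C \<in> attach \<Q> \<W> R" using that C(1) D(1) by blast
    then show ?thesis by (rule attach_trace) (intro exI conjI)
  qed
  from bchoice[OF ballI[OF this]] obtain k where
    "\<forall>C\<in>\<D>. k C \<in> \<Q> \<and> Inl -` C - k C = (\<Union>w\<in>Inr -` C. R w) - k C" by (rule exE)
  note k = bspec[OF this]
  \<comment> \<open>What the finite family leaves uncovered lies in the base, inside a compact set.\<close>
  let ?J = "K \<union> (\<Union>C\<in>\<D>. k C)"
  have J: "?J \<in> \<Q>" using compact_ring_Un[OF ring_base K(1) compact_ring_UN[OF ring_base D(2) conjunct1[OF k]]] .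
  have cov: "Inl -` M - ?J \<subseteq> (\<Union>C\<in>\<D>. Inl -` C)"
  proof
    fix q assume q: "q \<in> Inl -` M - ?J"
    then have "q \<in> (\<Union>w\<in>Inr -` M. R w) - K" using K(2) by blast
    then obtain w where w: "w \<in> Inr -` M" "q \<in> R w" by blast
    then obtain C where C: "C \<in> \<D>" "w \<in> Inr -` C" using D(3) by blast
    then have "q \<in> (\<Union>w\<in>Inr -` C. R w) - k C" using q w(2) by blast
    then have "q \<in> Inl -` C" using conjunct2[OF k[OF C(1)]] by blast
    then show "q \<in> (\<Union>C\<in>\<D>. Inl -` C)" using C(1) by blast
  qed
  have "Inl -` M \<inter> ?J \<subseteq> (\<Union>C\<in>\<C>. Inl -` C \<inter> ?J)" using C(2) by blast
  then obtain \<E> where E: "\<E> \<subseteq> \<C>" "finite \<E>" "Inl -` M \<inter> ?J \<subseteq> (\<Union>C\<in>\<E>. Inl -` C \<inter> ?J)"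
    by (rule compact_ring_subcover[OF ring_base MQ[OF J] CQ[OF _ J], rotated])
  show "\<exists>\<C>'\<subseteq>\<C>. finite \<C>' \<and> M \<subseteq> \<Union>\<C>'"
  proof (intro exI[of _ "\<D> \<union> \<E>"] conjI)
    show "M \<subseteq> \<Union>(\<D> \<union> \<E>)"
    proof
      fix x assume x: "x \<in> M"
      show "x \<in> \<Union>(\<D> \<union> \<E>)"
      proof (cases x)
        case (Inl q)
        then show ?thesis using x cov E(3) by (cases "q \<in> ?J") auto
      next
        case (Inr w)
        then show ?thesis using x D(3) by auto
      qed
    qed
  qed (use D E in auto)
qed

end

text \<open>
  The closed subspace that remains after the isolated points \<open>N\<close> have been removed.
\<close>

definition residue :: "'a set set \<Rightarrow> 'a set \<Rightarrow> 'a set set" where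
  "residue \<K> N = (\<lambda>K. K - N) ` \<K>"

lemma Union_residue: "\<Union>(residue \<K> N) = \<Union>\<K> - N"
  unfolding residue_def by blast

lemma compact_ring_residue:
  assumes K: "compact_ring \<K>" and N: "\<And>z. z \<in> N \<Longrightarrow> {z} \<in> \<K>"
  shows "compact_ring (residue \<K> N)"
proof (rule compact_ringI)
  show "{} \<in> residue \<K> N" unfolding residue_def using compact_ring_empty[OF K] by force
next
  fix A B assume "A \<in> residue \<K> N" "B \<in> residue \<K> N"
  then obtain K L where KL: "K \<in> \<K>" "A = K - N" "L \<in> \<K>" "B = L - N" unfolding residue_def by blast
  have "A \<union> B = (K \<union> L) - N" "A - B = (K - L) - N" using KL by auto
  then show "A \<union> B \<in> residue \<K> N" "A - B \<in> residue \<K> N"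
    unfolding residue_def using compact_ring_Un[OF K KL(1,3)] compact_ring_Diff[OF K KL(1,3)] by blast+
next
  show "countable A" if "A \<in> residue \<K> N" for A
    using that compact_ring_countable[OF K] unfolding residue_def by auto
next
  fix A \<C> assume A: "A \<in> residue \<K> N" "\<C> \<subseteq> residue \<K> N" "A \<subseteq> \<Union>\<C>"
  obtain K where k: "K \<in> \<K>" "A = K - N" using A(1) unfolding residue_def by blast
  have "\<exists>L. L \<in> \<K> \<and> C = L - N" if "C \<in> \<C>" for C using A(2) that unfolding residue_def by blast
  from bchoice[OF ballI[OF this]] obtain l where "\<forall>C\<in>\<C>. l C \<in> \<K> \<and> C = l C - N" by (rule exE)
  note l = bspec[OF this]
  \<comment> \<open>The removed points are covered by singletons, which may be discarded afterwards.\<close>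
  define c where "c = case_sum l (\<lambda>z. {z})"
  have "c j \<in> \<K>" if "j \<in> Inl ` \<C> \<union> Inr ` N" for j using that l N unfolding c_def by auto
  moreover have "K \<subseteq> (\<Union>j\<in>Inl ` \<C> \<union> Inr ` N. c j)"
  proof
    fix x assume x: "x \<in> K"
    show "x \<in> (\<Union>j\<in>Inl ` \<C> \<union> Inr ` N. c j)"
    proof (cases "x \<in> N")
      case True
      then show ?thesis unfolding c_def by auto
    next
      case False
      then obtain C where "C \<in> \<C>" "x \<in> C" using x k A(3) by blast
      then have "x \<in> c (Inl C)" using l unfolding c_def by auto
      then show ?thesis using \<open>C \<in> \<C>\<close> by blast
    qed
  qed
  ultimately obtain J where J: "J \<subseteq> Inl ` \<C> \<union> Inr ` N" "finite J" "K \<subseteq> (\<Union>j\<in>J. c j)"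
    by (rule compact_ring_subcover[OF K k(1)])
  show "\<exists>\<C>'\<subseteq>\<C>. finite \<C>' \<and> A \<subseteq> \<Union>\<C>'"
  proof (intro exI[of _ "Inl -` J"] conjI)
    show "Inl -` J \<subseteq> \<C>" using J(1) by auto
    show "finite (Inl -` J)" using J(2) by (simp add: finite_vimageI)
    show "A \<subseteq> \<Union>(Inl -` J)"
    proof
      fix x assume x: "x \<in> A"
      then obtain j where j: "j \<in> J" "x \<in> c j" using J(3) k by blast
      show "x \<in> \<Union>(Inl -` J)"
      proof (cases j)
        case (Inl C)
        then have "C \<in> \<C>" using j J(1) by auto
        then show ?thesis using Inl j x k l unfolding c_def by auto
      next
        case (Inr z)
        then show ?thesis using j x k J(1) unfolding c_def by auto
      qed
    qed
  qed
qed

lemma inj_on_image_Diff: "\<lbrakk>inj_on h (\<Union>\<K>); K \<in> \<K>; L \<in> \<K>\<rbrakk> \<Longrightarrow> h ` (K - L) = h ` K - h ` L"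
  by (rule inj_on_image_set_diff[of h "\<Union>\<K>"]) auto

lemma compact_ring_image:
  assumes K: "compact_ring \<K>" and h: "inj_on h (\<Union>\<K>)"
  shows "compact_ring ((`) h ` \<K>)"
proof (rule compact_ringI)
  show "{} \<in> (`) h ` \<K>" using compact_ring_empty[OF K] by force
next
  fix A B assume "A \<in> (`) h ` \<K>" "B \<in> (`) h ` \<K>"
  then obtain K L where KL: "K \<in> \<K>" "A = h ` K" "L \<in> \<K>" "B = h ` L" by blast
  have "A \<union> B = h ` (K \<union> L)" "A - B = h ` (K - L)" using KL inj_on_image_Diff[OF h] by auto
  then show "A \<union> B \<in> (`) h ` \<K>" "A - B \<in> (`) h ` \<K>"
    using compact_ring_Un[OF K KL(1,3)] compact_ring_Diff[OF K KL(1,3)] by blast+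
next
  show "countable A" if "A \<in> (`) h ` \<K>" for A using that compact_ring_countable[OF K] by auto
next
  fix A \<C> assume A: "A \<in> (`) h ` \<K>" "\<C> \<subseteq> (`) h ` \<K>" "A \<subseteq> \<Union>\<C>"
  obtain K where k: "K \<in> \<K>" "A = h ` K" using A(1) by blast
  obtain \<D> where D: "\<D> \<subseteq> \<K>" "\<C> = (`) h ` \<D>" using A(2) by (meson subset_imageE)
  have "K \<subseteq> (\<Union>D\<in>\<D>. D)"
  proof
    fix x assume x: "x \<in> K"
    then obtain D' where "D' \<in> \<D>" "h x \<in> h ` D'" using k A(3) D(2) by blast
    then show "x \<in> (\<Union>D\<in>\<D>. D)" using x k(1) D(1) inj_onD[OF h] by blast
  qed
  then obtain \<E> where E: "\<E> \<subseteq> \<D>" "finite \<E>" "K \<subseteq> (\<Union>D\<in>\<E>. D)"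
    by (rule compact_ring_subcover[OF K k(1) subsetD[OF D(1)], rotated])
  show "\<exists>\<C>'\<subseteq>\<C>. finite \<C>' \<and> A \<subseteq> \<Union>\<C>'"
  proof (intro exI[of _ "(`) h ` \<E>"] conjI)
    show "A \<subseteq> \<Union>((`) h ` \<E>)" using E(3) k(2) by blast
  qed (use E D in auto)
qed

section \<open>Gluing graded spaces to a base\<close>

text \<open>
  The dense set \<open>N\<close> of isolated points is divided by \<open>g\<close> into countably many levels, each smaller than \<open>|\<Lambda>|\<close> and each
  meeting a compact set in a finite set only. The finiteness makes gluing possible: a compact set then involves only finitely
  many isolated points at each step of a sequence.
\<close>

locale graded =
  fixes \<Lambda> :: "'l set" and \<K> :: "'a set set" and N :: "'a set" and g :: "'a \<Rightarrow> nat"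
  assumes ring: "compact_ring \<K>"
    and isolated: "z \<in> N \<Longrightarrow> {z} \<in> \<K>"
    and dense: "\<lbrakk>K \<in> \<K>; K \<noteq> {}\<rbrakk> \<Longrightarrow> K \<inter> N \<noteq> {}"
    and finite_level: "K \<in> \<K> \<Longrightarrow> finite {z \<in> K \<inter> N. g z \<le> n}"
    and small_level: "|{z \<in> N. g z \<le> n}| <o |\<Lambda>|"

definition glue_trace :: "'i set \<Rightarrow> ('i \<Rightarrow> 'a set) \<Rightarrow> ('i \<Rightarrow> 'a \<Rightarrow> nat) \<Rightarrow> ('i \<Rightarrow> nat \<Rightarrow> 'a \<Rightarrow> 'q set) \<Rightarrow> 'i \<times> 'a \<Rightarrow> 'q set" where
  "glue_trace I N g c = (\<lambda>(i, z). if i \<in> I \<and> z \<in> N i then \<Union>k\<in>{g i z..}. c i k z else {})"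

lemma glue_trace_iff: "q \<in> glue_trace I N g c (i, z) \<longleftrightarrow> i \<in> I \<and> z \<in> N i \<and> (\<exists>k\<ge>g i z. q \<in> c i k z)"
  unfolding glue_trace_def by auto

text \<open>
  Graded pieces, indexed by \<open>I\<close>, are glued to a graded base. The isolated point \<open>z\<close> of piece \<open>i\<close> becomes the limit of the
  compact open sets \<open>c i k z\<close> of the base, for \<open>k \<rightarrow> \<infinity>\<close> starting at the level of \<open>z\<close>; the other points of the piece
  are limits of isolated ones and follow them. The sets for one piece are disjoint and leave every compact set
  (\<open>c_away\<close>), those for two pieces are eventually disjoint (\<open>c_apart\<close>), and those of index \<open>k\<close> contain isolated points of
  level at least \<open>k\<close> only, so that the result is graded by the isolated points of the base.
\<close>

locale gluing =
  fixes \<Lambda> :: "'l set" and \<Q> :: "'q set set" and M :: "'q set" and h :: "'q \<Rightarrow> nat"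
    and I :: "'i set" and \<K> :: "'i \<Rightarrow> 'a set set" and N :: "'i \<Rightarrow> 'a set" and g :: "'i \<Rightarrow> 'a \<Rightarrow> nat"
    and c :: "'i \<Rightarrow> nat \<Rightarrow> 'a \<Rightarrow> 'q set"
  assumes base: "graded \<Lambda> \<Q> M h"
    and pieces: "i \<in> I \<Longrightarrow> graded \<Lambda> (\<K> i) (N i) (g i)"
    and c_mem: "\<lbrakk>i \<in> I; z \<in> N i; g i z \<le> k\<rbrakk> \<Longrightarrow> c i k z \<in> \<Q>"
    and c_ne: "\<lbrakk>i \<in> I; z \<in> N i; g i z \<le> k\<rbrakk> \<Longrightarrow> c i k z \<noteq> {}"
    and c_disjoint: "\<lbrakk>i \<in> I; z \<in> N i; g i z \<le> k; z' \<in> N i; g i z' \<le> k'; (k, z) \<noteq> (k', z')\<rbrakk> \<Longrightarrow> c i k z \<inter> c i k' z' = {}"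
    and c_apart: "\<lbrakk>i \<in> I; j \<in> I; i \<noteq> j\<rbrakk> \<Longrightarrow> \<exists>m. \<forall>k\<ge>m. \<forall>k'\<ge>m. \<forall>z\<in>N i. \<forall>z'\<in>N j.
        g i z \<le> k \<longrightarrow> g j z' \<le> k' \<longrightarrow> c i k z \<inter> c j k' z' = {}"
    and c_away: "\<lbrakk>i \<in> I; K \<in> \<Q>\<rbrakk> \<Longrightarrow> \<exists>m. \<forall>k\<ge>m. \<forall>z\<in>N i. g i z \<le> k \<longrightarrow> K \<inter> c i k z = {}"
    and c_level: "\<lbrakk>i \<in> I; z \<in> N i; g i z \<le> k; q \<in> c i k z; q \<in> M\<rbrakk> \<Longrightarrow> k \<le> h q"
begin

abbreviation trace :: "'i \<times> 'a \<Rightarrow> 'q set" where "trace \<equiv> glue_trace I N g c"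
abbreviation glued :: "('q + 'i \<times> 'a) set set" where "glued \<equiv> attach \<Q> (sum_ring I \<K>) trace"

lemma base_ring: "compact_ring \<Q>"
  using base by (rule graded.ring)

lemma piece_ring: "i \<in> I \<Longrightarrow> compact_ring (\<K> i)"
  using pieces by (rule graded.ring)

text \<open>
  The part of the trace of \<open>U\<close> that belongs to indices below \<open>m\<close>. It is compact because \<open>U\<close> contains only finitely many
  isolated points of level below \<open>m\<close>, and all errors below are of this form.
\<close>

definition early :: "'i \<Rightarrow> 'a set \<Rightarrow> nat \<Rightarrow> 'q set" where
  "early i U m = (\<Union>(k, z)\<in>(SIGMA k:{..<m}. {z \<in> U \<inter> N i. g i z \<le> k}). c i k z)"

lemma early_mem:
  assumes i: "i \<in> I" and U: "U \<in> \<K> i"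
  shows "early i U m \<in> \<Q>"
  unfolding early_def
proof (rule compact_ring_UN[OF base_ring])
  show "finite (SIGMA k:{..<m}. {z \<in> U \<inter> N i. g i z \<le> k})"
    using graded.finite_level[OF pieces[OF i] U] by (intro finite_SigmaI) auto
qed (auto intro: c_mem i)

lemma trace_early:
  assumes q: "q \<in> trace (i, y)" "y \<in> U"
    and late: "\<And>k z. \<lbrakk>m \<le> k; z \<in> N i; g i z \<le> k\<rbrakk> \<Longrightarrow> q \<notin> c i k z"
  shows "q \<in> early i U m"
proof -
  obtain k where k: "y \<in> N i" "g i y \<le> k" "q \<in> c i k y" using q(1) unfolding glue_trace_iff by auto
  then have "k < m" using late[of k y] by (meson not_less)
  then show ?thesis unfolding early_def using k q(2) by auto
qed

lemma early_subset_trace: "i \<in> I \<Longrightarrow> early i U m \<subseteq> (\<Union>y\<in>U. trace (i, y))"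
  unfolding early_def by (fastforce simp: glue_trace_iff)

lemma piece_trace_clopen:
  assumes i: "i \<in> I" and U: "U \<in> \<K> i" and K: "K \<in> \<Q>"
  shows "(\<Union>y\<in>U. trace (i, y)) \<inter> K \<in> \<Q>"
proof -
  obtain m where m: "\<And>k z. \<lbrakk>m \<le> k; z \<in> N i; g i z \<le> k\<rbrakk> \<Longrightarrow> K \<inter> c i k z = {}"
    using c_away[OF i K] by blast
  have "(\<Union>y\<in>U. trace (i, y)) \<inter> K = early i U m \<inter> K"
  proof
    show "(\<Union>y\<in>U. trace (i, y)) \<inter> K \<subseteq> early i U m \<inter> K"
    proof
      fix q assume "q \<in> (\<Union>y\<in>U. trace (i, y)) \<inter> K"
      then obtain y where y: "y \<in> U" "q \<in> trace (i, y)" "q \<in> K" by blast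
      then have "q \<in> early i U m" using m by (intro trace_early[OF y(2,1)]) blast
      then show "q \<in> early i U m \<inter> K" using y(3) by blast
    qed
    show "early i U m \<inter> K \<subseteq> (\<Union>y\<in>U. trace (i, y)) \<inter> K" using early_subset_trace[OF i] by blast
  qed
  then show ?thesis using compact_ring_Int[OF base_ring early_mem[OF i U] K] by simp
qed

lemma piece_traces_disjoint:
  assumes i: "i \<in> I" and U: "U \<in> \<K> i" and j: "j \<in> I" and V: "V \<in> \<K> j" and UV: "i = j \<Longrightarrow> U \<inter> V = {}"
  shows "\<exists>K\<in>\<Q>. (\<Union>y\<in>U. trace (i, y)) \<inter> (\<Union>y\<in>V. trace (j, y)) \<subseteq> K"
proof (cases "i = j")
  case True
  have "q \<notin> trace (j, y')" if y: "y \<in> U" "q \<in> trace (i, y)" "y' \<in> V" for q y y'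
  proof
    assume "q \<in> trace (j, y')"
    then obtain k' where k': "y' \<in> N i" "g i y' \<le> k'" "q \<in> c i k' y'" unfolding glue_trace_iff using True by auto
    obtain k where k: "y \<in> N i" "g i y \<le> k" "q \<in> c i k y" using y(2) unfolding glue_trace_iff by auto
    have "y \<noteq> y'" using y(1,3) UV[OF True] by blast
    then show False using c_disjoint[OF i k(1,2) k'(1,2)] k(3) k'(3) by auto
  qed
  then have "(\<Union>y\<in>U. trace (i, y)) \<inter> (\<Union>y\<in>V. trace (j, y)) \<subseteq> {}" by auto
  then show ?thesis using compact_ring_empty[OF base_ring] by (intro bexI)
next
  case False
  obtain m where m: "\<forall>k\<ge>m. \<forall>k'\<ge>m. \<forall>z\<in>N i. \<forall>z'\<in>N j.
      g i z \<le> k \<longrightarrow> g j z' \<le> k' \<longrightarrow> c i k z \<inter> c j k' z' = {}"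
    using c_apart[OF i j False] by (rule exE)
  have "(\<Union>y\<in>U. trace (i, y)) \<inter> (\<Union>y\<in>V. trace (j, y)) \<subseteq> early i U m \<union> early j V m"
  proof
    fix q assume "q \<in> (\<Union>y\<in>U. trace (i, y)) \<inter> (\<Union>y\<in>V. trace (j, y))"
    then obtain y y' where y: "y \<in> U" "q \<in> trace (i, y)" "y' \<in> V" "q \<in> trace (j, y')" by blast
    show "q \<in> early i U m \<union> early j V m"
    proof (rule ccontr)
      assume no: "q \<notin> early i U m \<union> early j V m"
      have "\<not> (\<forall>k z. m \<le> k \<longrightarrow> z \<in> N i \<longrightarrow> g i z \<le> k \<longrightarrow> q \<notin> c i k z)"
        using trace_early[OF y(2,1), of m] no by blast
      moreover have "\<not> (\<forall>k z. m \<le> k \<longrightarrow> z \<in> N j \<longrightarrow> g j z \<le> k \<longrightarrow> q \<notin> c j k z)"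
        using trace_early[OF y(4,3), of m] no by blast
      ultimately obtain k z k' z' where "m \<le> k" "z \<in> N i" "g i z \<le> k" "q \<in> c i k z"
        "m \<le> k'" "z' \<in> N j" "g j z' \<le> k'" "q \<in> c j k' z'" by auto
      then show False using m by blast
    qed
  qed
  moreover have "early i U m \<union> early j V m \<in> \<Q>"
    using compact_ring_Un[OF base_ring early_mem[OF i U] early_mem[OF j V]] .
  ultimately show ?thesis by (rule bexI)
qed

lemma trace_UN: "(\<Union>w\<in>P. trace w) = (\<Union>i\<in>fst ` P. \<Union>y\<in>Pair i -` P. trace (i, y))"
  by force

lemma fst_sum_ring: "P \<in> sum_ring I \<K> \<Longrightarrow> finite (fst ` P)" "\<lbrakk>P \<in> sum_ring I \<K>; i \<in> fst ` P\<rbrakk> \<Longrightarrow> i \<in> I"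
  unfolding sum_ring_def by auto

sublocale attachment \<Q> "sum_ring I \<K>" trace
proof
  show "compact_ring \<Q>" by (rule base_ring)
  show "compact_ring (sum_ring I \<K>)" using piece_ring by (rule compact_ring_sum_ring)
  fix w :: "'i \<times> 'a"
  obtain i z where w: "w = (i, z)" by (cases w)
  show "countable (trace w)" unfolding w glue_trace_def
    using compact_ring_countable[OF base_ring c_mem] by auto
  show "trace w \<subseteq> \<Union>\<Q>" unfolding w glue_trace_def using c_mem by auto
next
  fix P K assume P: "P \<in> sum_ring I \<K>" and K: "K \<in> \<Q>"
  have "(\<Union>i\<in>fst ` P. (\<Union>y\<in>Pair i -` P. trace (i, y)) \<inter> K) \<in> \<Q>"
    using fst_sum_ring[OF P] sum_ring_fiber[OF P] K
    by (intro compact_ring_UN[OF base_ring] piece_trace_clopen) auto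
  then show "(\<Union>w\<in>P. trace w) \<inter> K \<in> \<Q>" unfolding trace_UN[of P] by (simp only: Int_UN_distrib2 UN_simps)
next
  fix P P' assume P: "P \<in> sum_ring I \<K>" and P': "P' \<in> sum_ring I \<K>" and PP': "P \<inter> P' = {}"
  have ex: "\<exists>K\<in>\<Q>. (\<Union>y\<in>Pair (fst ij) -` P. trace (fst ij, y)) \<inter> (\<Union>y\<in>Pair (snd ij) -` P'. trace (snd ij, y)) \<subseteq> K"
    if ij: "ij \<in> fst ` P \<times> fst ` P'" for ij
  proof (rule piece_traces_disjoint)
    have "fst ij \<in> fst ` P" "snd ij \<in> fst ` P'" using ij by (simp_all only: mem_Times_iff)
    then show *: "fst ij \<in> I" "snd ij \<in> I" using fst_sum_ring(2)[OF P] fst_sum_ring(2)[OF P'] by simp_all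
    show "Pair (fst ij) -` P \<in> \<K> (fst ij)" "Pair (snd ij) -` P' \<in> \<K> (snd ij)"
      using sum_ring_fiber[OF P *(1)] sum_ring_fiber[OF P' *(2)] .
    show "Pair (fst ij) -` P \<inter> Pair (snd ij) -` P' = {}" if "fst ij = snd ij" using PP' that by auto
  qed
  from bchoice[OF ballI[OF ex[unfolded Bex_def]]] obtain k where
    k: "\<forall>ij\<in>fst ` P \<times> fst ` P'. k ij \<in> \<Q> \<and> (\<Union>y\<in>Pair (fst ij) -` P. trace (fst ij, y)) \<inter> (\<Union>y\<in>Pair (snd ij) -` P'. trace (snd ij, y)) \<subseteq> k ij"
    by (rule exE)
  show "\<exists>K\<in>\<Q>. (\<Union>w\<in>P. trace w) \<inter> (\<Union>w\<in>P'. trace w) \<subseteq> K"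
  proof (rule bexI)
    show "(\<Union>ij\<in>fst ` P \<times> fst ` P'. k ij) \<in> \<Q>"
      using fst_sum_ring(1)[OF P] fst_sum_ring(1)[OF P'] k by (intro compact_ring_UN[OF base_ring]) auto
    show "(\<Union>w\<in>P. trace w) \<inter> (\<Union>w\<in>P'. trace w) \<subseteq> (\<Union>ij\<in>fst ` P \<times> fst ` P'. k ij)"
    proof
      fix q assume "q \<in> (\<Union>w\<in>P. trace w) \<inter> (\<Union>w\<in>P'. trace w)"
      then obtain i y j y' where y: "(i, y) \<in> P" "q \<in> trace (i, y)" "(j, y') \<in> P'" "q \<in> trace (j, y')" by auto
      then have ij: "(i, j) \<in> fst ` P \<times> fst ` P'" by force
      from conjunct2[OF bspec[OF k ij]] have "q \<in> k (i, j)" using y by auto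
      then show "q \<in> (\<Union>ij\<in>fst ` P \<times> fst ` P'. k ij)" using ij by (rule UN_I[rotated])
    qed
  qed
qed

text \<open>
  This is the only property of the topology that the lower bounds need: near an old isolated point \<open>z\<close> are all late \<open>c i k z\<close>.
\<close>

lemma glued_limit:
  assumes P: "P \<in> glued" and iz: "Inr (i, z) \<in> P" "z \<in> N i"
  shows "\<exists>m. \<forall>k\<ge>m. g i z \<le> k \<longrightarrow> Inl ` c i k z \<subseteq> P"
proof -
  have "(i, z) \<in> Inr -` P" using iz(1) by simp
  then have i: "i \<in> I" using fst_sum_ring(2)[OF attach_new_part[OF P]] by force
  obtain K where K: "K \<in> \<Q>" "Inl -` P - K = (\<Union>w\<in>Inr -` P. trace w) - K" using P by (rule attach_trace)
  obtain m where m: "\<And>k. \<lbrakk>m \<le> k; g i z \<le> k\<rbrakk> \<Longrightarrow> K \<inter> c i k z = {}"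
    using c_away[OF i K(1)] iz(2) by blast
  have "Inl ` c i k z \<subseteq> P" if k: "m \<le> k" "g i z \<le> k" for k
  proof
    fix x :: "'q + 'i \<times> 'a" assume "x \<in> Inl ` c i k z"
    then obtain q where q: "q \<in> c i k z" "x = Inl q" by blast
    then have "q \<in> trace (i, z)" unfolding glue_trace_iff using i iz(2) k(2) by blast
    moreover have "q \<notin> K" using m[OF k] q(1) by blast
    ultimately have "q \<in> (\<Union>w\<in>Inr -` P. trace w) - K" using \<open>(i, z) \<in> Inr -` P\<close> by blast
    then have "q \<in> Inl -` P" unfolding K(2)[symmetric] by blast
    then show "x \<in> P" using q(2) by simp
  qed
  then show ?thesis by blast
qed

lemma glued_fiber: "\<lbrakk>P \<in> glued; i \<in> I\<rbrakk> \<Longrightarrow> {y. Inr (i, y) \<in> P} \<in> \<K> i"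
  using sum_ring_fiber[OF attach_new_part, of P i] by (simp add: vimage_def)

lemma glued_piece:
  assumes "i \<in> I" "U \<in> \<K> i"
  shows "Inl ` (\<Union>y\<in>U. trace (i, y)) \<union> Inr ` Pair i ` U \<in> glued"
proof -
  have "Pair i ` U \<in> sum_ring I \<K>"
    using compact_ring_empty[OF piece_ring] assms by (rule sum_ring_Pair)
  from attach_new[OF this] show ?thesis by simp
qed

lemma Union_glued: "\<Union>glued = Inl ` \<Union>\<Q> \<union> Inr ` (SIGMA i:I. \<Union>(\<K> i))"
  unfolding Union_attach using Union_sum_ring[of I \<K>, OF compact_ring_empty[OF piece_ring]] by simp

lemma graded_glued: "graded \<Lambda> glued (Inl ` M) (case_sum h (\<lambda>_. 0))"
proof
  show "compact_ring glued" by (rule compact_ring_attach)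
  show "{z} \<in> glued" if "z \<in> Inl ` M" for z
    using that graded.isolated[OF base] attach_base[of "{inv Inl z}" for z] attach_base by fastforce
next
  fix P assume P: "P \<in> glued" "P \<noteq> {}"
  have *: "P \<inter> Inl ` M \<noteq> {}" if q: "Inl q \<in> P" for q
  proof -
    obtain K where K: "K \<in> \<Q>" "q \<in> K" using attach_base_part[OF P(1)] q by blast
    then have "Inl -` P \<inter> K \<noteq> {}" using q by auto
    then have "(Inl -` P \<inter> K) \<inter> M \<noteq> {}"
      using graded.dense[OF base attach_base_clopen[OF P(1) K(1)]] by blast
    then show ?thesis by auto
  qed
  obtain x where x: "x \<in> P" using P(2) by blast
  show "P \<inter> Inl ` M \<noteq> {}"
  proof (cases x)
    case (Inl q)
    then show ?thesis using * x by simp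
  next
    case (Inr w)
    obtain i y where iy: "w = (i, y)" by (cases w)
    then have "(i, y) \<in> Inr -` P" using x Inr by simp
    then have i: "i \<in> I" using fst_sum_ring(2)[OF attach_new_part[OF P(1)]] by force
    have "{y. Inr (i, y) \<in> P} \<noteq> {}" using x Inr iy by auto
    then obtain z where z: "Inr (i, z) \<in> P" "z \<in> N i"
      using graded.dense[OF pieces[OF i] glued_fiber[OF P(1) i]] by blast
    obtain m where m: "\<And>k. \<lbrakk>m \<le> k; g i z \<le> k\<rbrakk> \<Longrightarrow> Inl ` c i k z \<subseteq> P"
      using glued_limit[OF P(1) z] by blast
    obtain q where "q \<in> c i (max m (g i z)) z" using c_ne[OF i z(2), of "max m (g i z)"] by auto
    then have "Inl q \<in> P" using m[of "max m (g i z)"] by auto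
    then show ?thesis by (rule *)
  qed
next
  fix P n assume P: "P \<in> glued"
  obtain K where K: "K \<in> \<Q>" "Inl -` P - K = (\<Union>w\<in>Inr -` P. trace w) - K" using P by (rule attach_trace)
  note PW = attach_new_part[OF P]
  let ?E = "\<Union>i\<in>fst ` (Inr -` P). early i (Pair i -` (Inr -` P)) (Suc n)"
  have "?E \<in> \<Q>"
    using fst_sum_ring[OF PW] sum_ring_fiber[OF PW] by (intro compact_ring_UN[OF base_ring] early_mem) auto
  then have "finite {q \<in> (K \<union> ?E) \<inter> M. h q \<le> n}"
    by (intro graded.finite_level[OF base] compact_ring_Un[OF base_ring K(1)])
  moreover have "{z \<in> P \<inter> Inl ` M. case_sum h (\<lambda>_. 0) z \<le> n} \<subseteq> Inl ` {q \<in> (K \<union> ?E) \<inter> M. h q \<le> n}"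
  proof
    fix x assume "x \<in> {z \<in> P \<inter> Inl ` M. case_sum h (\<lambda>_. 0) z \<le> n}"
    then obtain q where q: "x = Inl q" "q \<in> M" "h q \<le> n" "Inl q \<in> P" by auto
    have "q \<in> K \<union> ?E"
    proof (cases "q \<in> K")
      case False
      then have "q \<in> (\<Union>w\<in>Inr -` P. trace w) - K" using q(4) unfolding K(2)[symmetric] by simp
      then obtain i y where iy: "(i, y) \<in> Inr -` P" "q \<in> trace (i, y)" by auto
      then have i: "i \<in> fst ` (Inr -` P)" by force
      have "q \<in> early i (Pair i -` (Inr -` P)) (Suc n)"
        using iy q(2,3) c_level[OF fst_sum_ring(2)[OF PW i], of _ _ q] by (intro trace_early[OF iy(2)]) fastforce+
      then show ?thesis using i by blast
    qed simp
    then show "x \<in> Inl ` {q \<in> (K \<union> ?E) \<inter> M. h q \<le> n}" using q by blast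
  qed
  ultimately show "finite {z \<in> P \<inter> Inl ` M. case_sum h (\<lambda>_. 0) z \<le> n}"
    by (rule finite_subset[rotated, OF finite_imageI])
next
  fix n
  have eq: "{z \<in> (Inl ` M :: ('q + 'i \<times> 'a) set). case_sum h (\<lambda>_. 0) z \<le> n} = Inl ` {q \<in> M. h q \<le> n}" by auto
  show "|{z \<in> (Inl ` M :: ('q + 'i \<times> 'a) set). case_sum h (\<lambda>_. 0) z \<le> n}| <o |\<Lambda>|"
    unfolding eq using card_of_image graded.small_level[OF base] by (rule ordLeq_ordLess_trans)
qed

end

section \<open>Branches of a tree with small levels\<close>

text \<open>
  \<open>|\<Lambda>|\<close> is \<open>\<omega>\<close> or a strong limit cardinal of cofinality \<open>\<omega>\<close>. The subsets of \<open>\<Lambda>\<close> are regarded as the branches of a tree: \<open>d \<inter> B n\<close> is the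
  node of \<open>d\<close> at level \<open>n\<close>.
\<close>

locale strong_limit =
  fixes \<Lambda> :: "'l set" and B :: "nat \<Rightarrow> 'l set"
  assumes infinite: "infinite \<Lambda>"
    and B_mono: "i \<le> j \<Longrightarrow> B i \<subseteq> B j"
    and UN_B: "(\<Union>n. B n) = \<Lambda>"
    and B_small: "|B n| <o |\<Lambda>|"
    and Pow_small_subset: "\<lbrakk>S \<subseteq> \<Lambda>; |S| <o |\<Lambda>|\<rbrakk> \<Longrightarrow> |Pow S| <o |\<Lambda>|"
begin

lemma copy_of_small:
  assumes "|S| <o |\<Lambda>|" obtains S' where "S' \<subseteq> \<Lambda>" "|S| =o |S'|"
proof -
  obtain f where f: "inj_on f S" "f ` S \<subseteq> \<Lambda>"
    using ordLess_imp_ordLeq[OF assms] unfolding card_of_ordLeq[symmetric] by blast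
  then have "|S| =o |f ` S|" by (intro card_of_ordIsoI[of f]) (simp add: bij_betw_def)
  then show ?thesis using f(2) that by blast
qed

lemma Pow_small:
  assumes "|S| <o |\<Lambda>|" shows "|Pow S| <o |\<Lambda>|"
proof -
  obtain S' where S': "S' \<subseteq> \<Lambda>" "|S| =o |S'|" using assms by (rule copy_of_small)
  obtain f where "bij_betw f S S'" using S'(2) unfolding card_of_ordIso[symmetric] by blast
  then have "|Pow S| =o |Pow S'|" by (intro card_of_ordIsoI[OF bij_betw_Pow])
  moreover have "|S'| <o |\<Lambda>|" using ordIso_symmetric[OF S'(2)] assms by (rule ordIso_ordLess_trans)
  then have "|Pow S'| <o |\<Lambda>|" by (rule Pow_small_subset[OF S'(1)])
  ultimately show ?thesis by (rule ordIso_ordLess_trans)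
qed

lemma infinite_Pow: "infinite (Pow \<Lambda>)"
  using infinite by simp

lemma nat_le: "|UNIV :: nat set| \<le>o |\<Lambda>|"
  using infinite infinite_iff_card_of_nat by blast

lemma card_of_nodes: "|SIGMA n:(UNIV :: nat set). Pow (B n)| \<le>o |\<Lambda>|"
  using infinite nat_le ordLess_imp_ordLeq[OF Pow_small[OF B_small]]
  by (intro card_of_Sigma_ordLeq_infinite) auto

lemma eq_if_levels_eq:
  assumes "d \<subseteq> \<Lambda>" "d' \<subseteq> \<Lambda>" "\<And>n. d \<inter> B n = d' \<inter> B n" shows "d = d'"
proof -
  have "e \<subseteq> e'" if e: "e \<subseteq> \<Lambda>" "\<And>n. e \<inter> B n = e' \<inter> B n" for e e'
  proof
    fix y assume y: "y \<in> e"
    then have "y \<in> (\<Union>n. B n)" unfolding UN_B using e(1) by blast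
    then obtain n where "y \<in> B n" by blast
    then have "y \<in> e \<inter> B n" using y by blast
    then show "y \<in> e'" unfolding e(2) by blast
  qed
  from this[OF assms(1,3)] this[OF assms(2) assms(3)[symmetric]] show ?thesis by (rule equalityI)
qed

lemma level_down: "\<lbrakk>d \<inter> B n = d' \<inter> B n; m \<le> n\<rbrakk> \<Longrightarrow> d \<inter> B m = d' \<inter> B m"
  using B_mono by blast

text \<open>
  The nodes at level \<open>n\<close> of those branches in \<open>E\<close> that agree with \<open>x\<close> up to level \<open>m\<close>.
\<close>

definition split_set :: "'l set set \<Rightarrow> 'l set \<Rightarrow> nat \<Rightarrow> nat \<Rightarrow> 'l set set" where
  "split_set E x m n = (\<lambda>d. d \<inter> B n) ` {d \<in> E. d \<inter> B m = x \<inter> B m}"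

text \<open>
  Strong limit points of \<open>E\<close>: each neighbourhood of \<open>x\<close> contains branches of \<open>E\<close> that have arbitrarily many
  nodes, short of \<open>|\<Lambda>|\<close>, on a single level. Merely having many branches of \<open>E\<close> near \<open>x\<close> would not do, since the branches chosen
  for \<open>needles\<close> must be separated on a single level.
\<close>

definition Lim :: "'l set set \<Rightarrow> 'l set set" where
  "Lim E = {x. x \<subseteq> \<Lambda> \<and> (\<forall>m. \<forall>S\<subseteq>\<Lambda>. |S| <o |\<Lambda>| \<longrightarrow> (\<exists>n. |S| \<le>o |split_set E x m n| ))}"

lemma finite_separated:
  assumes "finite F" "F \<subseteq> Pow \<Lambda>"
  obtains n where "inj_on (\<lambda>d. d \<inter> B n) F"
proof -
  have "\<exists>n. d \<noteq> d' \<longrightarrow> d \<inter> B n \<noteq> d' \<inter> B n" if "d \<in> F" "d' \<in> F" for d d'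
    using eq_if_levels_eq[of d d'] assms(2) that by blast
  then have "\<forall>p\<in>F \<times> F. \<exists>n. fst p \<noteq> snd p \<longrightarrow> fst p \<inter> B n \<noteq> snd p \<inter> B n" by auto
  from bchoice[OF this] obtain k where
    k: "\<forall>p\<in>F \<times> F. fst p \<noteq> snd p \<longrightarrow> fst p \<inter> B (k p) \<noteq> snd p \<inter> B (k p)" by (rule exE)
  obtain n where n: "\<forall>i\<in>k ` (F \<times> F). i \<le> n"
    using assms(1) finite_nat_set_iff_bounded_le[of "k ` (F \<times> F)"] by auto
  have "inj_on (\<lambda>d. d \<inter> B n) F"
  proof (rule inj_onI, rule ccontr)
    fix d d' assume d: "d \<in> F" "d' \<in> F" "d \<inter> B n = d' \<inter> B n" "d \<noteq> d'"
    then have "k (d, d') \<le> n" using n by auto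
    then have "d \<inter> B (k (d, d')) = d' \<inter> B (k (d, d'))" by (rule level_down[OF d(3)])
    moreover have "fst (d, d') \<inter> B (k (d, d')) \<noteq> snd (d, d') \<inter> B (k (d, d'))"
      using d k by auto
    ultimately show False by simp
  qed
  then show ?thesis by (rule that)
qed

text \<open>
  If \<open>S\<close> is infinite, a member of \<open>E\<close> is coded by a sequence in \<open>S\<close>, and \<open>|S|\<^sup>\<omega> \<le> 2\<^bsup>|S|\<^esup> < |\<Lambda>|\<close>. If \<open>S\<close> is finite, then so is \<open>E\<close>,
  because finitely many branches are separated on some level.
\<close>

lemma card_of_thin:
  assumes E: "E \<subseteq> Pow \<Lambda>" and S: "S \<subseteq> \<Lambda>" "|S| <o |\<Lambda>|" and thin: "\<And>n. |(\<lambda>d. d \<inter> B n) ` E| <o |S|"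
  shows "|E| \<le>o |\<Lambda>|"
proof (cases "finite S")
  case False
  have "\<exists>f. inj_on f ((\<lambda>d. d \<inter> B n) ` E) \<and> f ` (\<lambda>d. d \<inter> B n) ` E \<subseteq> S" for n
    using ordLess_imp_ordLeq[OF thin[of n]] unfolding card_of_ordLeq[symmetric] .
  then have "\<forall>n. \<exists>f. inj_on f ((\<lambda>d. d \<inter> B n) ` E) \<and> f ` (\<lambda>d. d \<inter> B n) ` E \<subseteq> S" by (rule allI)
  from choice[OF this] obtain f where
    f: "\<forall>n. inj_on (f n) ((\<lambda>d. d \<inter> B n) ` E) \<and> f n ` (\<lambda>d. d \<inter> B n) ` E \<subseteq> S" by (rule exE)
  let ?G = "\<lambda>d. {(n, f n (d \<inter> B n)) | n. True}"
  have "|E| \<le>o |Pow ((UNIV :: nat set) \<times> S)|"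
  proof (rule card_of_ordLeqI[of ?G])
    show "inj_on ?G E"
    proof (rule inj_onI)
      fix d d' assume d: "d \<in> E" "d' \<in> E" and eq: "?G d = ?G d'"
      have "d \<inter> B n = d' \<inter> B n" for n
      proof -
        have "(n, f n (d \<inter> B n)) \<in> ?G d" by blast
        then have "f n (d \<inter> B n) = f n (d' \<inter> B n)" unfolding eq by blast
        then show ?thesis using f d unfolding inj_on_def by blast
      qed
      then show "d = d'" using eq_if_levels_eq[of d d'] d E by auto
    qed
    show "?G d \<in> Pow (UNIV \<times> S)" if "d \<in> E" for d using f that by blast
  qed
  moreover have "|UNIV :: nat set| <o |\<Lambda>|"
    using False S(2) infinite_iff_card_of_nat ordLeq_ordLess_trans by blast
  then have "|Pow ((UNIV :: nat set) \<times> S)| <o |\<Lambda>|"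
    by (intro Pow_small card_of_Times_less_infinite infinite S(2))
  ultimately have "|E| <o |\<Lambda>|" by (rule ordLeq_ordLess_trans)
  then show ?thesis by (rule ordLess_imp_ordLeq)
next
  case True
  have "finite E"
  proof (rule ccontr)
    assume "infinite E"
    then obtain F where F: "finite F" "card F = Suc (card S)" "F \<subseteq> E"
      using infinite_arbitrarily_large by metis
    obtain n where n: "inj_on (\<lambda>d. d \<inter> B n) F" using finite_separated[of F] F E by blast
    have "|F| \<le>o |(\<lambda>d. d \<inter> B n) ` E|" using n F(3) by (intro card_of_ordLeqI[of "\<lambda>d. d \<inter> B n"]) auto
    then have "|F| <o |S|" using thin by (rule ordLeq_ordLess_trans)
    moreover obtain f where "f ` S \<subseteq> F" "inj_on f S" using card_le_inj[OF True F(1)] F(2) by auto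
    then have "|S| \<le>o |F|" unfolding card_of_ordLeq[symmetric] by blast
    ultimately show False using not_ordLess_ordLeq by blast
  qed
  then show ?thesis using finite_card_of_less[OF _ infinite] ordLess_imp_ordLeq by blast
qed

text \<open>
  A branch of \<open>E\<close> that is not a limit point lies in a thin neighbourhood; there are at most \<open>|\<Lambda>|\<close> neighbourhoods, one for each
  node, and by \<open>card_of_thin\<close> each thin one contains at most \<open>|\<Lambda>|\<close> members of \<open>E\<close>.
\<close>

lemma card_of_Diff_Lim:
  assumes E: "E \<subseteq> Pow \<Lambda>" shows "|E - Lim E| \<le>o |\<Lambda>|"
proof -
  let ?fib = "\<lambda>t. {d \<in> E. d \<inter> B (fst t) = snd t}"
  let ?T = "{t \<in> (SIGMA n:(UNIV :: nat set). Pow (B n)). |?fib t| \<le>o |\<Lambda>|}"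
  have "E - Lim E \<subseteq> (\<Union>t\<in>?T. ?fib t)"
  proof
    fix x assume x: "x \<in> E - Lim E"
    then have "x \<subseteq> \<Lambda>" using E by blast
    then obtain m S where S: "S \<subseteq> \<Lambda>" "|S| <o |\<Lambda>|" and no: "\<And>n. \<not> |S| \<le>o |split_set E x m n|"
      using x unfolding Lim_def by blast
    have "|(\<lambda>d. d \<inter> B n) ` {d \<in> E. d \<inter> B m = x \<inter> B m}| <o |S|" for n
      using no[of n] unfolding split_set_def not_card_of_le .
    then have "|{d \<in> E. d \<inter> B m = x \<inter> B m}| \<le>o |\<Lambda>|"
      using E by (intro card_of_thin[OF _ S]) auto
    then have "(m, x \<inter> B m) \<in> ?T" by simp
    moreover have "x \<in> ?fib (m, x \<inter> B m)" using x by simp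
    ultimately show "x \<in> (\<Union>t\<in>?T. ?fib t)" by (rule UN_I)
  qed
  then have "|E - Lim E| \<le>o |\<Union>t\<in>?T. ?fib t|" by (rule card_of_mono1)
  also have "|\<Union>t\<in>?T. ?fib t| \<le>o |\<Lambda>|"
  proof (rule card_of_UNION_ordLeq_infinite[OF infinite])
    have "|?T| \<le>o |SIGMA n:(UNIV :: nat set). Pow (B n)|" by (rule card_of_mono1) blast
    then show "|?T| \<le>o |\<Lambda>|" using card_of_nodes by (rule ordLeq_transitive)
  qed simp
  finally show ?thesis .
qed

lemma card_of_split_set_mono:
  assumes "n \<le> n'" shows "|split_set E x m n| \<le>o |split_set E x m n'|"
proof -
  have "d \<inter> B n = (d \<inter> B n') \<inter> B n" for d using B_mono[OF assms] by blast
  then have "split_set E x m n = (\<lambda>d. d \<inter> B n) ` split_set E x m n'"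
    unfolding split_set_def image_image by (intro image_cong refl)
  then show ?thesis by (simp add: card_of_image)
qed

text \<open>
  One branch of \<open>E\<close> through each node suffices to keep all limit points, so families of size \<open>|\<Lambda>|\<close> are enough. There are only \<open>2\<^bsup>|\<Lambda>|\<^esup>\<close> of these.
\<close>

lemma dense_family:
  assumes E: "E \<subseteq> Pow \<Lambda>" "E \<noteq> {}"
  obtains f where "f ` \<Lambda> \<subseteq> E" "Lim E \<subseteq> Lim (f ` \<Lambda>)"
proof -
  let ?T = "(\<lambda>(n, d). (n, d \<inter> B n)) ` ((UNIV :: nat set) \<times> E)"
  have "|?T| \<le>o |SIGMA n:(UNIV :: nat set). Pow (B n)|" by (rule card_of_mono1) auto
  then have T: "|?T| \<le>o |\<Lambda>|" using card_of_nodes by (rule ordLeq_transitive)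
  have "?T \<noteq> {}" using E(2) by simp
  from T obtain u where u: "u ` \<Lambda> = ?T" unfolding card_of_ordLeq2[OF \<open>?T \<noteq> {}\<close>, symmetric] by blast
  have "\<forall>t\<in>?T. \<exists>d. d \<in> E \<and> d \<inter> B (fst t) = snd t" by auto
  from bchoice[OF this] obtain e where e: "\<forall>t\<in>?T. e t \<in> E \<and> e t \<inter> B (fst t) = snd t" by (rule exE)
  let ?f = "\<lambda>a. e (u a)"
  have fE: "?f ` \<Lambda> \<subseteq> E" using u e by blast
  have dense: "\<exists>a\<in>\<Lambda>. ?f a \<inter> B n = d \<inter> B n" if "d \<in> E" for n d
  proof -
    have t: "(n, d \<inter> B n) \<in> ?T" using that by auto
    then obtain a where a: "a \<in> \<Lambda>" "u a = (n, d \<inter> B n)" using u by (metis imageE)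
    have "e (n, d \<inter> B n) \<inter> B n = d \<inter> B n" using bspec[OF e t] by simp
    then show ?thesis using a by (intro bexI[of _ a]) simp_all
  qed
  have "Lim E \<subseteq> Lim (?f ` \<Lambda>)"
  proof
    fix x assume x: "x \<in> Lim E"
    have "\<exists>n. |S| \<le>o |split_set (?f ` \<Lambda>) x m n|" if S: "S \<subseteq> \<Lambda>" "|S| <o |\<Lambda>|" for m S
    proof -
      obtain n where n: "|S| \<le>o |split_set E x m n|" using x S unfolding Lim_def by blast
      have "split_set E x m (max n m) \<subseteq> split_set (?f ` \<Lambda>) x m (max n m)"
      proof
        fix v assume "v \<in> split_set E x m (max n m)"
        then obtain d where d: "d \<in> E" "d \<inter> B m = x \<inter> B m" "v = d \<inter> B (max n m)" unfolding split_set_def by blast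
        obtain a where a: "a \<in> \<Lambda>" "?f a \<inter> B (max n m) = d \<inter> B (max n m)" using dense[OF d(1)] by blast
        have "?f a \<inter> B m = x \<inter> B m" using level_down[OF a(2), of m] d(2) by simp
        then have "?f a \<in> {d \<in> ?f ` \<Lambda>. d \<inter> B m = x \<inter> B m}" using a(1) by simp
        moreover have "v = ?f a \<inter> B (max n m)" using a(2) d(3) by simp
        ultimately show "v \<in> split_set (?f ` \<Lambda>) x m (max n m)" unfolding split_set_def by (rule rev_image_eqI)
      qed
      then have "|split_set E x m (max n m)| \<le>o |split_set (?f ` \<Lambda>) x m (max n m)|" by (rule card_of_mono1)
      then have "|S| \<le>o |split_set (?f ` \<Lambda>) x m (max n m)|"
        using ordLeq_transitive[OF n card_of_split_set_mono[of n "max n m"]] ordLeq_transitive by fastforce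
      then show ?thesis by blast
    qed
    then show "x \<in> Lim (?f ` \<Lambda>)" using x unfolding Lim_def by simp
  qed
  then show ?thesis using that[of ?f] fE by simp
qed

lemma large_dense_family:
  assumes E: "E \<subseteq> Pow \<Lambda>" "|Pow \<Lambda>| \<le>o |E|"
  obtains f where "f ` \<Lambda> \<subseteq> E" "|Pow \<Lambda>| \<le>o |Lim (f ` \<Lambda>)|"
proof -
  have ne: "E \<noteq> {}" using E(2) infinite_Pow card_of_ordLeq_infinite by blast
  obtain f where f: "f ` \<Lambda> \<subseteq> E" "Lim E \<subseteq> Lim (f ` \<Lambda>)" using E(1) ne by (rule dense_family)
  have "|Pow \<Lambda>| \<le>o |Lim E|"
  proof (rule ccontr)
    assume "\<not> ?thesis"
    then have "|Lim E| <o |Pow \<Lambda>|" unfolding not_card_of_le .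
    moreover have "|E - Lim E| <o |Pow \<Lambda>|" using card_of_Diff_Lim[OF E(1)] card_of_Pow by (rule ordLeq_ordLess_trans)
    ultimately have "|Lim E \<union> (E - Lim E)| <o |Pow \<Lambda>|" by (rule card_of_Un_ordLess_infinite[OF infinite_Pow])
    moreover have "|E| \<le>o |Lim E \<union> (E - Lim E)|" by (rule card_of_mono1) blast
    ultimately have "|E| <o |Pow \<Lambda>|" by (rule ordLeq_ordLess_trans[rotated])
    then show False using E(2) not_ordLess_ordLeq by blast
  qed
  then have "|Pow \<Lambda>| \<le>o |Lim (f ` \<Lambda>)|" using card_of_mono1[OF f(2)] by (rule ordLeq_transitive)
  then show ?thesis using f(1) that by blast
qed

text \<open>
  Let \<open>f\<close> enumerate a dense family of \<open>E\<close>. If its levels are bounded in \<open>V\<close>, it is as required. If not, they are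
  cofinal in \<open>V\<close>, hence \<open>E\<close> is the union of at most \<open>|\<Lambda>|\<close> sets on which \<open>lev\<close> is bounded; by \<open>Koenig\<close> one of these is of full
  size, and a dense family of it is as required.
\<close>

lemma bounded_dense_family:
  assumes E: "E \<subseteq> Pow \<Lambda>" "|Pow \<Lambda> - E| <o |Pow \<Lambda>|"
    and lev: "\<And>d. d \<in> E \<Longrightarrow> lev d \<in> V" and total: "\<And>a b. \<lbrakk>a \<in> V; b \<in> V\<rbrakk> \<Longrightarrow> (a, b) \<in> r \<or> (b, a) \<in> r"
  obtains v f where "v \<in> V" "f ` \<Lambda> \<subseteq> {d \<in> E. (lev d, v) \<in> r}" "|Pow \<Lambda>| \<le>o |Lim (f ` \<Lambda>)|"
proof -
  have large: "|Pow \<Lambda>| \<le>o |E|"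
  proof (rule ccontr)
    assume "\<not> ?thesis"
    then have "|E| <o |Pow \<Lambda>|" unfolding not_card_of_le .
    then have "|E \<union> (Pow \<Lambda> - E)| <o |Pow \<Lambda>|" using E(2) by (rule card_of_Un_ordLess_infinite[OF infinite_Pow])
    moreover have "E \<union> (Pow \<Lambda> - E) = Pow \<Lambda>" using E(1) by blast
    ultimately show False by (simp only: ordLess_irreflexive)
  qed
  obtain f where f: "f ` \<Lambda> \<subseteq> E" "|Pow \<Lambda>| \<le>o |Lim (f ` \<Lambda>)|" using E(1) large by (rule large_dense_family)
  show ?thesis
  proof (cases "\<exists>v\<in>V. \<forall>a\<in>\<Lambda>. (lev (f a), v) \<in> r")
    case True
    then show ?thesis using that[of _ f] f by blast
  next
    case False
    have "E \<subseteq> (\<Union>a\<in>\<Lambda>. {d \<in> E. (lev d, lev (f a)) \<in> r})"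
    proof
      fix d assume d: "d \<in> E"
      then obtain a where a: "a \<in> \<Lambda>" "(lev (f a), lev d) \<notin> r" using False lev by blast
      then have "(lev d, lev (f a)) \<in> r" using total[OF lev[OF d] lev[of "f a"]] f(1) by blast
      then show "d \<in> (\<Union>a\<in>\<Lambda>. {d \<in> E. (lev d, lev (f a)) \<in> r})" using a(1) d by blast
    qed
    then have "|Pow \<Lambda>| \<le>o |\<Union>a\<in>\<Lambda>. {d \<in> E. (lev d, lev (f a)) \<in> r}|"
      by (rule ordLeq_transitive[OF large card_of_mono1])
    then have "\<not> (\<forall>a\<in>\<Lambda>. |{d \<in> E. (lev d, lev (f a)) \<in> r}| <o |Pow \<Lambda>| )"
      using Koenig[OF infinite ordLeq_reflexive[OF card_of_Well_order], of "\<lambda>a. {d \<in> E. (lev d, lev (f a)) \<in> r}"]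
        not_ordLess_ordLeq by blast
    then obtain a where a: "a \<in> \<Lambda>" "|Pow \<Lambda>| \<le>o |{d \<in> E. (lev d, lev (f a)) \<in> r}|"
      using card_of_less_or_le by blast
    have "{d \<in> E. (lev d, lev (f a)) \<in> r} \<subseteq> Pow \<Lambda>" using E(1) by blast
    then obtain f' where "f' ` \<Lambda> \<subseteq> {d \<in> E. (lev d, lev (f a)) \<in> r}" "|Pow \<Lambda>| \<le>o |Lim (f' ` \<Lambda>)|"
      using a(2) by (rule large_dense_family)
    moreover have "lev (f a) \<in> V" using f(1) a(1) lev by blast
    ultimately show ?thesis by (rule that[rotated])
  qed
qed

lemma needles_step:
  assumes x: "x \<in> Lim E" and N: "|N| <o |\<Lambda>|"
  shows "\<exists>n a. m \<le> n \<and> inj_on (\<lambda>z. a z \<inter> B n) N \<and>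
    (\<forall>z\<in>N. a z \<in> E \<and> a z \<inter> B m = x \<inter> B m \<and> a z \<inter> B n \<noteq> x \<inter> B n)"
proof -
  let ?S = "insert None (Some ` N)"
  have "|Some ` N| <o |\<Lambda>|" using card_of_image N by (rule ordLeq_ordLess_trans)
  moreover have "|{None :: 'a option}| <o |\<Lambda>|" using infinite by (intro finite_card_of_less) simp_all
  ultimately have "|{None} \<union> Some ` N| <o |\<Lambda>|" by (intro card_of_Un_ordLess_infinite infinite)
  then have "|?S| <o |\<Lambda>|" by simp
  then obtain S where S: "S \<subseteq> \<Lambda>" "|?S| =o |S|" by (rule copy_of_small)
  have "|S| <o |\<Lambda>|" using ordIso_symmetric[OF S(2)] \<open>|?S| <o |\<Lambda>|\<close> by (rule ordIso_ordLess_trans)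
  then obtain n0 where n0: "|S| \<le>o |split_set E x m n0|" using x S(1) unfolding Lim_def by blast
  define n where "n = max m n0"
  have "|?S| \<le>o |split_set E x m n0|" using S(2) n0 by (rule ordIso_ordLeq_trans)
  then have "|?S| \<le>o |split_set E x m n|"
    using card_of_split_set_mono[of n0 n] unfolding n_def by (rule ordLeq_transitive) simp
  then obtain \<phi> where \<phi>: "inj_on \<phi> ?S" "\<phi> ` ?S \<subseteq> split_set E x m n" unfolding card_of_ordLeq[symmetric] by blast
  \<comment> \<open>One spare value makes it possible to avoid the node of x itself.\<close>
  define \<psi> where "\<psi> z = (if \<phi> (Some z) = x \<inter> B n then \<phi> None else \<phi> (Some z))" for z
  have mem: "\<psi> z \<in> split_set E x m n" if "z \<in> N" for z
    using \<phi>(2) that unfolding \<psi>_def by auto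
  have away: "\<psi> z \<noteq> x \<inter> B n" if "z \<in> N" for z
  proof
    assume eq: "\<psi> z = x \<inter> B n"
    then have "\<phi> (Some z) = \<phi> None" unfolding \<psi>_def by (simp split: if_splits)
    then show False using inj_onD[OF \<phi>(1), of "Some z" None] that by auto
  qed
  have inj: "inj_on \<psi> N"
  proof (rule inj_onI)
    fix z z' assume z: "z \<in> N" "z' \<in> N" "\<psi> z = \<psi> z'"
    have i: "\<phi> u = \<phi> v \<Longrightarrow> u = v" if "u \<in> ?S" "v \<in> ?S" for u v using inj_onD[OF \<phi>(1)] that by blast
    show "z = z'"
      using z i[of "Some z" "Some z'"] i[of None "Some z'"] i[of "Some z" None] unfolding \<psi>_def
      by (auto split: if_splits)
  qed
  have "\<forall>z\<in>N. \<exists>d. d \<in> E \<and> d \<inter> B m = x \<inter> B m \<and> \<psi> z = d \<inter> B n"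
    using mem unfolding split_set_def by blast
  from bchoice[OF this] obtain a where
    a: "\<forall>z\<in>N. a z \<in> E \<and> a z \<inter> B m = x \<inter> B m \<and> \<psi> z = a z \<inter> B n" by (rule exE)
  have "inj_on \<psi> N \<longleftrightarrow> inj_on (\<lambda>z. a z \<inter> B n) N" using a by (intro inj_on_cong) blast
  then have "inj_on (\<lambda>z. a z \<inter> B n) N" using inj by (rule iffD1)
  moreover have "\<forall>z\<in>N. a z \<in> E \<and> a z \<inter> B m = x \<inter> B m \<and> a z \<inter> B n \<noteq> x \<inter> B n" using a away by auto
  moreover have "m \<le> n" unfolding n_def by simp
  ultimately show ?thesis by (intro exI[of _ n] exI[of _ a] conjI)
qed

text \<open>
  A comb along the branch \<open>x\<close>: at step \<open>k\<close> the fewer than \<open>|\<Lambda>|\<close> points of level at most \<open>k\<close>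
  get branches \<open>a k z\<close> of \<open>E\<close> which follow \<open>x\<close> through all earlier levels \<open>lv j\<close>, have left it at level \<open>lv k\<close>, and are
  separated from one another there. So for every \<open>z\<close> the sequence \<open>a k z\<close> converges to \<open>x\<close>, while the
  branches \<open>a k z\<close> with their nodes from level \<open>lv k\<close> on are pairwise disjoint.
\<close>

lemma needles:
  assumes x: "x \<in> Lim E" and N: "\<And>k. |{z \<in> N. g z \<le> k}| <o |\<Lambda>|"
  obtains lv :: "nat \<Rightarrow> nat" and a where
    "\<And>k. k \<le> lv k" "\<And>k. inj_on (\<lambda>z. a k z \<inter> B (lv k)) {z \<in> N. g z \<le> k}"
    "\<And>k z. \<lbrakk>z \<in> N; g z \<le> k\<rbrakk> \<Longrightarrow> a k z \<in> E"
    "\<And>k z. \<lbrakk>z \<in> N; g z \<le> k\<rbrakk> \<Longrightarrow> a k z \<inter> B (lv k) \<noteq> x \<inter> B (lv k)"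
    "\<And>j k z. \<lbrakk>z \<in> N; g z \<le> k; j < k\<rbrakk> \<Longrightarrow> a k z \<inter> B (lv j) = x \<inter> B (lv j)"
proof -
  define N' where "N' k = {z \<in> N. g z \<le> k}" for k
  define P where "P k p \<longleftrightarrow> k \<le> fst p \<and> inj_on (\<lambda>z. snd p z \<inter> B (fst p)) (N' k) \<and>
    (\<forall>z\<in>N' k. snd p z \<in> E \<and> snd p z \<inter> B (fst p) \<noteq> x \<inter> B (fst p))" for k and p :: "nat \<times> ('a \<Rightarrow> 'l set)"
  define Q where "Q k p p' \<longleftrightarrow> fst p \<le> fst p' \<and> (\<forall>z\<in>N' (Suc k). snd p' z \<inter> B (fst p) = x \<inter> B (fst p))"
    for k and p p' :: "nat \<times> ('a \<Rightarrow> 'l set)"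
  have small: "|N' k| <o |\<Lambda>|" for k using N unfolding N'_def .
  have "\<exists>p. \<forall>k. P k (p k) \<and> Q k (p k) (p (Suc k))"
  proof (rule dependent_nat_choice)
    show "\<exists>p. P 0 p" using needles_step[OF x small, of 0 0] unfolding P_def by auto
    fix p k assume "P k p"
    then have "k \<le> fst p" unfolding P_def by simp
    obtain n a where "max (Suc k) (fst p) \<le> n" "inj_on (\<lambda>z. a z \<inter> B n) (N' (Suc k))"
      and a: "\<forall>z\<in>N' (Suc k). a z \<in> E \<and> a z \<inter> B (max (Suc k) (fst p)) = x \<inter> B (max (Suc k) (fst p)) \<and> a z \<inter> B n \<noteq> x \<inter> B n"
      using needles_step[OF x small, of "max (Suc k) (fst p)" "Suc k"] by (elim exE conjE)
    then have "P (Suc k) (n, a)" unfolding P_def by simp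
    moreover have "a z \<inter> B (fst p) = x \<inter> B (fst p)" if "z \<in> N' (Suc k)" for z
    proof (rule level_down)
      show "a z \<inter> B (max (Suc k) (fst p)) = x \<inter> B (max (Suc k) (fst p))" using a that by blast
    qed simp
    then have "Q k p (n, a)" unfolding Q_def using \<open>max (Suc k) (fst p) \<le> n\<close> by simp
    ultimately show "\<exists>p'. P (Suc k) p' \<and> Q k p p'" by (intro exI[of _ "(n, a)"] conjI)
  qed
  then obtain p where "\<forall>k. P k (p k) \<and> Q k (p k) (p (Suc k))" by (rule exE)
  then have p: "P k (p k)" "Q k (p k) (p (Suc k))" for k by simp_all
  have mono: "fst (p j) \<le> fst (p k)" if "j \<le> k" for j k
    using that by (rule lift_Suc_mono_le[rotated]) (use p(2) in \<open>simp add: Q_def\<close>)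
  show ?thesis
  proof (rule that[of "\<lambda>k. fst (p k)" "\<lambda>k. snd (p k)"])
    show "k \<le> fst (p k)" for k using p(1)[of k] unfolding P_def by simp
    show "inj_on (\<lambda>z. snd (p k) z \<inter> B (fst (p k))) {z \<in> N. g z \<le> k}" for k
      using p(1)[of k] unfolding P_def N'_def by simp
    show "snd (p k) z \<in> E" "snd (p k) z \<inter> B (fst (p k)) \<noteq> x \<inter> B (fst (p k))" if "z \<in> N" "g z \<le> k" for k z
      using p(1)[of k] that unfolding P_def N'_def by simp_all
    show "snd (p k) z \<inter> B (fst (p j)) = x \<inter> B (fst (p j))" if z: "z \<in> N" "g z \<le> k" and jk: "j < k" for j k z
    proof -
      obtain i where i: "k = Suc i" using jk by (cases k) auto
      have "snd (p k) z \<inter> B (fst (p i)) = x \<inter> B (fst (p i))"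
        using p(2)[of i] z unfolding Q_def N'_def i by simp
      then show ?thesis by (rule level_down) (use mono jk i in simp)
    qed
  qed
qed

end

section \<open>The space of branches and nodes\<close>

context strong_limit
begin

definition nodes :: "(nat \<times> 'l set) set" where
  "nodes = (SIGMA n:UNIV. Pow (B n))"

text \<open>
  A basic neighbourhood of the branch \<open>d\<close> in the space of branches and nodes.
\<close>

definition cylinder :: "'l set \<Rightarrow> nat \<Rightarrow> (nat \<times> 'l set + 'l set) set" where
  "cylinder d m = insert (Inr d) (Inl ` (\<lambda>n. (n, d \<inter> B n)) ` {m..})"

text \<open>
  Nodes are isolated and a branch is the limit of its nodes; for \<open>\<Lambda> = \<omega>\<close> this is a \<open>\<Psi>\<close>-space over a countable set.
\<close>

definition branch_ring :: "(nat \<times> 'l set + 'l set) set set" where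
  "branch_ring = attach (Fpow nodes) (Fpow (Pow \<Lambda>)) (\<lambda>d. range (\<lambda>n. (n, d \<inter> B n)))"

lemma node_mem: "(n, d \<inter> B n) \<in> nodes"
  unfolding nodes_def by simp

lemma separated_levels:
  assumes "d \<subseteq> \<Lambda>" "d' \<subseteq> \<Lambda>" "d \<noteq> d'"
  obtains m where "\<And>n. m \<le> n \<Longrightarrow> d \<inter> B n \<noteq> d' \<inter> B n"
proof -
  obtain m where "d \<inter> B m \<noteq> d' \<inter> B m" using eq_if_levels_eq[OF assms(1,2)] assms(3) by blast
  then show ?thesis using that[of m] level_down[of d _ d' m] by blast
qed

lemma cylinder_disjoint:
  assumes "d \<inter> B j \<noteq> d' \<inter> B j" "j \<le> m \<or> j \<le> m'"
  shows "cylinder d m \<inter> cylinder d' m' = {}"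
proof (rule ccontr)
  assume "\<not> ?thesis"
  then consider "d = d'" | n where "m \<le> n" "m' \<le> n" "d \<inter> B n = d' \<inter> B n"
    unfolding cylinder_def by auto
  then show False
  proof cases
    case 1
    then show False using assms(1) by simp
  next
    case 2
    then have "j \<le> n" using assms(2) by auto
    then show False using level_down[OF 2(3)] assms(1) by simp
  qed
qed

sublocale branch: attachment "Fpow nodes" "Fpow (Pow \<Lambda>)" "\<lambda>d. range (\<lambda>n. (n, d \<inter> B n))"
proof
  show "compact_ring (Fpow nodes)" "compact_ring (Fpow (Pow \<Lambda>))" by (rule compact_ring_Fpow)+
  show "countable (range (\<lambda>n. (n, d \<inter> B n)))" for d by simp
  show "range (\<lambda>n. (n, d \<inter> B n)) \<subseteq> \<Union>(Fpow nodes)" for d unfolding Union_Fpow using node_mem by blast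
  show "(\<Union>d\<in>P. range (\<lambda>n. (n, d \<inter> B n))) \<inter> K \<in> Fpow nodes" if "K \<in> Fpow nodes" for P K
    using that unfolding Fpow_def by auto
next
  fix P P' assume P: "P \<in> Fpow (Pow \<Lambda>)" "P' \<in> Fpow (Pow \<Lambda>)" "P \<inter> P' = {}"
  then have "finite (P \<union> P')" "P \<union> P' \<subseteq> Pow \<Lambda>" unfolding Fpow_def by auto
  then obtain j where j: "inj_on (\<lambda>d. d \<inter> B j) (P \<union> P')" by (rule finite_separated)
  let ?K = "(\<lambda>(n, d). (n, d \<inter> B n)) ` ({..<j} \<times> P)"
  show "\<exists>K\<in>Fpow nodes. (\<Union>d\<in>P. range (\<lambda>n. (n, d \<inter> B n))) \<inter> (\<Union>d\<in>P'. range (\<lambda>n. (n, d \<inter> B n))) \<subseteq> K"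
  proof (rule bexI)
    show "?K \<in> Fpow nodes" using P(1) node_mem unfolding Fpow_def by auto
    show "(\<Union>d\<in>P. range (\<lambda>n. (n, d \<inter> B n))) \<inter> (\<Union>d\<in>P'. range (\<lambda>n. (n, d \<inter> B n))) \<subseteq> ?K"
    proof
      fix t assume "t \<in> (\<Union>d\<in>P. range (\<lambda>n. (n, d \<inter> B n))) \<inter> (\<Union>d\<in>P'. range (\<lambda>n. (n, d \<inter> B n)))"
      then obtain d d' n where t: "d \<in> P" "d' \<in> P'" "t = (n, d \<inter> B n)" "d \<inter> B n = d' \<inter> B n" by auto
      have "n < j"
      proof (rule ccontr)
        assume "\<not> n < j"
        then have "d \<inter> B j = d' \<inter> B j" using level_down[OF t(4)] by simp
        then have "d = d'" using inj_onD[OF j] t(1,2) by blast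
        then show False using t(1,2) P(3) by blast
      qed
      then show "t \<in> ?K" using t(1,3) by (intro image_eqI[of _ _ "(n, d)"]) auto
    qed
  qed
qed

lemma Union_branch_ring: "\<Union>branch_ring = Inl ` nodes \<union> Inr ` Pow \<Lambda>"
  unfolding branch_ring_def branch.Union_attach Union_Fpow by (rule refl)

lemma cylinder_mem:
  assumes "d \<subseteq> \<Lambda>" shows "cylinder d m \<in> branch_ring"
proof -
  have "{d} \<in> Fpow (Pow \<Lambda>)" using assms unfolding Fpow_def by simp
  from branch.attach_new[OF this]
  have 1: "Inl ` range (\<lambda>n. (n, d \<inter> B n)) \<union> {Inr d} \<in> branch_ring" unfolding branch_ring_def by simp
  have "(\<lambda>n. (n, d \<inter> B n)) ` {..<m} \<in> Fpow nodes" using node_mem unfolding Fpow_def by auto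
  from branch.attach_base[OF this]
  have 2: "Inl ` (\<lambda>n. (n, d \<inter> B n)) ` {..<m} \<in> branch_ring" unfolding branch_ring_def .
  have "cylinder d m = (Inl ` range (\<lambda>n. (n, d \<inter> B n)) \<union> {Inr d}) - Inl ` (\<lambda>n. (n, d \<inter> B n)) ` {..<m}"
  proof -
    let ?g = "\<lambda>n. Inl (n, d \<inter> B n) :: nat \<times> 'l set + 'l set"
    have "range ?g = ?g ` {m..} \<union> ?g ` {..<m}" unfolding image_Un[symmetric] by (rule arg_cong[of _ _ "image ?g"]) auto
    moreover have "?g ` {m..} \<inter> ?g ` {..<m} = {}" "Inr d \<notin> ?g ` {..<m}" by auto
    ultimately show ?thesis unfolding cylinder_def image_image by blast
  qed
  then show ?thesis
    using compact_ring_Diff[OF branch.compact_ring_attach[folded branch_ring_def] 1 2] by simp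
qed

text \<open>
  A compact set is covered by finitely many cylinders and finitely many nodes.
\<close>

lemma branch_ring_cover:
  assumes "K \<in> branch_ring"
  obtains F where "finite F" "finite (Inr -` K)" "Inr -` K \<subseteq> Pow \<Lambda>" "K \<subseteq> Inl ` F \<union> (\<Union>d\<in>Inr -` K. cylinder d 0)"
proof -
  have K: "K \<in> attach (Fpow nodes) (Fpow (Pow \<Lambda>)) (\<lambda>d. range (\<lambda>n. (n, d \<inter> B n)))"
    using assms unfolding branch_ring_def .
  obtain F where F: "F \<in> Fpow nodes"
    "Inl -` K - F = (\<Union>d\<in>Inr -` K. range (\<lambda>n. (n, d \<inter> B n))) - F" using K by (rule branch.attach_trace)
  have "K \<subseteq> Inl ` F \<union> (\<Union>d\<in>Inr -` K. cylinder d 0)"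
  proof
    fix x assume x: "x \<in> K"
    show "x \<in> Inl ` F \<union> (\<Union>d\<in>Inr -` K. cylinder d 0)"
    proof (cases x)
      case (Inl t)
      show ?thesis
      proof (cases "t \<in> F")
        case False
        then have "t \<in> (\<Union>d\<in>Inr -` K. range (\<lambda>n. (n, d \<inter> B n))) - F" using x Inl unfolding F(2)[symmetric] by simp
        then show ?thesis using Inl unfolding cylinder_def by auto
      qed (use Inl in auto)
    next
      case (Inr d)
      then show ?thesis using x unfolding cylinder_def by auto
    qed
  qed
  moreover have "Inr -` K \<in> Fpow (Pow \<Lambda>)" using K by (rule branch.attach_new_part)
  ultimately show ?thesis using that[of F] F(1) unfolding Fpow_def by simp
qed

lemma card_of_level: "|{..n :: nat} \<times> Pow (B n)| <o |\<Lambda>|"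
  by (intro card_of_Times_less_infinite infinite finite_card_of_less Pow_small B_small) simp

lemma graded_branch_ring: "graded \<Lambda> branch_ring (Inl ` nodes) (case_sum fst (\<lambda>_. 0))"
proof
  show "compact_ring branch_ring" unfolding branch_ring_def by (rule branch.compact_ring_attach)
next
  fix z :: "nat \<times> 'l set + 'l set" assume "z \<in> Inl ` nodes"
  then obtain t where t: "t \<in> nodes" "z = Inl t" by blast
  then have "{t} \<in> Fpow nodes" unfolding Fpow_def by simp
  from branch.attach_base[OF this] show "{z} \<in> branch_ring" unfolding branch_ring_def t(2) by simp
next
  fix K assume K: "K \<in> branch_ring" "K \<noteq> {}"
  then obtain x where x: "x \<in> K" by blast
  show "K \<inter> Inl ` nodes \<noteq> {}"
  proof (cases x)
    case (Inl t)
    moreover have "K \<subseteq> \<Union>branch_ring" using K(1) by blast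
    ultimately show ?thesis using x unfolding Union_branch_ring by auto
  next
    case (Inr d)
    have K': "K \<in> attach (Fpow nodes) (Fpow (Pow \<Lambda>)) (\<lambda>d. range (\<lambda>n. (n, d \<inter> B n)))"
      using K(1) unfolding branch_ring_def .
    obtain F where F: "F \<in> Fpow nodes"
      "Inl -` K - F = (\<Union>d\<in>Inr -` K. range (\<lambda>n. (n, d \<inter> B n))) - F" using K' by (rule branch.attach_trace)
    have "infinite (range (\<lambda>n. (n, d \<inter> B n)))"
      by (rule range_inj_infinite) (simp add: inj_on_def)
    moreover have "finite F" using F(1) unfolding Fpow_def by simp
    ultimately have "\<not> range (\<lambda>n. (n, d \<inter> B n)) \<subseteq> F" using finite_subset by blast
    then obtain n where "(n, d \<inter> B n) \<notin> F" by blast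
    moreover have "d \<in> Inr -` K" using x Inr by simp
    ultimately have "(n, d \<inter> B n) \<in> (\<Union>d\<in>Inr -` K. range (\<lambda>n. (n, d \<inter> B n))) - F" by blast
    then have "Inl (n, d \<inter> B n) \<in> K" unfolding F(2)[symmetric] by simp
    then show ?thesis using node_mem[of n d] by auto
  qed
next
  fix K n assume "K \<in> branch_ring"
  then obtain F where F: "finite F" "finite (Inr -` K)" "Inr -` K \<subseteq> Pow \<Lambda>"
    "K \<subseteq> Inl ` F \<union> (\<Union>d\<in>Inr -` K. cylinder d 0)" by (rule branch_ring_cover)
  have "{z \<in> K \<inter> Inl ` nodes. case_sum fst (\<lambda>_. 0) z \<le> n} \<subseteq>
      Inl ` F \<union> (\<lambda>(k, d). Inl (k, d \<inter> B k)) ` ({..n} \<times> (Inr -` K))"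
  proof
    fix z assume z: "z \<in> {z \<in> K \<inter> Inl ` nodes. case_sum fst (\<lambda>_. 0) z \<le> n}"
    then have "z \<in> Inl ` F \<union> (\<Union>d\<in>Inr -` K. cylinder d 0)" using F(4) by blast
    then consider "z \<in> Inl ` F" | d k where "d \<in> Inr -` K" "z = Inl (k, d \<inter> B k)"
      using z unfolding cylinder_def by auto
    then show "z \<in> Inl ` F \<union> (\<lambda>(k, d). Inl (k, d \<inter> B k)) ` ({..n} \<times> (Inr -` K))"
      using z by cases auto
  qed
  moreover have "finite (Inl ` F \<union> (\<lambda>(k, d). Inl (k, d \<inter> B k)) ` ({..n} \<times> (Inr -` K)))" using F by blast
  ultimately show "finite {z \<in> K \<inter> Inl ` nodes. case_sum fst (\<lambda>_. 0) z \<le> n}" by (rule finite_subset)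
next
  fix n
  have "{z \<in> (Inl ` nodes :: (nat \<times> 'l set + 'l set) set). case_sum fst (\<lambda>_. 0) z \<le> n} \<subseteq> Inl ` ({..n} \<times> Pow (B n))"
    unfolding nodes_def using B_mono[of _ n] by fastforce
  then have "|{z \<in> (Inl ` nodes :: (nat \<times> 'l set + 'l set) set). case_sum fst (\<lambda>_. 0) z \<le> n}| \<le>o |{..n} \<times> Pow (B n)|"
    by (rule ordLeq_transitive[OF card_of_mono1 card_of_image])
  then show "|{z \<in> (Inl ` nodes :: (nat \<times> 'l set + 'l set) set). case_sum fst (\<lambda>_. 0) z \<le> n}| <o |\<Lambda>|"
    using card_of_level by (rule ordLeq_ordLess_trans)
qed

end

section \<open>Left rankings and stages\<close>

text \<open>
  From here on \<open>\<kappa> = 2\<^bsup>|\<Lambda>|\<^esup>\<close>, and \<open>\<alpha>\<close> is an ordinal below \<open>\<kappa>\<^sup>+\<close>.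
\<close>

locale left_types = strong_limit \<Lambda> B for \<Lambda> :: "'l set" and B +
  fixes \<kappa> :: "'k rel" and \<alpha> :: "'a rel"
  assumes card_\<kappa>: "Card_order \<kappa>" and \<kappa>_Pow: "\<kappa> =o |Pow \<Lambda>|"
    and well_\<alpha>: "Well_order \<alpha>" and \<alpha>_small: "|Field \<alpha>| \<le>o \<kappa>"
begin

definition less :: "'a \<Rightarrow> 'a \<Rightarrow> bool" where
  "less a b \<longleftrightarrow> (a, b) \<in> \<alpha> \<and> a \<noteq> b"

lemma \<alpha>_refl: "a \<in> Field \<alpha> \<Longrightarrow> (a, a) \<in> \<alpha>"
  and \<alpha>_trans: "\<lbrakk>(a, b) \<in> \<alpha>; (b, c) \<in> \<alpha>\<rbrakk> \<Longrightarrow> (a, c) \<in> \<alpha>"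
  and \<alpha>_antisym: "\<lbrakk>(a, b) \<in> \<alpha>; (b, a) \<in> \<alpha>\<rbrakk> \<Longrightarrow> a = b"
  and \<alpha>_total: "\<lbrakk>a \<in> Field \<alpha>; b \<in> Field \<alpha>\<rbrakk> \<Longrightarrow> (a, b) \<in> \<alpha> \<or> less b a"
proof -
  interpret wo_rel \<alpha> using well_\<alpha> by (simp add: wo_rel_def)
  show "a \<in> Field \<alpha> \<Longrightarrow> (a, a) \<in> \<alpha>" using REFL by (simp add: refl_on_def)
  show "\<lbrakk>(a, b) \<in> \<alpha>; (b, c) \<in> \<alpha>\<rbrakk> \<Longrightarrow> (a, c) \<in> \<alpha>" using TRANS by (rule transD)
  show "\<lbrakk>(a, b) \<in> \<alpha>; (b, a) \<in> \<alpha>\<rbrakk> \<Longrightarrow> a = b" using ANTISYM by (rule antisymD)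
  show "\<lbrakk>a \<in> Field \<alpha>; b \<in> Field \<alpha>\<rbrakk> \<Longrightarrow> (a, b) \<in> \<alpha> \<or> less b a"
    using TOTALS REFL unfolding less_def by (metis refl_onD)
qed

lemma le_less_trans: "\<lbrakk>(a, b) \<in> \<alpha>; less b c\<rbrakk> \<Longrightarrow> less a c"
  unfolding less_def using \<alpha>_trans \<alpha>_antisym by blast

lemma less_not_le: "less a b \<Longrightarrow> (b, a) \<notin> \<alpha>"
  unfolding less_def using \<alpha>_antisym by blast

lemma infinite_\<kappa>: "infinite (Field \<kappa>)"
proof -
  have "|Field \<kappa>| =o |Pow \<Lambda>|" using card_of_Field_ordIso[OF card_\<kappa>] \<kappa>_Pow by (rule ordIso_transitive)
  then show ?thesis using infinite_Pow card_of_ordIso_finite by blast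
qed

lemma Pow_le_\<kappa>: "|Pow \<Lambda>| \<le>o \<kappa>"
  by (rule ordIso_imp_ordLeq[OF ordIso_symmetric[OF \<kappa>_Pow]])

lemma \<Lambda>_le_\<kappa>: "|\<Lambda>| \<le>o \<kappa>"
  using ordLess_imp_ordLeq[OF card_of_Pow] Pow_le_\<kappa> by (rule ordLeq_transitive)

lemma \<kappa>_le_iff: "\<kappa> \<le>o |A| \<longleftrightarrow> |Pow \<Lambda>| \<le>o |A|"
  using ordIso_ordLeq_trans[OF \<kappa>_Pow] ordIso_ordLeq_trans[OF ordIso_symmetric[OF \<kappa>_Pow]] by (rule iffI[rotated])

lemma Un_le_\<kappa>: "\<lbrakk>|A| \<le>o \<kappa>; |C| \<le>o \<kappa>\<rbrakk> \<Longrightarrow> |A \<union> C| \<le>o \<kappa>"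
  by (rule card_of_Un_ordLeq_infinite_Field[OF infinite_\<kappa> _ _ card_\<kappa>])

lemma Sigma_le_\<kappa>: "\<lbrakk>|A| \<le>o \<kappa>; \<And>x. x \<in> A \<Longrightarrow> |C x| \<le>o \<kappa>\<rbrakk> \<Longrightarrow> |SIGMA x:A. C x| \<le>o \<kappa>"
  by (intro card_of_Sigma_ordLeq_infinite_Field[OF infinite_\<kappa> card_\<kappa>] ballI)

lemma image_le_\<kappa>: "|A| \<le>o \<kappa> \<Longrightarrow> |f ` A| \<le>o \<kappa>"
  by (rule ordLeq_transitive[OF card_of_image])

lemma card_of_under: "|{b. (b, a) \<in> \<kappa>}| <o |Pow \<Lambda>|"
proof (cases "a \<in> Field \<kappa>")
  case True
  have "|underS \<kappa> a| <o |Pow \<Lambda>|"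
    using card_of_underS[OF card_\<kappa> True] \<kappa>_Pow by (rule ordLess_ordIso_trans)
  moreover have "|{a}| <o |Pow \<Lambda>|" using infinite_Pow by (intro finite_card_of_less) simp
  ultimately have "|underS \<kappa> a \<union> {a}| <o |Pow \<Lambda>|" by (rule card_of_Un_ordLess_infinite[OF infinite_Pow])
  moreover have "{b. (b, a) \<in> \<kappa>} \<subseteq> underS \<kappa> a \<union> {a}" unfolding underS_def by blast
  ultimately show ?thesis using ordLeq_ordLess_trans[OF card_of_mono1] by blast
next
  case False
  then have "{b. (b, a) \<in> \<kappa>} = {}" unfolding Field_def by blast
  then show ?thesis using infinite_Pow by (simp add: finite_card_of_less)
qed

text \<open>
  The positions of the points in a left-separating order that is embedded into \<open>\<kappa> \<cdot> \<alpha>\<close>: every point comes first in one of its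
  neighbourhoods. In this form the notion passes to subspaces at once, without collapsing the order.
\<close>

definition left_ranking :: "'x set set \<Rightarrow> ('x \<Rightarrow> 'k \<times> 'a) \<Rightarrow> bool" where
  "left_ranking \<K> p \<longleftrightarrow> inj_on p (\<Union>\<K>) \<and> p ` \<Union>\<K> \<subseteq> Field \<kappa> \<times> Field \<alpha> \<and>
     (\<forall>x\<in>\<Union>\<K>. \<exists>K\<in>\<K>. x \<in> K \<and> (\<forall>y\<in>K. (p x, p y) \<in> ord_times \<kappa> \<alpha>))"

lemma left_ranking_pullback:
  assumes p: "left_ranking \<K> p" and h: "inj_on h (\<Union>\<L>)" "h ` \<Union>\<L> \<subseteq> \<Union>\<K>"
    and trace: "\<And>K. K \<in> \<K> \<Longrightarrow> {x \<in> \<Union>\<L>. h x \<in> K} \<in> \<L>"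
  shows "left_ranking \<L> (p \<circ> h)"
  unfolding left_ranking_def
proof (intro conjI ballI)
  note all = p[unfolded left_ranking_def]
  note inj = conjunct1[OF all] and rng = conjunct1[OF conjunct2[OF all]] and nb = conjunct2[OF conjunct2[OF all]]
  show "inj_on (p \<circ> h) (\<Union>\<L>)" using h inj by (intro comp_inj_on) (auto intro: inj_on_subset)
  show "(p \<circ> h) ` \<Union>\<L> \<subseteq> Field \<kappa> \<times> Field \<alpha>" using h(2) rng by (simp only: image_comp[symmetric]) blast
  fix x assume x: "x \<in> \<Union>\<L>"
  then have "h x \<in> \<Union>\<K>" using h(2) by blast
  then obtain K where K: "K \<in> \<K>" "h x \<in> K" "\<forall>y\<in>K. (p (h x), p y) \<in> ord_times \<kappa> \<alpha>"
    using bspec[OF nb] by blast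
  show "\<exists>K\<in>\<L>. x \<in> K \<and> (\<forall>y\<in>K. ((p \<circ> h) x, (p \<circ> h) y) \<in> ord_times \<kappa> \<alpha>)"
  proof (rule bexI[OF _ trace[OF K(1)]], intro conjI ballI)
    show "x \<in> {x \<in> \<Union>\<L>. h x \<in> K}" using x K(2) by simp
    show "((p \<circ> h) x, (p \<circ> h) y) \<in> ord_times \<kappa> \<alpha>" if "y \<in> {x \<in> \<Union>\<L>. h x \<in> K}" for y
      using that K(3) by simp
  qed
qed

lemma left_ranking_residue: "left_ranking \<K> p \<Longrightarrow> left_ranking (residue \<K> N) p"
proof -
  assume p: "left_ranking \<K> p"
  have "left_ranking (residue \<K> N) (p \<circ> (\<lambda>x. x))"
  proof (rule left_ranking_pullback[OF p])
    show "(\<lambda>x. x) ` \<Union>(residue \<K> N) \<subseteq> \<Union>\<K>" unfolding Union_residue by auto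
    fix K assume K: "K \<in> \<K>"
    have "{x \<in> \<Union>(residue \<K> N). x \<in> K} = K - N" unfolding Union_residue using K by auto
    then show "{x \<in> \<Union>(residue \<K> N). x \<in> K} \<in> residue \<K> N" using K unfolding residue_def by simp
  qed simp
  then show ?thesis by (simp add: o_def)
qed

lemma left_rankingD:
  assumes "left_ranking \<K> p"
  shows "inj_on p (\<Union>\<K>)" "x \<in> \<Union>\<K> \<Longrightarrow> snd (p x) \<in> Field \<alpha>"
    "x \<in> \<Union>\<K> \<Longrightarrow> \<exists>K\<in>\<K>. x \<in> K \<and> (\<forall>y\<in>K. (p x, p y) \<in> ord_times \<kappa> \<alpha>)"
proof -
  note all = assms[unfolded left_ranking_def]
  note rng = conjunct1[OF conjunct2[OF all]] and nb = conjunct2[OF conjunct2[OF all]]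
  show "inj_on p (\<Union>\<K>)" by (rule conjunct1[OF all])
  show "x \<in> \<Union>\<K> \<Longrightarrow> snd (p x) \<in> Field \<alpha>"
    using subsetD[OF rng imageI[of x]] by (simp only: mem_Times_iff)
  show "x \<in> \<Union>\<K> \<Longrightarrow> \<exists>K\<in>\<K>. x \<in> K \<and> (\<forall>y\<in>K. (p x, p y) \<in> ord_times \<kappa> \<alpha>)" using nb by (rule bspec)
qed

lemma ord_times_snd:
  assumes "(u, v) \<in> ord_times \<kappa> \<alpha>" shows "(snd u, snd v) \<in> \<alpha>"
  using assms \<alpha>_refl unfolding ord_times_def by auto

lemma ord_times_fst:
  assumes "(u, v) \<in> ord_times \<kappa> \<alpha>" "snd u = snd v" shows "(fst u, fst v) \<in> \<kappa>"
  using assms unfolding ord_times_def by auto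

text \<open>
  The level function \<open>L\<close> is meant for the points outside \<open>N\<close> only. Near each of these, the other points outside
  \<open>N\<close> are on strictly higher levels, so that it comes first in a neighbourhood.
\<close>

definition graded_levels :: "'x set set \<Rightarrow> 'x set \<Rightarrow> ('x \<Rightarrow> nat) \<Rightarrow> ('x \<Rightarrow> 'a) \<Rightarrow> bool" where
  "graded_levels \<K> N g L \<longleftrightarrow> graded \<Lambda> \<K> N g \<and> |\<Union>\<K>| \<le>o \<kappa> \<and>
     (\<forall>x\<in>\<Union>\<K> - N. \<exists>K\<in>\<K>. x \<in> K \<and> (\<forall>y\<in>K - N. y \<noteq> x \<longrightarrow> less (L x) (L y)))"

lemma graded_levelsD:
  assumes "graded_levels \<K> N g L"
  shows "graded \<Lambda> \<K> N g" "|\<Union>\<K>| \<le>o \<kappa>"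
    "\<lbrakk>x \<in> \<Union>\<K>; x \<notin> N\<rbrakk> \<Longrightarrow> \<exists>K\<in>\<K>. x \<in> K \<and> (\<forall>y\<in>K - N. y \<noteq> x \<longrightarrow> less (L x) (L y))"
proof -
  show "graded \<Lambda> \<K> N g" using assms unfolding graded_levels_def by (rule conjunct1)
  show "|\<Union>\<K>| \<le>o \<kappa>" using assms unfolding graded_levels_def by (elim conjE)
  have "\<forall>x\<in>\<Union>\<K> - N. \<exists>K\<in>\<K>. x \<in> K \<and> (\<forall>y\<in>K - N. y \<noteq> x \<longrightarrow> less (L x) (L y))"
    using assms unfolding graded_levels_def by (elim conjE)
  then show "\<lbrakk>x \<in> \<Union>\<K>; x \<notin> N\<rbrakk> \<Longrightarrow> \<exists>K\<in>\<K>. x \<in> K \<and> (\<forall>y\<in>K - N. y \<noteq> x \<longrightarrow> less (L x) (L y))"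
    using bspec[of "\<Union>\<K> - N" _ x] by simp
qed

text \<open>
  The conditions on \<open>L\<close> bound the left-separating type of the residue from above, and the condition on rankings bounds it from
  below: there must be \<open>\<kappa>\<close> points on level \<open>\<gamma>\<close> or later.
\<close>

definition stage :: "'a \<Rightarrow> 'x set set \<Rightarrow> 'x set \<Rightarrow> ('x \<Rightarrow> nat) \<Rightarrow> ('x \<Rightarrow> 'a) \<Rightarrow> bool" where
  "stage \<gamma> \<K> N g L \<longleftrightarrow> graded_levels \<K> N g L \<and> (\<forall>x\<in>\<Union>\<K> - N. (L x, \<gamma>) \<in> \<alpha>) \<and>
     (\<forall>p. left_ranking (residue \<K> N) p \<longrightarrow> \<kappa> \<le>o |{x \<in> \<Union>\<K> - N. (\<gamma>, snd (p x)) \<in> \<alpha>}| )"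

lemma stageD:
  assumes "stage \<gamma> \<K> N g L"
  shows "graded_levels \<K> N g L" "\<lbrakk>x \<in> \<Union>\<K>; x \<notin> N\<rbrakk> \<Longrightarrow> (L x, \<gamma>) \<in> \<alpha>"
    "left_ranking (residue \<K> N) p \<Longrightarrow> \<kappa> \<le>o |{x \<in> \<Union>\<K> - N. (\<gamma>, snd (p x)) \<in> \<alpha>}|"
  using assms unfolding stage_def by auto

lemma card_of_graded:
  assumes "graded \<Lambda> \<K> N g" shows "|N| \<le>o |\<Lambda>|"
proof -
  have "N = (\<Union>n. {z \<in> N. g z \<le> n})" by auto
  moreover have "|\<Union>n. {z \<in> N. g z \<le> n}| \<le>o |\<Lambda>|"
    using nat_le ordLess_imp_ordLeq[OF graded.small_level[OF assms]]
    by (intro card_of_UNION_ordLeq_infinite[OF infinite]) auto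
  ultimately show ?thesis by simp
qed

text \<open>
  Otherwise let \<open>H\<close> be the set of the \<open>\<kappa>\<close> points on levels at least \<open>\<gamma>\<close>. By density each of them precedes a point of \<open>N\<close>, so both are on level
  \<open>\<gamma>\<close>, and \<open>H\<close> is the union over \<open>z \<in> N\<close> of the points of level \<open>\<gamma>\<close> before \<open>z\<close>. These are at most \<open>|\<Lambda>|\<close> sets of size less than \<open>\<kappa>\<close>, contrary to \<open>Koenig\<close>.
\<close>

lemma stage_top:
  assumes st: "stage \<gamma> \<K> N g L" and p: "left_ranking \<K> p" and \<gamma>: "\<gamma> \<in> Field \<alpha>"
  shows "\<exists>z\<in>N. less \<gamma> (snd (p z))"
proof (rule ccontr)
  assume no: "\<not> ?thesis"
  let ?H = "{x \<in> \<Union>\<K> - N. (\<gamma>, snd (p x)) \<in> \<alpha>}"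
  have gr: "graded \<Lambda> \<K> N g" using graded_levelsD(1)[OF stageD(1)[OF st]] .
  have NK: "z \<in> \<Union>\<K>" if "z \<in> N" for z using graded.isolated[OF gr that] by blast
  have "|?H| \<le>o |\<Union>z\<in>N. {b. (b, fst (p z)) \<in> \<kappa>}|"
  proof (rule card_of_ordLeqI[of "\<lambda>x. fst (p x)"])
    have key: "snd (p x) = \<gamma> \<and> (\<exists>z\<in>N. (fst (p x), fst (p z)) \<in> \<kappa>)" if x: "x \<in> ?H" for x
    proof -
      obtain K where K: "K \<in> \<K>" "x \<in> K" "\<forall>y\<in>K. (p x, p y) \<in> ord_times \<kappa> \<alpha>"
        using left_rankingD(3)[OF p, of x] x by blast
      obtain z where z: "z \<in> K" "z \<in> N" using graded.dense[OF gr K(1)] K(2) by blast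
      have pz: "(p x, p z) \<in> ord_times \<kappa> \<alpha>" using K(3) z(1) by blast
      have "(snd (p z), \<gamma>) \<in> \<alpha>"
        using no \<alpha>_total[OF left_rankingD(2)[OF p NK[OF z(2)]] \<gamma>] z(2) by blast
      moreover have "(\<gamma>, snd (p x)) \<in> \<alpha>" using x by simp
      ultimately have "snd (p x) = \<gamma>" "snd (p z) = \<gamma>"
        using ord_times_snd[OF pz] \<alpha>_trans \<alpha>_antisym by metis+
      then show ?thesis using ord_times_fst[OF pz] z(2) by auto
    qed
    show "inj_on (\<lambda>x. fst (p x)) ?H"
    proof (rule inj_onI)
      fix x y assume xy: "x \<in> ?H" "y \<in> ?H" "fst (p x) = fst (p y)"
      then have "p x = p y" using key[OF xy(1)] key[OF xy(2)] by (simp add: prod_eq_iff)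
      then show "x = y" using inj_onD[OF left_rankingD(1)[OF p]] xy(1,2) by blast
    qed
    show "fst (p x) \<in> (\<Union>z\<in>N. {b. (b, fst (p z)) \<in> \<kappa>})" if "x \<in> ?H" for x
      using key[OF that] by blast
  qed
  also have "|\<Union>z\<in>N. {b. (b, fst (p z)) \<in> \<kappa>}| <o |Pow \<Lambda>|"
    using infinite card_of_graded[OF gr] card_of_under by (rule Koenig)
  finally have "|?H| <o |Pow \<Lambda>|" .
  moreover have "\<kappa> \<le>o |?H|" using stageD(3)[OF st left_ranking_residue[OF p]] .
  ultimately show False unfolding \<kappa>_le_iff using not_ordLess_ordLeq by blast
qed

end

section \<open>Construction of the stages\<close>

context strong_limit
begin

text \<open>
  The combs of \<open>needles\<close> satisfy the conditions for gluing. The cylinders for one piece are disjoint since the comb leaves \<open>x i\<close> at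
  different levels or through different nodes; those for two pieces are eventually disjoint since \<open>x i \<noteq> x j\<close>; and each branch
  other than \<open>x i\<close> splits from \<open>x i\<close> at some level, after which the comb stays away from it.
\<close>

lemma cylinder_gluing:
  fixes N :: "'i \<Rightarrow> 'x set" and lv :: "'i \<Rightarrow> nat \<Rightarrow> nat"
  assumes pieces: "\<And>i. i \<in> I \<Longrightarrow> graded \<Lambda> (\<K> i) (N i) (g i)"
    and x: "inj_on x I" "\<And>i. i \<in> I \<Longrightarrow> x i \<subseteq> \<Lambda>"
    and lv: "\<And>i k. i \<in> I \<Longrightarrow> k \<le> lv i k"
    and inj: "\<And>i k. i \<in> I \<Longrightarrow> inj_on (\<lambda>z. a i k z \<inter> B (lv i k)) {z \<in> N i. g i z \<le> k}"
    and mem: "\<And>i k z. \<lbrakk>i \<in> I; z \<in> N i; g i z \<le> k\<rbrakk> \<Longrightarrow> a i k z \<subseteq> \<Lambda>"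
    and off: "\<And>i k z. \<lbrakk>i \<in> I; z \<in> N i; g i z \<le> k\<rbrakk> \<Longrightarrow> a i k z \<inter> B (lv i k) \<noteq> x i \<inter> B (lv i k)"
    and conv: "\<And>i j k z. \<lbrakk>i \<in> I; z \<in> N i; g i z \<le> k; j < k\<rbrakk> \<Longrightarrow> a i k z \<inter> B (lv i j) = x i \<inter> B (lv i j)"
  shows "gluing \<Lambda> branch_ring (Inl ` nodes) (case_sum fst (\<lambda>_. 0)) I \<K> N g (\<lambda>i k z. cylinder (a i k z) (lv i k))"
proof (rule gluing.intro)
  have conv': "a i k z \<inter> B m = x i \<inter> B m" if "i \<in> I" "z \<in> N i" "g i z \<le> k" "m < k" for i z k m
    using conv[OF that] by (rule level_down) (rule lv[OF that(1)])
  show "graded \<Lambda> branch_ring (Inl ` nodes) (case_sum fst (\<lambda>_. 0))" by (rule graded_branch_ring)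
  show "graded \<Lambda> (\<K> i) (N i) (g i)" if "i \<in> I" for i using that by (rule pieces)
  show "cylinder (a i k z) (lv i k) \<in> branch_ring" if "i \<in> I" "z \<in> N i" "g i z \<le> k" for i k z
    by (rule cylinder_mem[OF mem[OF that]])
  show "cylinder (a i k z) (lv i k) \<noteq> {}" for i k z unfolding cylinder_def by simp
  show "cylinder (a i k z) (lv i k) \<inter> cylinder (a i k' z') (lv i k') = {}"
    if i: "i \<in> I" and z: "z \<in> N i" "g i z \<le> k" "z' \<in> N i" "g i z' \<le> k'" and ne: "(k, z) \<noteq> (k', z')" for i z k z' k'
  proof (cases rule: linorder_cases[of k k'])
    case less
    have "a i k z \<inter> B (lv i k) \<noteq> a i k' z' \<inter> B (lv i k)"
      using off[OF i z(1,2)] conv[OF i z(3,4) less] by simp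
    then show ?thesis by (rule cylinder_disjoint) simp
  next
    case equal
    then have "a i k z \<inter> B (lv i k) \<noteq> a i k' z' \<inter> B (lv i k)"
      using inj_onD[OF inj[OF i, of k], of z z'] z ne by auto
    then show ?thesis by (rule cylinder_disjoint) simp
  next
    case greater
    have "a i k z \<inter> B (lv i k') \<noteq> a i k' z' \<inter> B (lv i k')"
      using off[OF i z(3,4)] conv[OF i z(1,2) greater] by simp
    then show ?thesis by (rule cylinder_disjoint) simp
  qed
  show "\<exists>m. \<forall>k\<ge>m. \<forall>k'\<ge>m. \<forall>z\<in>N i. \<forall>z'\<in>N j. g i z \<le> k \<longrightarrow> g j z' \<le> k' \<longrightarrow>
      cylinder (a i k z) (lv i k) \<inter> cylinder (a j k' z') (lv j k') = {}" if ij: "i \<in> I" "j \<in> I" "i \<noteq> j" for i j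
  proof -
    have "x i \<noteq> x j" using inj_onD[OF x(1)] ij by blast
    with x(2)[OF ij(1)] x(2)[OF ij(2)]
    obtain m where m: "\<And>n. m \<le> n \<Longrightarrow> x i \<inter> B n \<noteq> x j \<inter> B n" by (rule separated_levels) blast
    show ?thesis
    proof (intro exI[of _ "Suc m"] allI ballI impI)
      fix k k' z z' assume k: "Suc m \<le> k" "Suc m \<le> k'" and z: "z \<in> N i" "z' \<in> N j" "g i z \<le> k" "g j z' \<le> k'"
      have "a i k z \<inter> B m = x i \<inter> B m" "a j k' z' \<inter> B m = x j \<inter> B m"
        using conv'[OF ij(1) z(1,3), of m] conv'[OF ij(2) z(2,4), of m] k by simp_all
      then have "a i k z \<inter> B m \<noteq> a j k' z' \<inter> B m" using m[of m] by simp
      then show "cylinder (a i k z) (lv i k) \<inter> cylinder (a j k' z') (lv j k') = {}"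
        by (rule cylinder_disjoint) (use lv[OF ij(1), of k] k in simp)
    qed
  qed
  show "\<exists>m. \<forall>k\<ge>m. \<forall>z\<in>N i. g i z \<le> k \<longrightarrow> K \<inter> cylinder (a i k z) (lv i k) = {}"
    if i: "i \<in> I" and K: "K \<in> branch_ring" for i K
  proof -
    obtain F where F: "finite F" "finite (Inr -` K)" "Inr -` K \<subseteq> Pow \<Lambda>" "K \<subseteq> Inl ` F \<union> (\<Union>d\<in>Inr -` K. cylinder d 0)"
      using K by (rule branch_ring_cover)
    have "\<exists>m. \<forall>k\<ge>m. \<forall>z\<in>N i. g i z \<le> k \<longrightarrow> cylinder d 0 \<inter> cylinder (a i k z) (lv i k) = {}" if d: "d \<in> Inr -` K" for d
    proof (cases "d = x i")
      case True
      have "cylinder d 0 \<inter> cylinder (a i k z) (lv i k) = {}" if "z \<in> N i" "g i z \<le> k" for k z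
        using off[OF i that, symmetric] unfolding True by (rule cylinder_disjoint) simp
      then show ?thesis by blast
    next
      case False
      have "d \<subseteq> \<Lambda>" using d F(3) by blast
      from this x(2)[OF i] False
      obtain m where m: "\<And>n. m \<le> n \<Longrightarrow> d \<inter> B n \<noteq> x i \<inter> B n" by (rule separated_levels) blast
      have "cylinder d 0 \<inter> cylinder (a i k z) (lv i k) = {}" if "Suc m \<le> k" "z \<in> N i" "g i z \<le> k" for k z
      proof (rule cylinder_disjoint)
        show "d \<inter> B m \<noteq> a i k z \<inter> B m" using m[of m] conv'[OF i that(2,3), of m] that(1) by simp
        show "m \<le> 0 \<or> m \<le> lv i k" using lv[OF i, of k] that(1) by simp
      qed
      then show ?thesis by blast
    qed
    from bchoice[OF ballI[OF this]] obtain m where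
      m: "\<forall>d\<in>Inr -` K. \<forall>k\<ge>m d. \<forall>z\<in>N i. g i z \<le> k \<longrightarrow> cylinder d 0 \<inter> cylinder (a i k z) (lv i k) = {}" by (rule exE)
    obtain m1 where m1: "\<forall>n\<in>m ` (Inr -` K) \<union> fst ` F. n \<le> m1"
      using F(1,2) finite_nat_set_iff_bounded_le[of "m ` (Inr -` K) \<union> fst ` F"] by auto
    show ?thesis
    proof (intro exI[of _ "Suc m1"] allI ballI impI)
      fix k z assume k: "Suc m1 \<le> k" and z: "z \<in> N i" "g i z \<le> k"
      have "Inl ` F \<inter> cylinder (a i k z) (lv i k) = {}"
      proof (rule ccontr)
        assume "\<not> ?thesis"
        then obtain n A where n: "(n, A) \<in> F" "lv i k \<le> n" unfolding cylinder_def by auto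
        then have "n \<le> m1" using m1 by force
        then show False using n(2) lv[OF i, of k] k by simp
      qed
      moreover have "cylinder d 0 \<inter> cylinder (a i k z) (lv i k) = {}" if d: "d \<in> Inr -` K" for d
      proof -
        have "m d \<le> m1" using m1 d by (intro bspec[OF m1] UnI1 imageI)
        then have "m d \<le> k" using k by simp
        then show ?thesis using bspec[OF m d] z by blast
      qed
      ultimately show "K \<inter> cylinder (a i k z) (lv i k) = {}" using F(4) by blast
    qed
  qed
  show "k \<le> case_sum fst (\<lambda>_. 0) q" if "i \<in> I" "q \<in> cylinder (a i k z) (lv i k)" "q \<in> Inl ` nodes" for i z k q
    using that lv[OF that(1), of k] unfolding cylinder_def by auto
qed

end

context left_types
begin

lemma less_trans: "\<lbrakk>less a b; less b c\<rbrakk> \<Longrightarrow> less a c"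
  using le_less_trans unfolding less_def by blast

lemma piece_ranking:
  assumes gl: "gluing \<Lambda> \<Q> M h I \<K> N g c" and i: "i \<in> I"
    and p: "left_ranking (residue (attach \<Q> (sum_ring I \<K>) (glue_trace I N g c)) (Inl ` M)) p"
  shows "left_ranking (\<K> i) (\<lambda>y. p (Inr (i, y)))"
proof -
  interpret gluing \<Lambda> \<Q> M h I \<K> N g c by (rule gl)
  have "left_ranking (\<K> i) (p \<circ> (\<lambda>y. Inr (i, y)))"
  proof (rule left_ranking_pullback[OF p])
    show "inj_on (\<lambda>y. Inr (i, y)) (\<Union>(\<K> i))" by (simp add: inj_on_def)
    show "(\<lambda>y. Inr (i, y)) ` \<Union>(\<K> i) \<subseteq> \<Union>(residue glued (Inl ` M))"
      unfolding Union_residue Union_glued using i by auto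
    fix K assume "K \<in> residue glued (Inl ` M)"
    then obtain P where P: "P \<in> glued" "K = P - Inl ` M" unfolding residue_def by blast
    have f: "{y. Inr (i, y) \<in> P} \<in> \<K> i" by (rule glued_fiber[OF P(1) i])
    have "{y \<in> \<Union>(\<K> i). Inr (i, y) \<in> K} = {y. Inr (i, y) \<in> P}" unfolding P(2) using f by auto
    then show "{y \<in> \<Union>(\<K> i). Inr (i, y) \<in> K} \<in> \<K> i" using f by simp
  qed
  then show ?thesis by (simp add: o_def)
qed

text \<open>
  The old isolated points of piece \<open>i\<close> are put on a level \<open>T i\<close>, above all other points of the piece and below the
  points of the base.
\<close>

lemma glued_levels:
  assumes gl: "gluing \<Lambda> \<Q> M h I \<K> N g c" and I: "|I| \<le>o \<kappa>"
    and base_levels: "graded_levels \<Q> M h LQ" and piece_levels: "\<And>i. i \<in> I \<Longrightarrow> graded_levels (\<K> i) (N i) (g i) (L i)"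
    and top: "\<And>i y. \<lbrakk>i \<in> I; y \<in> \<Union>(\<K> i); y \<notin> N i\<rbrakk> \<Longrightarrow> less (L i y) (T i)"
    and above: "\<And>i q. \<lbrakk>i \<in> I; q \<in> \<Union>\<Q>; q \<notin> M\<rbrakk> \<Longrightarrow> less (T i) (LQ q)"
  shows "graded_levels (attach \<Q> (sum_ring I \<K>) (glue_trace I N g c)) (Inl ` M) (case_sum h (\<lambda>_. 0))
    (case_sum LQ (\<lambda>(i, y). if y \<in> N i then T i else L i y))" (is "graded_levels ?G _ _ ?L")
proof -
  interpret gluing \<Lambda> \<Q> M h I \<K> N g c by (rule gl)
  have "\<exists>K\<in>glued. x \<in> K \<and> (\<forall>w\<in>K - Inl ` M. w \<noteq> x \<longrightarrow> less (?L x) (?L w))" if x: "x \<in> \<Union>glued" "x \<notin> Inl ` M" for x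
  proof (cases x)
    case (Inl q)
    then have "q \<in> \<Union>\<Q>" "q \<notin> M" using x unfolding Union_glued by auto
    then obtain K where K: "K \<in> \<Q>" "q \<in> K" "\<forall>y\<in>K - M. y \<noteq> q \<longrightarrow> less (LQ q) (LQ y)"
      using graded_levelsD(3)[OF base_levels] by blast
    show ?thesis
    proof (rule bexI[OF _ attach_base[OF K(1)]], intro conjI ballI impI)
      show "x \<in> Inl ` K" using Inl K(2) by simp
      fix w assume "w \<in> Inl ` K - Inl ` M" "w \<noteq> x"
      then obtain q' where "w = Inl q'" "q' \<in> K - M" "q' \<noteq> q" using Inl by auto
      then show "less (?L x) (?L w)" using K(3) Inl by simp
    qed
  next
    case (Inr iy)
    obtain i y where iy: "iy = (i, y)" by (cases iy)
    then have i: "i \<in> I" and y: "y \<in> \<Union>(\<K> i)" using x Inr unfolding Union_glued by auto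
    obtain U where U: "U \<in> \<K> i" "y \<in> U" "\<And>y'. \<lbrakk>y' \<in> U; y' \<noteq> y\<rbrakk> \<Longrightarrow> y \<notin> N i \<and> (y' \<notin> N i \<longrightarrow> less (L i y) (L i y'))"
    proof (cases "y \<in> N i")
      case True
      then have "{y} \<in> \<K> i" using graded.isolated[OF graded_levelsD(1)[OF piece_levels[OF i]]] by blast
      then show ?thesis by (rule that) auto
    next
      case False
      then obtain K where "K \<in> \<K> i" "y \<in> K" "\<forall>y'\<in>K - N i. y' \<noteq> y \<longrightarrow> less (L i y) (L i y')"
        using graded_levelsD(3)[OF piece_levels[OF i] y] by blast
      then show ?thesis using False by (intro that[of K]) auto
    qed
    have Lx: "?L x = (if y \<in> N i then T i else L i y)" using Inr iy by simp
    have le: "?L x = T i \<or> less (?L x) (T i)" unfolding Lx using top[OF i y] by simp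
    show ?thesis
    proof (rule bexI[OF _ glued_piece[OF i U(1)]], intro conjI ballI impI)
      show "x \<in> Inl ` (\<Union>y\<in>U. trace (i, y)) \<union> Inr ` Pair i ` U" using Inr iy U(2) by simp
      fix w assume w: "w \<in> Inl ` (\<Union>y\<in>U. trace (i, y)) \<union> Inr ` Pair i ` U - Inl ` M" "w \<noteq> x"
      show "less (?L x) (?L w)"
      proof (cases w)
        case (Inl q)
        then have "q \<in> (\<Union>y\<in>U. trace (i, y))" "q \<notin> M" using w by auto
        moreover then have "q \<in> \<Union>\<Q>" using trace_subset by blast
        ultimately have "less (T i) (LQ q)" using above[OF i] by blast
        then show ?thesis using le less_trans Inl by auto
      next
        case (Inr v)
        then obtain y' where y': "v = (i, y')" "y' \<in> U" using w by auto
        then have "y' \<noteq> y" using w(2) Inr \<open>x = Inr iy\<close> iy by auto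
        then have "y \<notin> N i" "y' \<notin> N i \<longrightarrow> less (L i y) (L i y')" using U(3)[OF y'(2)] by auto
        then show ?thesis unfolding Lx Inr y'(1) using top[OF i y] by simp
      qed
    qed
  qed
  moreover have "|\<Union>glued| \<le>o \<kappa>"
    unfolding Union_glued
    using graded_levelsD(2)[OF base_levels] graded_levelsD(2)[OF piece_levels] I
    by (intro Un_le_\<kappa> image_le_\<kappa> Sigma_le_\<kappa>)
  ultimately show ?thesis unfolding graded_levels_def using graded_glued by blast
qed

text \<open>Stages on other types are moved into the type of \<open>\<kappa>\<close>, so that the recursion can choose all of them from one type.\<close>

lemma stage_image:
  assumes st: "stage \<gamma> \<K> N g L" and h: "inj_on h (\<Union>\<K>)"
  shows "stage \<gamma> ((`) h ` \<K>) (h ` N) (g \<circ> inv_into (\<Union>\<K>) h) (L \<circ> inv_into (\<Union>\<K>) h)"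
proof -
  let ?v = "inv_into (\<Union>\<K>) h"
  have gl: "graded_levels \<K> N g L" by (rule stageD(1)[OF st])
  have gr: "graded \<Lambda> \<K> N g" by (rule graded_levelsD(1)[OF gl])
  have NK: "z \<in> \<Union>\<K>" if "z \<in> N" for z using graded.isolated[OF gr that] by blast
  have v: "?v (h x) = x" if "x \<in> \<Union>\<K>" for x using h that by (rule inv_into_f_f)
  have UN: "\<Union>((`) h ` \<K>) = h ` \<Union>\<K>" by blast
  have hN: "h x \<in> h ` N \<longleftrightarrow> x \<in> N" if "x \<in> \<Union>\<K>" for x
    using that NK inj_onD[OF h] by blast
  have "graded \<Lambda> ((`) h ` \<K>) (h ` N) (g \<circ> ?v)"
  proof
    show "compact_ring ((`) h ` \<K>)" using graded.ring[OF gr] h by (rule compact_ring_image)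
    show "{z} \<in> (`) h ` \<K>" if z: "z \<in> h ` N" for z
    proof -
      obtain y where y: "y \<in> N" "z = h y" using z by blast
      then have "{z} = h ` {y}" by simp
      then show ?thesis using graded.isolated[OF gr y(1)] by (rule image_eqI)
    qed
    show "K \<inter> h ` N \<noteq> {}" if K: "K \<in> (`) h ` \<K>" "K \<noteq> {}" for K
    proof -
      obtain K' where K': "K' \<in> \<K>" "K = h ` K'" using K(1) by blast
      then have "K' \<inter> N \<noteq> {}" using graded.dense[OF gr K'(1)] K(2) by blast
      then show ?thesis using K'(2) by blast
    qed
    show "finite {z \<in> K \<inter> h ` N. (g \<circ> ?v) z \<le> n}" if K: "K \<in> (`) h ` \<K>" for K n
    proof -
      obtain K' where K': "K' \<in> \<K>" "K = h ` K'" using K(1) by blast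
      have "{z \<in> K \<inter> h ` N. (g \<circ> ?v) z \<le> n} \<subseteq> h ` {z \<in> K' \<inter> N. g z \<le> n}"
      proof
        fix z assume z: "z \<in> {z \<in> K \<inter> h ` N. (g \<circ> ?v) z \<le> n}"
        then obtain y where y: "y \<in> K'" "z = h y" unfolding K'(2) by blast
        then have yK: "y \<in> \<Union>\<K>" using K'(1) by blast
        then have "y \<in> N" "g y \<le> n" using z hN[OF yK] v[OF yK] unfolding y(2) by auto
        then show "z \<in> h ` {z \<in> K' \<inter> N. g z \<le> n}" using y by blast
      qed
      then show ?thesis using finite_imageI[OF graded.finite_level[OF gr K'(1)]] by (rule finite_subset)
    qed
    show "|{z \<in> h ` N. (g \<circ> ?v) z \<le> n}| <o |\<Lambda>|" for n
    proof -
      have "{z \<in> h ` N. (g \<circ> ?v) z \<le> n} \<subseteq> h ` {z \<in> N. g z \<le> n}" using v[OF NK] by auto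
      then have "|{z \<in> h ` N. (g \<circ> ?v) z \<le> n}| \<le>o |{z \<in> N. g z \<le> n}|"
        by (rule ordLeq_transitive[OF card_of_mono1 card_of_image])
      then show ?thesis using graded.small_level[OF gr] by (rule ordLeq_ordLess_trans)
    qed
  qed
  moreover have "|\<Union>((`) h ` \<K>)| \<le>o \<kappa>" unfolding UN using graded_levelsD(2)[OF gl] by (rule image_le_\<kappa>)
  moreover have "\<exists>K\<in>(`) h ` \<K>. x \<in> K \<and> (\<forall>y\<in>K - h ` N. y \<noteq> x \<longrightarrow> less ((L \<circ> ?v) x) ((L \<circ> ?v) y))"
    if x: "x \<in> \<Union>((`) h ` \<K>) - h ` N" for x
  proof -
    obtain u where u: "x = h u" "u \<in> \<Union>\<K>" "u \<notin> N" using x unfolding UN by blast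
    obtain K where K: "K \<in> \<K>" "u \<in> K" "\<forall>y\<in>K - N. y \<noteq> u \<longrightarrow> less (L u) (L y)"
      using graded_levelsD(3)[OF gl u(2,3)] by blast
    show ?thesis
    proof (intro bexI[OF _ imageI[OF K(1)]] conjI ballI impI)
      show "x \<in> h ` K" using u K(2) by blast
      fix y assume y: "y \<in> h ` K - h ` N" "y \<noteq> x"
      then obtain w where w: "y = h w" "w \<in> K" by blast
      then have "w \<in> \<Union>\<K>" "w \<in> K - N" "w \<noteq> u" using y u K(1) by auto
      then show "less ((L \<circ> ?v) x) ((L \<circ> ?v) y)" using K(3) v u w by simp
    qed
  qed
  ultimately have "graded_levels ((`) h ` \<K>) (h ` N) (g \<circ> ?v) (L \<circ> ?v)"
    unfolding graded_levels_def by simp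
  moreover have "((L \<circ> ?v) x, \<gamma>) \<in> \<alpha>" if x: "x \<in> \<Union>((`) h ` \<K>) - h ` N" for x
  proof -
    obtain u where u: "x = h u" "u \<in> \<Union>\<K>" "u \<notin> N" using x unfolding UN by blast
    then show ?thesis using stageD(2)[OF st u(2,3)] v by simp
  qed
  moreover have "\<kappa> \<le>o |{x \<in> \<Union>((`) h ` \<K>) - h ` N. (\<gamma>, snd (p x)) \<in> \<alpha>}|"
    if p: "left_ranking (residue ((`) h ` \<K>) (h ` N)) p" for p
  proof -
    have "left_ranking (residue \<K> N) (p \<circ> h)"
    proof (rule left_ranking_pullback[OF p])
      show "inj_on h (\<Union>(residue \<K> N))" unfolding Union_residue using h by (rule inj_on_subset) blast
      show "h ` \<Union>(residue \<K> N) \<subseteq> \<Union>(residue ((`) h ` \<K>) (h ` N))"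
      proof
        fix y assume "y \<in> h ` \<Union>(residue \<K> N)"
        then obtain u where u: "u \<in> \<Union>\<K>" "u \<notin> N" "y = h u" unfolding Union_residue by blast
        show "y \<in> \<Union>(residue ((`) h ` \<K>) (h ` N))"
          unfolding Union_residue UN u(3) using imageI[OF u(1), of h] hN[OF u(1)] u(2) by (intro DiffI) blast+
      qed
      fix K assume "K \<in> residue ((`) h ` \<K>) (h ` N)"
      then obtain K' where K': "K' \<in> \<K>" "K = h ` K' - h ` N" unfolding residue_def by blast
      have "{x \<in> \<Union>(residue \<K> N). h x \<in> K} = K' - N"
      proof (intro equalityI subsetI)
        fix x assume "x \<in> {x \<in> \<Union>(residue \<K> N). h x \<in> K}"
        then have x: "x \<in> \<Union>\<K>" "x \<notin> N" "h x \<in> h ` K'" unfolding Union_residue K'(2) by simp_all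
        then obtain x' where x': "x' \<in> K'" "h x = h x'" by blast
        then have "x = x'" using inj_onD[OF h x'(2) x(1)] K'(1) by blast
        then show "x \<in> K' - N" using x' x by blast
      next
        fix x assume x: "x \<in> K' - N"
        then have xK: "x \<in> \<Union>\<K>" using K'(1) by blast
        have "x \<in> K'" "h x \<notin> h ` N" using x hN[OF xK] by simp_all
        then show "x \<in> {x \<in> \<Union>(residue \<K> N). h x \<in> K}"
          using x xK unfolding Union_residue K'(2) by (intro CollectI conjI DiffI imageI) simp_all
      qed
      then show "{x \<in> \<Union>(residue \<K> N). h x \<in> K} \<in> residue \<K> N" using K'(1) unfolding residue_def by simp
    qed
    from stageD(3)[OF st this]
    have "\<kappa> \<le>o |{x \<in> \<Union>\<K> - N. (\<gamma>, snd (p (h x))) \<in> \<alpha>}|" by simp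
    also have "|{x \<in> \<Union>\<K> - N. (\<gamma>, snd (p (h x))) \<in> \<alpha>}| \<le>o |{x \<in> \<Union>((`) h ` \<K>) - h ` N. (\<gamma>, snd (p x)) \<in> \<alpha>}|"
    proof (rule card_of_ordLeqI[of h])
      show "inj_on h {x \<in> \<Union>\<K> - N. (\<gamma>, snd (p (h x))) \<in> \<alpha>}" using h by (rule inj_on_subset) blast
      show "h x \<in> {x \<in> \<Union>((`) h ` \<K>) - h ` N. (\<gamma>, snd (p x)) \<in> \<alpha>}" if "x \<in> {x \<in> \<Union>\<K> - N. (\<gamma>, snd (p (h x))) \<in> \<alpha>}" for x
        using that hN[of x] unfolding UN by simp
    qed
    finally show ?thesis .
  qed
  ultimately show ?thesis unfolding stage_def by (intro conjI ballI allI impI)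
qed

lemma stage_transport:
  assumes st: "stage \<gamma> (\<K> :: 'x set set) N g L"
  obtains \<K>' :: "'k set set" and N' g' L' where "stage \<gamma> \<K>' N' g' L'"
proof -
  have "|\<Union>\<K>| \<le>o |Field \<kappa>|"
    using graded_levelsD(2)[OF stageD(1)[OF st]] ordIso_symmetric[OF card_of_Field_ordIso[OF card_\<kappa>]]
    by (rule ordLeq_ordIso_trans)
  then have "\<exists>h :: 'x \<Rightarrow> 'k. inj_on h (\<Union>\<K>) \<and> h ` \<Union>\<K> \<subseteq> Field \<kappa>" by (rule iffD2[OF card_of_ordLeq])
  then obtain h :: "'x \<Rightarrow> 'k" where "inj_on h (\<Union>\<K>)" by (elim exE conjE)
  from stage_image[OF st this] show ?thesis by (rule that)
qed

end

context strong_limit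
begin

text \<open>
  Every old isolated point \<open>z\<close> gets its own copy of the nodes of the tree, from the level of \<open>z\<close> on. Thus all pieces share the
  same new isolated points, and piece \<open>d\<close> uses those on the branch \<open>d\<close>.
\<close>

definition tagged :: "'x set \<Rightarrow> ('x \<Rightarrow> nat) \<Rightarrow> ('x \<times> nat \<times> 'l set) set" where
  "tagged N g = {(z, n, S). z \<in> N \<and> g z \<le> n \<and> S \<subseteq> B n}"

lemma tagged_gluing:
  assumes gr: "graded \<Lambda> \<K> N g"
  shows "gluing \<Lambda> (Fpow (tagged N g)) (tagged N g) (\<lambda>t. fst (snd t)) (Pow \<Lambda>) (\<lambda>_. \<K>) (\<lambda>_. N) (\<lambda>_. g)
    (\<lambda>d k z. {(z, k, d \<inter> B k)})"
proof (rule gluing.intro)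
  show "graded \<Lambda> (Fpow (tagged N g)) (tagged N g) (\<lambda>t. fst (snd t))"
  proof
    show "compact_ring (Fpow (tagged N g))" by (rule compact_ring_Fpow)
    show "{z} \<in> Fpow (tagged N g)" if "z \<in> tagged N g" for z using that unfolding Fpow_def by simp
    show "K \<inter> tagged N g \<noteq> {}" if "K \<in> Fpow (tagged N g)" "K \<noteq> {}" for K using that unfolding Fpow_def by blast
    show "finite {z \<in> K \<inter> tagged N g. fst (snd z) \<le> n}" if "K \<in> Fpow (tagged N g)" for K n
      using that unfolding Fpow_def by simp
    show "|{z \<in> tagged N g. fst (snd z) \<le> n}| <o |\<Lambda>|" for n
    proof -
      have "{z \<in> tagged N g. fst (snd z) \<le> n} \<subseteq> {z \<in> N. g z \<le> n} \<times> {..n} \<times> Pow (B n)"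
        unfolding tagged_def using B_mono[of _ n] by fastforce
      then have "|{z \<in> tagged N g. fst (snd z) \<le> n}| \<le>o |{z \<in> N. g z \<le> n} \<times> {..n} \<times> Pow (B n)|"
        by (rule card_of_mono1)
      moreover have "|{z \<in> N. g z \<le> n} \<times> {..n} \<times> Pow (B n)| <o |\<Lambda>|"
        by (intro card_of_Times_less_infinite[OF infinite] card_of_level graded.small_level[OF gr])
      ultimately show ?thesis by (rule ordLeq_ordLess_trans)
    qed
  qed
  show "graded \<Lambda> \<K> N g" by (rule gr)
  show "{(z, k, d \<inter> B k)} \<in> Fpow (tagged N g)" if "z \<in> N" "g z \<le> k" for d z k
    using that unfolding Fpow_def tagged_def by simp
  show "{(z, k, d \<inter> B k)} \<noteq> {}" for d k and z :: 'a by simp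
  show "{(z, k, d \<inter> B k)} \<inter> {(z', k', d \<inter> B k')} = {}" if "(k, z) \<noteq> (k', z')" for d k k' and z z' :: 'a
    using that by auto
  show "\<exists>m. \<forall>k\<ge>m. \<forall>k'\<ge>m. \<forall>z\<in>N. \<forall>z'\<in>N. g z \<le> k \<longrightarrow> g z' \<le> k' \<longrightarrow> {(z, k, d \<inter> B k)} \<inter> {(z', k', d' \<inter> B k')} = {}"
    if d: "d \<in> Pow \<Lambda>" "d' \<in> Pow \<Lambda>" "d \<noteq> d'" for d d'
  proof -
    obtain m where m: "\<And>n. m \<le> n \<Longrightarrow> d \<inter> B n \<noteq> d' \<inter> B n"
      using separated_levels[of d d'] d by blast
    show ?thesis by (rule exI[of _ m]) (use m in auto)
  qed
  show "\<exists>m. \<forall>k\<ge>m. \<forall>z\<in>N. g z \<le> k \<longrightarrow> K \<inter> {(z, k, d \<inter> B k)} = {}" if K: "K \<in> Fpow (tagged N g)" for d K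
  proof -
    have "finite ((\<lambda>t. fst (snd t)) ` K)" using K unfolding Fpow_def by simp
    then obtain m where m: "\<forall>n\<in>(\<lambda>t. fst (snd t)) ` K. n \<le> m" using finite_nat_set_iff_bounded_le by blast
    show ?thesis
    proof (intro exI[of _ "Suc m"] allI impI ballI)
      fix k z assume "Suc m \<le> k"
      then have "(z, k, d \<inter> B k) \<notin> K" using m by force
      then show "K \<inter> {(z, k, d \<inter> B k)} = {}" by blast
    qed
  qed
  show "k \<le> fst (snd q)" if "q \<in> {(z, k, d \<inter> B k)}" for k q d and z :: 'a using that by simp
qed

end

context left_types
begin

text \<open>
  Each of the \<open>\<kappa>\<close> copies of stage \<open>\<eta>\<close> contains, by \<open>stage_top\<close>, an isolated point on a level above \<open>\<eta>\<close>, that is, at least \<open>\<gamma>\<close>. After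
  the gluing these points are not isolated any more, and they are given level \<open>\<gamma>\<close>.
\<close>

lemma successor_step:
  assumes st: "stage \<eta> (\<K> :: 'x set set) N g L" and \<eta>: "less \<eta> \<gamma>" and gap: "\<And>s. \<not> (less \<eta> s \<and> less s \<gamma>)"
  shows "\<exists>(\<L> :: ('x \<times> nat \<times> 'l set + 'l set \<times> 'x) set set) N' g' L'. stage \<gamma> \<L> N' g' L'"
proof -
  have gl: "graded_levels \<K> N g L" by (rule stageD(1)[OF st])
  have gr: "graded \<Lambda> \<K> N g" by (rule graded_levelsD(1)[OF gl])
  let ?M = "tagged N g" and ?c = "\<lambda>d k z. {(z, k, d \<inter> B k)}"
  note glue = tagged_gluing[OF gr]
  interpret gluing \<Lambda> "Fpow ?M" ?M "\<lambda>t. fst (snd t)" "Pow \<Lambda>" "\<lambda>_. \<K>" "\<lambda>_. N" "\<lambda>_. g" ?c by (rule glue)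
  let ?L = "case_sum (\<lambda>_. \<gamma>) (\<lambda>(i, y). if y \<in> N then \<gamma> else L y)"
  have "|?M| \<le>o \<kappa>" using card_of_graded[OF base] \<Lambda>_le_\<kappa> by (rule ordLeq_transitive)
  then have "graded_levels (Fpow ?M) ?M (\<lambda>t. fst (snd t)) (\<lambda>_. \<gamma>)"
    unfolding graded_levels_def Union_Fpow using base by simp
  then have lev: "graded_levels glued (Inl ` ?M) (case_sum (\<lambda>t. fst (snd t)) (\<lambda>_. 0)) ?L"
  proof (rule glued_levels[OF glue Pow_le_\<kappa>])
    show "graded_levels \<K> N g L" by (rule gl)
    show "less (L y) \<gamma>" if "y \<in> \<Union>\<K>" "y \<notin> N" for y
      using stageD(2)[OF st that] \<eta> by (rule le_less_trans)
  qed (simp add: Union_Fpow)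
  have rest: "\<Union>glued - Inl ` ?M = Inr ` (Pow \<Lambda> \<times> \<Union>\<K>)"
    unfolding Union_glued Union_Fpow by auto
  have \<gamma>F: "\<gamma> \<in> Field \<alpha>" "\<eta> \<in> Field \<alpha>" using \<eta> unfolding less_def Field_def by auto
  have "stage \<gamma> glued (Inl ` ?M) (case_sum (\<lambda>t. fst (snd t)) (\<lambda>_. 0)) ?L"
    unfolding stage_def rest
  proof (intro conjI allI impI ballI lev)
    fix x :: "'x \<times> nat \<times> 'l set + 'l set \<times> 'x" assume "x \<in> Inr ` (Pow \<Lambda> \<times> \<Union>\<K>)"
    then obtain d y where "x = Inr (d, y)" "y \<in> \<Union>\<K>" by blast
    then show "(?L x, \<gamma>) \<in> \<alpha>"
      using \<alpha>_refl[OF \<gamma>F(1)] le_less_trans[OF stageD(2)[OF st] \<eta>] unfolding less_def by simp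
  next
    fix p :: "'x \<times> nat \<times> 'l set + 'l set \<times> 'x \<Rightarrow> 'k \<times> 'a"
    assume p: "left_ranking (residue glued (Inl ` ?M)) p"
    have "\<exists>z\<in>N. (\<gamma>, snd (p (Inr (d, z)))) \<in> \<alpha>" if d: "d \<in> Pow \<Lambda>" for d
    proof -
      have rk: "left_ranking \<K> (\<lambda>y. p (Inr (d, y)))" by (rule piece_ranking[OF glue d p])
      from stage_top[OF st rk \<gamma>F(2)] obtain z where z: "z \<in> N" "less \<eta> (snd (p (Inr (d, z))))" by blast
      have "snd (p (Inr (d, z))) \<in> Field \<alpha>" using z(2) unfolding less_def Field_def by auto
      then have "(\<gamma>, snd (p (Inr (d, z)))) \<in> \<alpha>" using \<alpha>_total[OF \<gamma>F(1)] gap z(2) by blast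
      then show ?thesis using z(1) by blast
    qed
    from bchoice[OF ballI[OF this[unfolded Bex_def]]] obtain z where
      z: "\<forall>d\<in>Pow \<Lambda>. z d \<in> N \<and> (\<gamma>, snd (p (Inr (d, z d)))) \<in> \<alpha>" by (rule exE)
    have "|Pow \<Lambda>| \<le>o |{x \<in> Inr ` (Pow \<Lambda> \<times> \<Union>\<K>). (\<gamma>, snd (p x)) \<in> \<alpha>}|"
    proof (rule card_of_ordLeqI[of "\<lambda>d. Inr (d, z d)"])
      show "inj_on (\<lambda>d. Inr (d, z d)) (Pow \<Lambda>)" by (simp add: inj_on_def)
      fix d assume d: "d \<in> Pow \<Lambda>"
      then have "z d \<in> N" "(\<gamma>, snd (p (Inr (d, z d)))) \<in> \<alpha>" using z by blast+
      moreover then have "z d \<in> \<Union>\<K>" using graded.isolated[OF gr] by blast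
      ultimately show "Inr (d, z d) \<in> {x \<in> Inr ` (Pow \<Lambda> \<times> \<Union>\<K>). (\<gamma>, snd (p x)) \<in> \<alpha>}" using d by simp
    qed
    then show "\<kappa> \<le>o |{x \<in> Inr ` (Pow \<Lambda> \<times> \<Union>\<K>). (\<gamma>, snd (p x)) \<in> \<alpha>}|" unfolding \<kappa>_le_iff .
  qed
  then show ?thesis by (intro exI)
qed

text \<open>
  An index \<open>(f, \<nu>)\<close> stands for the family of branches enumerated by \<open>f\<close> and for the stage \<open>\<nu>\<close> glued to it. There are only \<open>\<kappa>\<close> indices and
  each family has \<open>\<kappa>\<close> limit points, so every index can be given a limit point \<open>x i\<close> of its own. The case \<open>\<gamma> = 0\<close> is included: there are no indices
  then, and the space consists of branches and nodes only.
\<close>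

lemma limit_step:
  fixes \<K> :: "'a \<Rightarrow> 'k set set"
  assumes \<gamma>: "\<gamma> \<in> Field \<alpha>" and limit: "\<And>\<nu>. less \<nu> \<gamma> \<Longrightarrow> \<exists>s. less \<nu> s \<and> less s \<gamma>"
    and st: "\<And>\<nu>. less \<nu> \<gamma> \<Longrightarrow> stage \<nu> (\<K> \<nu>) (N \<nu>) (g \<nu>) (L \<nu>)"
  shows "\<exists>(\<L> :: ((nat \<times> 'l set + 'l set) + (('l \<Rightarrow> 'l set) \<times> 'a) \<times> 'k) set set) N' g' L'. stage \<gamma> \<L> N' g' L'"
proof -
  define I where "I = {i \<in> Func \<Lambda> (Pow \<Lambda>) \<times> Field \<alpha>. less (snd i) \<gamma> \<and> |Pow \<Lambda>| \<le>o |Lim (fst i ` \<Lambda>)|}"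
  have I: "less (snd i) \<gamma>" "|Pow \<Lambda>| \<le>o |Lim (fst i ` \<Lambda>)|" "fst i ` \<Lambda> \<subseteq> Pow \<Lambda>" if "i \<in> I" for i
  proof -
    have i: "fst i \<in> Func \<Lambda> (Pow \<Lambda>)" "less (snd i) \<gamma>" "|Pow \<Lambda>| \<le>o |Lim (fst i ` \<Lambda>)|"
      using that unfolding I_def by (simp_all add: mem_Times_iff)
    from i(2,3) show "less (snd i) \<gamma>" "|Pow \<Lambda>| \<le>o |Lim (fst i ` \<Lambda>)|" .
    have "fst i b \<in> Pow \<Lambda>" if "b \<in> \<Lambda>" for b using i(1) that unfolding Func_def by blast
    then show "fst i ` \<Lambda> \<subseteq> Pow \<Lambda>" by (rule image_subsetI)
  qed
  have "|Func \<Lambda> (Pow \<Lambda>) \<times> Field \<alpha>| \<le>o \<kappa>"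
    using ordLeq_transitive[OF card_of_Func_Pow_le[OF infinite] Pow_le_\<kappa>] \<alpha>_small by (intro Sigma_le_\<kappa>)
  moreover have "|I| \<le>o |Func \<Lambda> (Pow \<Lambda>) \<times> Field \<alpha>|" unfolding I_def by (rule card_of_mono1) blast
  ultimately have I_small: "|I| \<le>o \<kappa>" by (rule ordLeq_transitive[rotated])
  have "|I| \<le>o |Lim (fst i ` \<Lambda>)|" if "i \<in> I" for i
    using ordLeq_transitive[OF ordLeq_ordIso_trans[OF I_small \<kappa>_Pow] I(2)[OF that]] .
  from injective_choice[of I "\<lambda>i. Lim (fst i ` \<Lambda>)", OF this] obtain x where
    x: "inj_on x I" "\<forall>i\<in>I. x i \<in> Lim (fst i ` \<Lambda>)" by blast
  have gl: "graded_levels (\<K> (snd i)) (N (snd i)) (g (snd i)) (L (snd i))" if "i \<in> I" for i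
    by (rule stageD(1)[OF st[OF I(1)[OF that]]])
  have gr: "graded \<Lambda> (\<K> (snd i)) (N (snd i)) (g (snd i))" if "i \<in> I" for i
    by (rule graded_levelsD(1)[OF gl[OF that]])
  \<comment> \<open>The data that \<open>needles\<close> provides for the index \<open>i\<close>, as a predicate, to choose them for all indices simultaneously.\<close>
  define needle where "needle i u \<longleftrightarrow> (\<forall>k. k \<le> fst u k) \<and>
      (\<forall>k. inj_on (\<lambda>z. snd u k z \<inter> B (fst u k)) {z \<in> N (snd i). g (snd i) z \<le> k}) \<and>
      (\<forall>k z. z \<in> N (snd i) \<longrightarrow> g (snd i) z \<le> k \<longrightarrow> snd u k z \<in> fst i ` \<Lambda> \<and>
        snd u k z \<inter> B (fst u k) \<noteq> x i \<inter> B (fst u k) \<and>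
        (\<forall>j<k. snd u k z \<inter> B (fst u j) = x i \<inter> B (fst u j)))"
    for i and u :: "(nat \<Rightarrow> nat) \<times> (nat \<Rightarrow> 'k \<Rightarrow> 'l set)"
  have "\<exists>u. needle i u" if i: "i \<in> I" for i
  proof -
    have xi: "x i \<in> Lim (fst i ` \<Lambda>)" using x(2) i by blast
    obtain lv :: "nat \<Rightarrow> nat" and a where
      "\<And>k. k \<le> lv k" "\<And>k. inj_on (\<lambda>z. a k z \<inter> B (lv k)) {z \<in> N (snd i). g (snd i) z \<le> k}"
      "\<And>k z. \<lbrakk>z \<in> N (snd i); g (snd i) z \<le> k\<rbrakk> \<Longrightarrow> a k z \<in> fst i ` \<Lambda>"
      "\<And>k z. \<lbrakk>z \<in> N (snd i); g (snd i) z \<le> k\<rbrakk> \<Longrightarrow> a k z \<inter> B (lv k) \<noteq> x i \<inter> B (lv k)"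
      "\<And>j k z. \<lbrakk>z \<in> N (snd i); g (snd i) z \<le> k; j < k\<rbrakk> \<Longrightarrow> a k z \<inter> B (lv j) = x i \<inter> B (lv j)"
      using xi graded.small_level[OF gr[OF i]] by (rule needles) blast
    then have "needle i (lv, a)" unfolding needle_def by simp
    then show ?thesis by (rule exI)
  qed
  from bchoice[OF ballI[OF this]] obtain u where u: "\<forall>i\<in>I. needle i (u i)" by (rule exE)
  define lv where "lv i = fst (u i)" for i
  define a where "a i = snd (u i)" for i
  let ?c = "\<lambda>i k z. cylinder (a i k z) (lv i k)"
  have nd: "k \<le> lv i k" "inj_on (\<lambda>z. a i k z \<inter> B (lv i k)) {z \<in> N (snd i). g (snd i) z \<le> k}"
    "\<lbrakk>z \<in> N (snd i); g (snd i) z \<le> k\<rbrakk> \<Longrightarrow> a i k z \<in> fst i ` \<Lambda>"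
    "\<lbrakk>z \<in> N (snd i); g (snd i) z \<le> k\<rbrakk> \<Longrightarrow> a i k z \<inter> B (lv i k) \<noteq> x i \<inter> B (lv i k)"
    "\<lbrakk>z \<in> N (snd i); g (snd i) z \<le> k; j < k\<rbrakk> \<Longrightarrow> a i k z \<inter> B (lv i j) = x i \<inter> B (lv i j)"
    if "i \<in> I" for i j k z
    using bspec[OF u that] unfolding needle_def lv_def a_def by simp_all
  have glue: "gluing \<Lambda> branch_ring (Inl ` nodes) (case_sum fst (\<lambda>_. 0)) I (\<lambda>i. \<K> (snd i)) (\<lambda>i. N (snd i)) (\<lambda>i. g (snd i)) ?c"
  proof (rule cylinder_gluing[OF gr x(1)])
    show "x i \<subseteq> \<Lambda>" if "i \<in> I" for i using x(2) that unfolding Lim_def by blast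
    show "a i k z \<subseteq> \<Lambda>" if "i \<in> I" "z \<in> N (snd i)" "g (snd i) z \<le> k" for i k z
      using nd(3)[OF that] I(3)[OF that(1)] by blast
  qed (use nd in simp_all)
  interpret gluing \<Lambda> branch_ring "Inl ` nodes" "case_sum fst (\<lambda>_. 0)" I "\<lambda>i. \<K> (snd i)" "\<lambda>i. N (snd i)" "\<lambda>i. g (snd i)" ?c
    by (rule glue)
  \<comment> \<open>A level \<open>s \<nu>\<close> for the old isolated points of stage \<open>\<nu>\<close>: above that stage and still below the branches.\<close>
  have "\<forall>\<nu>\<in>{\<nu>. less \<nu> \<gamma>}. \<exists>s. less \<nu> s \<and> less s \<gamma>" using limit by blast
  from bchoice[OF this] obtain s where "\<forall>\<nu>\<in>{\<nu>. less \<nu> \<gamma>}. less \<nu> (s \<nu>) \<and> less (s \<nu>) \<gamma>" by (rule exE)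
  then have s: "less \<nu> (s \<nu>)" "less (s \<nu>) \<gamma>" if "less \<nu> \<gamma>" for \<nu> using that by simp_all
  let ?L = "case_sum (\<lambda>_. \<gamma>) (\<lambda>(i, y). if y \<in> N (snd i) then s (snd i) else L (snd i) y)"
  let ?N = "Inl ` Inl ` nodes :: ((nat \<times> 'l set + 'l set) + (('l \<Rightarrow> 'l set) \<times> 'a) \<times> 'k) set"
  have "graded_levels branch_ring (Inl ` nodes) (case_sum fst (\<lambda>_. 0)) (\<lambda>_. \<gamma>)"
    unfolding graded_levels_def
  proof (intro conjI ballI graded_branch_ring)
    have "|nodes| \<le>o \<kappa>" using card_of_nodes \<Lambda>_le_\<kappa> unfolding nodes_def by (rule ordLeq_transitive)
    then show "|\<Union>branch_ring| \<le>o \<kappa>" unfolding Union_branch_ring by (intro Un_le_\<kappa> image_le_\<kappa> Pow_le_\<kappa>)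
    fix v assume "v \<in> \<Union>branch_ring - Inl ` nodes"
    then obtain d where d: "v = Inr d" "d \<subseteq> \<Lambda>" unfolding Union_branch_ring by blast
    show "\<exists>K\<in>branch_ring. v \<in> K \<and> (\<forall>y\<in>K - Inl ` nodes. y \<noteq> v \<longrightarrow> less \<gamma> \<gamma>)"
      by (rule bexI[OF _ cylinder_mem[OF d(2), of 0]]) (auto simp: cylinder_def d(1) node_mem)
  qed
  then have lev: "graded_levels glued ?N (case_sum (case_sum fst (\<lambda>_. 0)) (\<lambda>_. 0)) ?L"
  proof (rule glued_levels[OF glue I_small _ gl])
    show "less (L (snd i) y) (s (snd i))" if "i \<in> I" "y \<in> \<Union>(\<K> (snd i))" "y \<notin> N (snd i)" for i y
      using stageD(2)[OF st[OF I(1)[OF that(1)]] that(2,3)] s(1)[OF I(1)[OF that(1)]] by (rule le_less_trans)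
    show "less (s (snd i)) \<gamma>" if "i \<in> I" for i using s(2)[OF I(1)[OF that]] .
  qed
  have rest: "\<Union>glued - ?N = Inl ` Inr ` Pow \<Lambda> \<union> Inr ` (SIGMA i:I. \<Union>(\<K> (snd i)))"
    unfolding Union_glued Union_branch_ring by auto
  have "stage \<gamma> glued ?N (case_sum (case_sum fst (\<lambda>_. 0)) (\<lambda>_. 0)) ?L"
    unfolding stage_def
  proof (intro conjI allI impI ballI lev)
    fix v :: "(nat \<times> 'l set + 'l set) + (('l \<Rightarrow> 'l set) \<times> 'a) \<times> 'k" assume "v \<in> \<Union>glued - ?N"
    then consider d where "v = Inl (Inr d)" | i y where "v = Inr (i, y)" "i \<in> I" "y \<in> \<Union>(\<K> (snd i))"
      unfolding rest by blast
    then show "(?L v, \<gamma>) \<in> \<alpha>"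
    proof cases
      case 1
      then show ?thesis using \<alpha>_refl[OF \<gamma>] by simp
    next
      case 2
      then show ?thesis
        using s(2)[OF I(1)[OF 2(2)]] le_less_trans[OF stageD(2)[OF st[OF I(1)[OF 2(2)]] 2(3)] I(1)[OF 2(2)]]
        unfolding less_def by simp
    qed
  next
    fix p assume p: "left_ranking (residue glued ?N) p"
    let ?H = "{v \<in> \<Union>glued - ?N. (\<gamma>, snd (p v)) \<in> \<alpha>}"
    show "\<kappa> \<le>o |?H|"
    proof (rule ccontr)
      assume "\<not> ?thesis"
      then have H: "|?H| <o |Pow \<Lambda>|" unfolding \<kappa>_le_iff not_card_of_le .
      \<comment> \<open>If fewer than \<open>\<kappa>\<close> points are on levels at least \<open>\<gamma>\<close>, then all but fewer than \<open>\<kappa>\<close> branches are on earlier levels.\<close>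
      define lev' where "lev' d = snd (p (Inl (Inr d)))" for d
      define E where "E = {d \<in> Pow \<Lambda>. less (lev' d) \<gamma>}"
      have dom: "Inl (Inr d) \<in> \<Union>(residue glued ?N)" if "d \<in> Pow \<Lambda>" for d
        unfolding Union_residue rest using that by blast
      have "|Pow \<Lambda> - E| \<le>o |?H|"
      proof (rule card_of_ordLeqI[of "\<lambda>d. Inl (Inr d)"])
        show "inj_on (\<lambda>d. Inl (Inr d)) (Pow \<Lambda> - E)" by (simp add: inj_on_def)
        fix d assume d: "d \<in> Pow \<Lambda> - E"
        then have "lev' d \<in> Field \<alpha>" unfolding lev'_def using left_rankingD(2)[OF p dom] by blast
        then have "(\<gamma>, lev' d) \<in> \<alpha>" using \<alpha>_total[OF \<gamma>] d unfolding E_def by blast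
        moreover have "Inl (Inr d) \<in> \<Union>glued - ?N" using dom[unfolded Union_residue, of d] d by simp
        ultimately show "Inl (Inr d) \<in> ?H" unfolding lev'_def by simp
      qed
      then have E: "|Pow \<Lambda> - E| <o |Pow \<Lambda>|" using H by (rule ordLeq_ordLess_trans)
      have EP: "E \<subseteq> Pow \<Lambda>" unfolding E_def by blast
      have lev'E: "lev' d \<in> {\<nu>. less \<nu> \<gamma>}" if "d \<in> E" for d using that unfolding E_def by simp
      have tot: "(b, c) \<in> \<alpha> \<or> (c, b) \<in> \<alpha>" if "b \<in> {\<nu>. less \<nu> \<gamma>}" "c \<in> {\<nu>. less \<nu> \<gamma>}" for b c
      proof -
        have "b \<in> Field \<alpha>" "c \<in> Field \<alpha>" using that unfolding less_def Field_def by auto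
        then show ?thesis using \<alpha>_total unfolding less_def by blast
      qed
      obtain \<nu> f where \<nu>: "\<nu> \<in> {\<nu>. less \<nu> \<gamma>}" and f: "f ` \<Lambda> \<subseteq> {d \<in> E. (lev' d, \<nu>) \<in> \<alpha>}"
        "|Pow \<Lambda>| \<le>o |Lim (f ` \<Lambda>)|"
        using EP E lev'E tot by (rule bounded_dense_family)
      \<comment> \<open>The copy that belongs to this family and this \<open>\<nu>\<close> leads to the contradiction.\<close>
      define i where "i = (\<lambda>b. if b \<in> \<Lambda> then f b else undefined, \<nu>)"
      have im: "fst i ` \<Lambda> = f ` \<Lambda>" unfolding i_def by simp
      have \<nu>F: "\<nu> \<in> Field \<alpha>" using \<nu> unfolding less_def Field_def by auto
      have "fst i \<in> Func \<Lambda> (Pow \<Lambda>)" using f(1) unfolding i_def Func_def E_def by auto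
      then have i: "i \<in> I" unfolding I_def using \<nu> \<nu>F f(2) im by (simp add: mem_Times_iff i_def)
      have sndi: "snd i = \<nu>" unfolding i_def by simp
      have rk: "left_ranking (\<K> \<nu>) (\<lambda>y. p (Inr (i, y)))" using piece_ranking[OF glue i p] unfolding sndi .
      obtain z where z: "z \<in> N \<nu>" "less \<nu> (snd (p (Inr (i, z))))"
        using stage_top[OF st rk \<nu>F] \<nu> by blast
      have "z \<in> \<Union>(\<K> \<nu>)" using graded.isolated[OF gr[OF i]] z(1) unfolding sndi by blast
      then have "Inr (i, z) \<in> \<Union>(residue glued ?N)" unfolding Union_residue rest using i sndi by blast
      from left_rankingD(3)[OF p this] obtain K where
        K: "K \<in> residue glued ?N" "Inr (i, z) \<in> K" "\<forall>y\<in>K. (p (Inr (i, z)), p y) \<in> ord_times \<kappa> \<alpha>" by blast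
      then obtain P where P: "P \<in> glued" "K = P - ?N" unfolding residue_def by blast
      then have "Inr (i, z) \<in> P" using K(2) by blast
      from glued_limit[OF P(1) this] obtain m where
        m: "\<forall>k\<ge>m. g (snd i) z \<le> k \<longrightarrow> Inl ` ?c i k z \<subseteq> P" using z(1) unfolding sndi by blast
      let ?k = "max m (g (snd i) z)"
      have "Inl ` ?c i ?k z \<subseteq> P" using m by simp
      then have "Inl (Inr (a i ?k z)) \<in> P" unfolding cylinder_def by blast
      then have "Inl (Inr (a i ?k z)) \<in> K" unfolding P(2) by blast
      then have "(p (Inr (i, z)), p (Inl (Inr (a i ?k z)))) \<in> ord_times \<kappa> \<alpha>" using K(3) by blast
      from ord_times_snd[OF this] have 1: "(snd (p (Inr (i, z))), lev' (a i ?k z)) \<in> \<alpha>" unfolding lev'_def .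
      have "a i ?k z \<in> f ` \<Lambda>" using nd(3)[OF i, of z ?k] z(1) unfolding im sndi by simp
      then have "(lev' (a i ?k z), \<nu>) \<in> \<alpha>" using f(1) by blast
      with 1 have "(snd (p (Inr (i, z))), \<nu>) \<in> \<alpha>" by (rule \<alpha>_trans)
      then show False using less_not_le[OF z(2)] by blast
    qed
  qed
  then show ?thesis by (intro exI)
qed

lemma stages_exist:
  assumes "\<gamma> \<in> Field \<alpha>"
  shows "\<exists>(\<K> :: 'k set set) N g L. stage \<gamma> \<K> N g L"
proof -
  have wf: "wf (\<alpha> - Id)" using well_\<alpha> unfolding well_order_on_def by blast
  have "\<gamma> \<in> Field \<alpha> \<longrightarrow> (\<exists>(\<K> :: 'k set set) N g L. stage \<gamma> \<K> N g L)"
    using wf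
  proof (induction \<gamma> rule: wf_induct_rule)
    case (less \<gamma>)
    have IH: "\<exists>(\<K> :: 'k set set) N g L. stage \<nu> \<K> N g L" if "less \<nu> \<gamma>" for \<nu>
      using less[of \<nu>] that unfolding less_def Field_def by auto
    show ?case
    proof
      assume \<gamma>: "\<gamma> \<in> Field \<alpha>"
      show "\<exists>(\<K> :: 'k set set) N g L. stage \<gamma> \<K> N g L"
      proof (cases "\<exists>\<eta>. less \<eta> \<gamma> \<and> (\<forall>s. \<not> (less \<eta> s \<and> less s \<gamma>))")
        case True
        then obtain \<eta> where \<eta>: "less \<eta> \<gamma>" "\<And>s. \<not> (less \<eta> s \<and> less s \<gamma>)" by blast
        obtain \<K> :: "'k set set" and N g L where st: "stage \<eta> \<K> N g L" using IH[OF \<eta>(1)] by (elim exE)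
        obtain \<L> :: "('k \<times> nat \<times> 'l set + 'l set \<times> 'k) set set" and N' g' L' where "stage \<gamma> \<L> N' g' L'"
          using successor_step[OF st \<eta>] by (elim exE)
        then show ?thesis by (rule stage_transport) (intro exI)
      next
        case False
        have "\<forall>\<nu>\<in>{\<nu>. less \<nu> \<gamma>}. \<exists>q. stage \<nu> (fst q :: 'k set set) (fst (snd q)) (fst (snd (snd q))) (snd (snd (snd q)))"
        proof
          fix \<nu> assume "\<nu> \<in> {\<nu>. less \<nu> \<gamma>}"
          then obtain \<K> :: "'k set set" and N g L where "stage \<nu> \<K> N g L" using IH[of \<nu>] by blast
          then show "\<exists>q. stage \<nu> (fst q :: 'k set set) (fst (snd q)) (fst (snd (snd q))) (snd (snd (snd q)))"
            by (intro exI[of _ "(\<K>, N, g, L)"]) simp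
        qed
        from bchoice[OF this] obtain q where
          q: "\<forall>\<nu>\<in>{\<nu>. less \<nu> \<gamma>}. stage \<nu> (fst (q \<nu>) :: 'k set set) (fst (snd (q \<nu>))) (fst (snd (snd (q \<nu>)))) (snd (snd (snd (q \<nu>))))"
          by (rule exE)
        have "\<exists>s. less \<nu> s \<and> less s \<gamma>" if "less \<nu> \<gamma>" for \<nu> using False that by blast
        moreover have "stage \<nu> (fst (q \<nu>)) (fst (snd (q \<nu>))) (fst (snd (snd (q \<nu>)))) (snd (snd (snd (q \<nu>))))" if "less \<nu> \<gamma>" for \<nu>
          using q that by blast
        ultimately have "\<exists>(\<L> :: ((nat \<times> 'l set + 'l set) + (('l \<Rightarrow> 'l set) \<times> 'a) \<times> 'k) set set) N' g' L'. stage \<gamma> \<L> N' g' L'"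
          by (rule limit_step[OF \<gamma>])
        then obtain \<L> :: "((nat \<times> 'l set + 'l set) + (('l \<Rightarrow> 'l set) \<times> 'a) \<times> 'k) set set" and N' g' L'
          where "stage \<gamma> \<L> N' g' L'" by (elim exE)
        then show ?thesis by (rule stage_transport) (intro exI)
      qed
    qed
  qed
  then show ?thesis using assms by (rule mp)
qed

end

section \<open>Beth numbers of cofinality omega\<close>

lemma Field_initial_segment:
  assumes "Well_order b" shows "Field (initial_segment b j) = underS b j"
proof -
  have "underS b j \<subseteq> Field b" unfolding underS_def Field_def by blast
  moreover have "Refl b" using assms by (simp add: well_order_on_def linear_order_on_def partial_order_on_def preorder_on_def)
  ultimately show ?thesis using Refl_Field_Restr[of b "underS b j"] by blast
qed

lemma initial_segment_initial_segment:
  assumes "Well_order b" "(i, j) \<in> b" "i \<noteq> j"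
  shows "initial_segment (initial_segment b j) i = initial_segment b i"
proof -
  have wo: "wo_rel b" using assms(1) by (simp add: wo_rel_def)
  note TRANS = wo_rel.TRANS[OF wo] and ANTISYM = wo_rel.ANTISYM[OF wo]
  have "underS (initial_segment b j) i = underS b i"
  proof (intro equalityI subsetI)
    fix x assume x: "x \<in> underS b i"
    then have "(x, i) \<in> b" "x \<noteq> i" unfolding underS_def by auto
    moreover have "(x, j) \<in> b" using transD[OF TRANS \<open>(x, i) \<in> b\<close> assms(2)] .
    moreover have "x \<noteq> j" using antisymD[OF ANTISYM, of i j] \<open>(x, i) \<in> b\<close> assms(2,3) by blast
    ultimately show "x \<in> underS (initial_segment b j) i" using assms unfolding underS_def by blast
  qed (auto simp: underS_def)
  moreover have "underS b i \<subseteq> underS b j"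
  proof
    fix x assume x: "x \<in> underS b i"
    then have "(x, i) \<in> b" unfolding underS_def by auto
    moreover have "x \<noteq> j" using antisymD[OF ANTISYM, of i j] \<open>(x, i) \<in> b\<close> assms(2,3) by blast
    ultimately show "x \<in> underS b j" using transD[OF TRANS _ assms(2)] unfolding underS_def by blast
  qed
  ultimately show ?thesis by (simp only: Restr_subset)
qed

lemma is_beth_infinite_card: "is_beth b k \<Longrightarrow> Card_order k \<and> natLeq \<le>o k"
proof (induction rule: is_beth.induct)
  case (zero k)
  then show ?case using Card_order_ordIso[OF natLeq_Card_order] ordIso_imp_ordLeq[OF ordIso_symmetric] by blast
next
  case (succ b m l k)
  have "Card_order k" by (rule Card_order_ordIso[OF Card_order_cexp succ.hyps(5)])
  moreover have "natLeq \<le>o ctwo ^c l"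
    using succ.IH ordLess_imp_ordLeq[OF ordLess_ctwo_cexp] ordLeq_transitive by blast
  then have "natLeq \<le>o k" using ordIso_symmetric[OF succ.hyps(5)] by (rule ordLeq_ordIso_trans)
  ultimately show ?case ..
next
  case (limit b f k)
  have fk: "f i \<le>o |Field k|" if i: "i \<in> Field b" for i
  proof -
    have "Card_order (f i)" using limit.IH i by blast
    then have "f i =o |Field (f i)|" by (rule ordIso_symmetric[OF card_of_Field_ordIso])
    moreover have "|Field (f i)| \<le>o |Field k|" using limit.hyps(4) i by (intro card_of_mono2) blast
    ultimately show ?thesis by (rule ordIso_ordLeq_trans)
  qed
  then have "k \<le>o |Field k|" using limit.hyps(5) by blast
  then have "Card_order k" unfolding Card_order_iff_ordLeq_card_of .
  moreover obtain i where i: "i \<in> Field b" using limit.hyps(2) by blast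
  then have "natLeq \<le>o f i" "f i \<le>o k" using limit.IH limit.hyps(4) by blast+
  then have "natLeq \<le>o k" by (rule ordLeq_transitive)
  ultimately show ?case ..
qed

lemma ctwo_cexp_cong:
  assumes "Card_order l" "l =o l'" shows "ctwo ^c l =o ctwo ^c l'"
  using assms by (intro cexp_cong2 Card_order_ctwo)

text \<open>
  Monotonicity at a successor rests on uniqueness for its predecessor, hence the joint induction.
\<close>

lemma is_beth_unique_mono:
  fixes b :: "'b rel" and k :: "'k rel"
  shows "is_beth b k \<Longrightarrow> (\<forall>k' :: 'k rel. is_beth b k' \<longrightarrow> k =o k') \<and>
    (\<forall>i\<in>Field b. \<forall>k' :: 'k rel. is_beth (initial_segment b i) k' \<longrightarrow> ctwo ^c k' \<le>o k)"
proof (induction rule: is_beth.induct)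
  case (zero k)
  show ?case
  proof (intro conjI allI impI ballI)
    fix k' :: "'k rel" assume "is_beth ({} :: 'b rel) k'"
    then show "k =o k'"
    proof (cases rule: is_beth.cases)
      case zero
      then show ?thesis using ordIso_transitive[OF \<open>k =o natLeq\<close> ordIso_symmetric] by blast
    qed simp_all
  next
    fix i and k' :: "'k rel" assume "i \<in> Field ({} :: 'b rel)"
    then show "ctwo ^c k' \<le>o k" by simp
  qed
next
  case (succ b m l k)
  have anti: "x = y" if "(x, y) \<in> b" "(y, x) \<in> b" for x y
    using succ.hyps(1) that by (auto simp: well_order_on_def linear_order_on_def partial_order_on_def antisym_def)
  have uniq: "l =o l'" if "is_beth (initial_segment b m) l'" for l' :: "'k rel" using succ.IH that by blast
  have cl: "Card_order l" using is_beth_infinite_card[OF succ.hyps(4)] ..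
  show ?case
  proof (intro conjI allI impI ballI)
    fix k' :: "'k rel" assume "is_beth b k'"
    then show "k =o k'"
    proof (cases rule: is_beth.cases)
      case zero
      then show ?thesis using succ.hyps(2) by simp
    next
      case (succ m' l')
      have "m' = m" using anti succ(2,3) \<open>m \<in> Field b\<close> \<open>\<forall>i\<in>Field b. (i, m) \<in> b\<close> by blast
      then have "l =o l'" using uniq succ(4) by simp
      then have "ctwo ^c l =o ctwo ^c l'" by (rule ctwo_cexp_cong[OF cl])
      then show ?thesis
        using ordIso_transitive[OF ordIso_transitive[OF \<open>k =o ctwo ^c l\<close>] ordIso_symmetric[OF succ(5)]] by blast
    next
      case (limit f)
      then obtain j where "j \<in> Field b" "m \<noteq> j" "(m, j) \<in> b" using succ.hyps(2) by blast
      then show ?thesis using anti succ.hyps(3) by blast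
    qed
  next
    fix i and k' :: "'k rel" assume i: "i \<in> Field b" and k': "is_beth (initial_segment b i) k'"
    have ck': "Card_order k'" using is_beth_infinite_card[OF k'] ..
    have "ctwo ^c k' \<le>o ctwo ^c l"
    proof (cases "i = m")
      case True
      then have "l =o k'" using uniq k' by simp
      then show ?thesis using ordIso_imp_ordLeq[OF ctwo_cexp_cong[OF ck' ordIso_symmetric]] by blast
    next
      case False
      have im: "(i, m) \<in> b" using succ.hyps(3) i by blast
      then have "i \<in> Field (initial_segment b m)"
        unfolding Field_initial_segment[OF succ.hyps(1)] using False by (simp add: underS_def)
      moreover have "is_beth (initial_segment (initial_segment b m) i) k'"
        unfolding initial_segment_initial_segment[OF succ.hyps(1) im False] by (rule k')
      ultimately have "ctwo ^c k' \<le>o l" using succ.IH by blast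
      then show ?thesis using ordLess_imp_ordLeq[OF ordLess_ctwo_cexp[OF cl]] by (rule ordLeq_transitive)
    qed
    then show "ctwo ^c k' \<le>o k" using ordIso_symmetric[OF succ.hyps(5)] by (rule ordLeq_ordIso_trans)
  qed
next
  case (limit b f k)
  have anti: "x = y" if "(x, y) \<in> b" "(y, x) \<in> b" for x y
    using limit.hyps(1) that by (auto simp: well_order_on_def linear_order_on_def partial_order_on_def antisym_def)
  have uniq: "f i =o k'" if "i \<in> Field b" "is_beth (initial_segment b i) k'" for i and k' :: "'k rel" using limit.IH that by blast
  show ?case
  proof (intro conjI allI impI ballI)
    fix k' :: "'k rel" assume "is_beth b k'"
    then show "k =o k'"
    proof (cases rule: is_beth.cases)
      case zero
      then show ?thesis using limit.hyps(2) by simp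
    next
      case (succ m' l')
      obtain j where "j \<in> Field b" "m' \<noteq> j" "(m', j) \<in> b" using limit.hyps(3) succ(2) by blast
      then show ?thesis using anti succ(3) by blast
    next
      case (limit f')
      have ff': "f i =o f' i" if "i \<in> Field b" for i using uniq limit(4) that by blast
      have "\<forall>i\<in>Field b. f i \<le>o k'" using ordIso_ordLeq_trans[OF ff'] limit(5) by blast
      then have "k \<le>o k'" using limit.hyps(5) by blast
      moreover have "\<forall>i\<in>Field b. f' i \<le>o k" using ordIso_ordLeq_trans[OF ordIso_symmetric[OF ff']] limit.hyps(4) by blast
      then have "k' \<le>o k" using limit(6) by blast
      ultimately show ?thesis unfolding ordIso_iff_ordLeq by (rule conjI)
    qed
  next
    fix i and k' :: "'k rel" assume i: "i \<in> Field b" and k': "is_beth (initial_segment b i) k'"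
    obtain j where j: "j \<in> Field b" "i \<noteq> j" "(i, j) \<in> b" using limit.hyps(3) i by blast
    have "i \<in> Field (initial_segment b j)"
      unfolding Field_initial_segment[OF limit.hyps(1)] using j by (simp add: underS_def)
    moreover have "is_beth (initial_segment (initial_segment b j) i) k'"
      unfolding initial_segment_initial_segment[OF limit.hyps(1) j(3,2)] by (rule k')
    ultimately have "ctwo ^c k' \<le>o f j" using limit.IH j(1) by blast
    moreover have "f j \<le>o k" using limit.hyps(4) j(1) by blast
    ultimately show "ctwo ^c k' \<le>o k" by (rule ordLeq_transitive)
  qed
qed

lemma card_of_Pow_ctwo: "|Pow A| =o ctwo ^c |A|"
  unfolding cexp_def ctwo_def Field_card_of by (rule card_of_Pow_Func)

lemma card_of_Pow_mono:
  assumes "|A| \<le>o |B|" shows "|Pow A| \<le>o |Pow B|"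
proof -
  obtain f where f: "inj_on f A \<and> f ` A \<subseteq> B" using iffD2[OF card_of_ordLeq assms] by (rule exE)
  show ?thesis
  proof (rule card_of_ordLeqI[of "image f"])
    show "inj_on (image f) (Pow A)" using f by (intro inj_on_image_Pow) blast
    show "f ` S \<in> Pow B" if "S \<in> Pow A" for S using f that by blast
  qed
qed

lemma strong_limit_omega:
  fixes l :: "'k rel"
  assumes "l =o natLeq"
  shows "\<exists>B. strong_limit (Field l) B"
proof -
  have "|UNIV :: nat set| =o |Field l|" using ordIso_symmetric[OF card_of_cong[OF assms]] unfolding Field_natLeq .
  then obtain f :: "nat \<Rightarrow> 'k" where f: "bij_betw f UNIV (Field l)" unfolding card_of_ordIso[symmetric] by blast
  have inf: "infinite (Field l)" using bij_betw_finite[OF f] by simp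
  have "strong_limit (Field l) (\<lambda>n. f ` {..<n})"
  proof
    show "infinite (Field l)" by (rule inf)
    show "f ` {..<i} \<subseteq> f ` {..<j}" if "i \<le> j" for i j using that by auto
    show "(\<Union>n. f ` {..<n}) = Field l" using bij_betw_imp_surj_on[OF f] by blast
    show "|f ` {..<n}| <o |Field l|" for n using inf by (intro finite_card_of_less) simp_all
    fix S assume "|S| <o |Field l|"
    then have "|S| <o |UNIV :: nat set|" using ordIso_symmetric[OF \<open>|UNIV :: nat set| =o |Field l|\<close>] by (rule ordLess_ordIso_trans)
    then have "finite S" using infinite_iff_card_of_nat not_ordLess_ordLeq by blast
    then show "|Pow S| <o |Field l|" using inf by (intro finite_card_of_less) simp_all
  qed
  then show ?thesis by (intro exI[of _ "\<lambda>n. f ` {..<n}"])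
qed

text \<open>
  Every \<open>\<mu> < \<beth>\<^sub>b\<close> is below some \<open>\<beth>\<^sub>i\<close> with \<open>i < b\<close>, hence \<open>2\<^sup>\<mu> \<le> \<beth>\<^bsub>i+1\<^esub> < \<beth>\<^sub>b\<close>. If \<open>s\<close> is a cofinal sequence in \<open>b\<close>, each \<open>f (s n)\<close> is
  isomorphic to an initial segment of \<open>l\<close>, and these initial segments exhaust \<open>l\<close>.
\<close>

lemma strong_limit_limit:
  fixes b :: "'b rel" and l :: "'k rel"
  assumes wo: "Well_order b" and ne: "Field b \<noteq> {}" and lim: "\<And>i. i \<in> Field b \<Longrightarrow> \<exists>j\<in>Field b. i \<noteq> j \<and> (i, j) \<in> b"
    and f: "\<And>i. i \<in> Field b \<Longrightarrow> is_beth (initial_segment b i) (f i)" and fl: "\<And>i. i \<in> Field b \<Longrightarrow> f i \<le>o l"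
    and least: "\<And>c :: 'k rel. (\<forall>i\<in>Field b. f i \<le>o c) \<Longrightarrow> l \<le>o c" and l: "Card_order l"
    and s: "\<And>n :: nat. s n \<in> Field b" "\<And>i. i \<in> Field b \<Longrightarrow> \<exists>n. (i, s n) \<in> b"
  shows "\<exists>B. strong_limit (Field l) B"
proof -
  have cf: "Card_order (f i)" "natLeq \<le>o f i" if "i \<in> Field b" for i using is_beth_infinite_card[OF f[OF that]] by simp_all
  have lF: "|Field l| =o l" using l by (rule card_of_Field_ordIso)
  have wl: "Well_order l" using l by (rule card_order_on_well_order_on)
  have two: "ctwo ^c f i \<le>o f j" if ij: "i \<in> Field b" "j \<in> Field b" "i \<noteq> j" "(i, j) \<in> b" for i j
  proof -
    have "i \<in> Field (initial_segment b j)"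
      unfolding Field_initial_segment[OF wo] using ij by (simp add: underS_def)
    moreover have "is_beth (initial_segment (initial_segment b j) i) (f i)"
      unfolding initial_segment_initial_segment[OF wo ij(4,3)] by (rule f[OF ij(1)])
    ultimately show ?thesis using is_beth_unique_mono[OF f[OF ij(2)]] by blast
  qed
  have less: "f i <o f j" if "i \<in> Field b" "j \<in> Field b" "i \<noteq> j" "(i, j) \<in> b" for i j
    using ordLess_ctwo_cexp[OF cf(1)[OF that(1)]] two[OF that] by (rule ordLess_ordLeq_trans)
  have mono: "f i \<le>o f j" if "i \<in> Field b" "j \<in> Field b" "(i, j) \<in> b" for i j
  proof (cases "i = j")
    case True
    then show ?thesis using cf(1)[OF that(1)] by (simp add: ordLeq_refl)
  next
    case False
    then show ?thesis using less[OF that(1,2) _ that(3)] ordLess_imp_ordLeq by blast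
  qed
  have fless: "f i <o l" if i: "i \<in> Field b" for i
  proof -
    obtain j where j: "j \<in> Field b" "i \<noteq> j" "(i, j) \<in> b" using lim[OF i] by blast
    show ?thesis using less[OF i j] fl[OF j(1)] by (rule ordLess_ordLeq_trans)
  qed
  have below: "\<exists>i\<in>Field b. |S| \<le>o f i" if S: "|S| <o |Field l|" for S :: "'k set"
  proof (rule ccontr)
    assume no: "\<not> ?thesis"
    have "\<forall>i\<in>Field b. f i \<le>o |S|"
    proof
      fix i assume i: "i \<in> Field b"
      have "Well_order (f i)" using cf(1)[OF i] by (rule card_order_on_well_order_on)
      from ordLeq_total[OF card_of_Well_order this] show "f i \<le>o |S|" using no i by blast
    qed
    from least[OF this] have "l \<le>o |S|" .
    moreover have "|S| <o l" using S lF by (rule ordLess_ordIso_trans)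
    ultimately show False using not_ordLess_ordLeq by blast
  qed
  have inf: "infinite (Field l)"
  proof -
    obtain i where i: "i \<in> Field b" using ne by blast
    have "natLeq \<le>o |Field l|" using ordLeq_ordIso_trans[OF ordLeq_transitive[OF cf(2)[OF i] fl[OF i]] ordIso_symmetric[OF lF]] .
    then show ?thesis using infinite_iff_natLeq_ordLeq by blast
  qed
  have "\<exists>c\<in>Field l. f (s n) =o Restr l (underS l c)" for n
  proof -
    have "Well_order (f (s n))" using cf(1)[OF s(1)] by (rule card_order_on_well_order_on)
    from ordLess_iff_ordIso_Restr[OF wl this] show ?thesis using fless[OF s(1)] by blast
  qed
  then have "\<forall>n. \<exists>c. c \<in> Field l \<and> f (s n) =o Restr l (underS l c)" by blast
  from choice[OF this] obtain c where c: "\<forall>n. c n \<in> Field l \<and> f (s n) =o Restr l (underS l (c n))" by (rule exE)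
  define B where "B n = (\<Union>k\<le>n. underS l (c k))" for n :: nat
  have "strong_limit (Field l) B"
  proof
    show "infinite (Field l)" by (rule inf)
    show "B i \<subseteq> B j" if "i \<le> j" for i j using that unfolding B_def by (intro UN_mono) auto
    show "|B n| <o |Field l|" for n
    proof (induction n)
      case 0
      have "|underS l (c 0)| <o l" using card_of_underS[OF l] c by blast
      then show ?case unfolding B_def using ordLess_ordIso_trans[OF _ ordIso_symmetric[OF lF]] by simp
    next
      case (Suc n)
      have "|underS l (c (Suc n))| <o l" using card_of_underS[OF l] c by blast
      then have "|underS l (c (Suc n))| <o |Field l|" using ordIso_symmetric[OF lF] by (rule ordLess_ordIso_trans)
      moreover have "B (Suc n) = B n \<union> underS l (c (Suc n))" unfolding B_def by (auto simp: le_Suc_eq)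
      ultimately show ?case using card_of_Un_ordLess_infinite[OF inf Suc] by simp
    qed
    show "(\<Union>n. B n) = Field l"
    proof
      show "(\<Union>n. B n) \<subseteq> Field l" unfolding B_def underS_def Field_def by blast
      show "Field l \<subseteq> (\<Union>n. B n)"
      proof (rule subsetI, rule ccontr)
        fix y assume y: "y \<in> Field l" "y \<notin> (\<Union>n. B n)"
        interpret l: wo_rel l using wl by (simp add: wo_rel_def)
        have cy: "(c n, y) \<in> l" for n
        proof -
          have "y \<notin> underS l (c n)" using y(2) unfolding B_def by blast
          then show ?thesis using l.TOTALS y(1) c unfolding underS_def by (metis (mono_tags, lifting) CollectI)
        qed
        have "f i \<le>o |underS l y|" if i: "i \<in> Field b" for i
        proof -
          obtain n where n: "(i, s n) \<in> b" using s(2)[OF i] by blast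
          have "f i \<le>o f (s n)" using mono[OF i s(1) n] .
          also have "f (s n) =o |Field (f (s n))|" using cf(1)[OF s(1)] by (rule ordIso_symmetric[OF card_of_Field_ordIso])
          also have "|Field (f (s n))| =o |Field (Restr l (underS l (c n)))|" using c by (intro card_of_cong) blast
          also have "|Field (Restr l (underS l (c n)))| \<le>o |underS l y|"
          proof (rule card_of_mono1, rule subsetI)
            fix x assume "x \<in> Field (Restr l (underS l (c n)))"
            then have x: "(x, c n) \<in> l" "x \<noteq> c n" unfolding Field_initial_segment[OF wl] by (auto simp: underS_def)
            moreover have "(x, y) \<in> l" using transD[OF l.TRANS x(1) cy] .
            moreover have "x \<noteq> y" using antisymD[OF l.ANTISYM cy, of n] x by blast
            ultimately show "x \<in> underS l y" unfolding underS_def by blast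
          qed
          finally show ?thesis .
        qed
        then have "l \<le>o |underS l y|" by (intro least ballI)
        moreover have "|underS l y| <o l" using card_of_underS[OF l y(1)] .
        ultimately show False using not_ordLess_ordLeq by blast
      qed
    qed
    fix S assume S: "S \<subseteq> Field l" "|S| <o |Field l|"
    obtain i where i: "i \<in> Field b" "|S| \<le>o f i" using below[OF S(2)] by blast
    obtain j where j: "j \<in> Field b" "i \<noteq> j" "(i, j) \<in> b" using lim[OF i(1)] by blast
    have fi: "f i =o |Field (f i)|" using cf(1)[OF i(1)] by (rule ordIso_symmetric[OF card_of_Field_ordIso])
    have "|Pow S| \<le>o |Pow (Field (f i))|" using ordLeq_ordIso_trans[OF i(2) fi] by (rule card_of_Pow_mono)
    also have "|Pow (Field (f i))| =o ctwo ^c |Field (f i)|" by (rule card_of_Pow_ctwo)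
    also have "ctwo ^c |Field (f i)| =o ctwo ^c f i" using ordIso_symmetric[OF fi] by (rule ctwo_cexp_cong[OF card_of_Card_order])
    also have "ctwo ^c f i \<le>o f j" using two[OF i(1) j] .
    also have "f j <o l" using fless[OF j(1)] .
    also have "l =o |Field l|" using lF by (rule ordIso_symmetric)
    finally show "|Pow S| <o |Field l|" .
  qed
  then show ?thesis by (rule exI[of _ B])
qed

text \<open>
  If \<open>\<beta> \<noteq> {}\<close> has cofinality \<open>\<omega>\<close>, it has no largest element, which would by itself be cofinal; so \<open>\<beth>\<^sub>\<beta>\<close> arises by the limit rule.
\<close>

lemma beth_successor_strong_limit:
  fixes \<beta> :: "'b rel" and \<kappa> :: "'k rel"
  assumes wo: "Well_order \<beta>" and cof: "\<beta> = {} \<or> is_cofinality \<beta> natLeq" and \<kappa>: "is_beth (ord_succ \<beta>) \<kappa>"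
  shows "\<exists>(l :: 'k rel) B. \<kappa> =o ctwo ^c l \<and> Card_order l \<and> strong_limit (Field l) B"
proof -
  define b where "b = map_prod Some Some ` \<beta>"
  have None_max: "(x, y) \<in> ord_succ \<beta> \<Longrightarrow> x = None \<Longrightarrow> y = None" for x y unfolding ord_succ_def by auto
  have None_Field: "None \<in> Field (ord_succ \<beta>)" unfolding ord_succ_def Field_def by auto
  have "\<beta> \<subseteq> Field \<beta> \<times> Field \<beta>" unfolding Field_def by auto
  then have seg: "initial_segment (ord_succ \<beta>) None = b"
    unfolding b_def ord_succ_def underS_def by (auto simp: Field_def)
  obtain l :: "'k rel" where l: "is_beth b l" "\<kappa> =o ctwo ^c l"
    using \<kappa>
  proof (cases rule: is_beth.cases)
    case zero
    then show ?thesis using None_Field by simp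
  next
    case (succ m l)
    have "m = None" using None_max succ(3) None_Field by blast
    then show ?thesis using that[of l] succ(4,5) seg by simp
  next
    case (limit f)
    then show ?thesis using None_max None_Field by blast
  qed
  have cl: "Card_order l" using is_beth_infinite_card[OF l(1)] ..
  have Fb: "Field b = Some ` Field \<beta>" unfolding b_def Field_def by force
  have "\<exists>B. strong_limit (Field l) B"
    using l(1)
  proof (cases rule: is_beth.cases)
    case zero
    then show ?thesis by (intro strong_limit_omega)
  next
    case (succ m l')
    obtain a where a: "m = Some a" "a \<in> Field \<beta>" using succ(2) Fb by blast
    have "(x, a) \<in> \<beta>" if "x \<in> Field \<beta>" for x
    proof -
      have "(Some x, Some a) \<in> b" using succ(3) Fb that a(1) by blast
      then show ?thesis unfolding b_def by auto
    qed
    then have "cofinal_subset \<beta> {a}" unfolding cofinal_subset_def using a(2) by blast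
    moreover have "\<beta> \<noteq> {}" using a(2) by auto
    ultimately have "natLeq \<le>o |{a}|" using cof unfolding is_cofinality_def by blast
    then have "infinite {a}" using infinite_iff_natLeq_ordLeq by blast
    then show ?thesis by simp
  next
    case (limit f)
    have "\<beta> \<noteq> {}" using limit(2) Fb by auto
    then obtain A where A: "cofinal_subset \<beta> A" "natLeq =o |A|" using cof unfolding is_cofinality_def by blast
    have "|UNIV :: nat set| =o |A|" using ordIso_transitive[OF card_of_nat A(2)] .
    then obtain s where s: "bij_betw s (UNIV :: nat set) A" unfolding card_of_ordIso[symmetric] by blast
    then have sA: "s ` UNIV = A" by (rule bij_betw_imp_surj_on)
    show ?thesis
    proof (rule strong_limit_limit[OF limit(1,2) _ _ _ _ cl, of f "\<lambda>n. Some (s n)"])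
      show "Some (s n) \<in> Field b" for n using sA A(1) unfolding Fb cofinal_subset_def by blast
      fix i assume "i \<in> Field b"
      then obtain x where x: "i = Some x" "x \<in> Field \<beta>" unfolding Fb by blast
      then obtain y where "y \<in> A" "(x, y) \<in> \<beta>" using A(1) unfolding cofinal_subset_def by blast
      then obtain n where "(x, s n) \<in> \<beta>" using sA by blast
      then have "(i, Some (s n)) \<in> b" unfolding b_def x(1) by force
      then show "\<exists>n. (i, Some (s n)) \<in> b" by (rule exI)
    qed (use limit in blast)+
  qed
  then show ?thesis using l(2) cl by blast
qed

section \<open>The topology of a ring and its left-separating orders\<close>

definition ring_topology :: "'a set set \<Rightarrow> 'a topology" where
  "ring_topology \<K> = topology (\<lambda>U. U \<subseteq> \<Union>\<K> \<and> (\<forall>x\<in>U. \<exists>K\<in>\<K>. x \<in> K \<and> K \<subseteq> U))"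

lemma openin_ring_topology:
  assumes K: "compact_ring \<K>"
  shows "openin (ring_topology \<K>) U \<longleftrightarrow> U \<subseteq> \<Union>\<K> \<and> (\<forall>x\<in>U. \<exists>K\<in>\<K>. x \<in> K \<and> K \<subseteq> U)"
proof -
  have "istopology (\<lambda>U. U \<subseteq> \<Union>\<K> \<and> (\<forall>x\<in>U. \<exists>K\<in>\<K>. x \<in> K \<and> K \<subseteq> U))"
    unfolding istopology_def
  proof (intro conjI allI impI ballI)
    fix S T x assume S: "S \<subseteq> \<Union>\<K> \<and> (\<forall>x\<in>S. \<exists>K\<in>\<K>. x \<in> K \<and> K \<subseteq> S)"
      and T: "T \<subseteq> \<Union>\<K> \<and> (\<forall>x\<in>T. \<exists>K\<in>\<K>. x \<in> K \<and> K \<subseteq> T)" and x: "x \<in> S \<inter> T"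
    obtain J where J: "J \<in> \<K>" "x \<in> J" "J \<subseteq> S" using bspec[OF conjunct2[OF S]] x by blast
    obtain L where L: "L \<in> \<K>" "x \<in> L" "L \<subseteq> T" using bspec[OF conjunct2[OF T]] x by blast
    show "\<exists>K\<in>\<K>. x \<in> K \<and> K \<subseteq> S \<inter> T"
      by (rule bexI[OF _ compact_ring_Int[OF K J(1) L(1)]]) (use J L in blast)
  next
    fix \<U> x assume U: "\<forall>S\<in>\<U>. S \<subseteq> \<Union>\<K> \<and> (\<forall>x\<in>S. \<exists>K\<in>\<K>. x \<in> K \<and> K \<subseteq> S)" and x: "x \<in> \<Union>\<U>"
    then obtain S where S: "S \<in> \<U>" "x \<in> S" by blast
    obtain J where "J \<in> \<K>" "x \<in> J" "J \<subseteq> S" using bspec[OF conjunct2[OF bspec[OF U S(1)]] S(2)] by blast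
    then show "\<exists>K\<in>\<K>. x \<in> K \<and> K \<subseteq> \<Union>\<U>" using S(1) by (intro bexI[of _ J] conjI) blast+
  qed auto
  then show ?thesis unfolding ring_topology_def by (simp add: topology_inverse')
qed

context
  fixes \<K> :: "'a set set" assumes K: "compact_ring \<K>"
begin

lemma openin_ring: "J \<in> \<K> \<Longrightarrow> openin (ring_topology \<K>) J"
  unfolding openin_ring_topology[OF K] by blast

lemma topspace_ring_topology: "topspace (ring_topology \<K>) = \<Union>\<K>"
proof
  show "topspace (ring_topology \<K>) \<subseteq> \<Union>\<K>"
    using openin_topspace[of "ring_topology \<K>"] unfolding openin_ring_topology[OF K] by (rule conjunct1)
  show "\<Union>\<K> \<subseteq> topspace (ring_topology \<K>)"
    using openin_subset[OF openin_ring] by (rule Union_least)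
qed

lemma closedin_ring:
  assumes J: "J \<in> \<K>" shows "closedin (ring_topology \<K>) J"
  unfolding closedin_def topspace_ring_topology openin_ring_topology[OF K]
proof (intro conjI ballI)
  show "J \<subseteq> \<Union>\<K>" using J by blast
  fix x assume "x \<in> \<Union>\<K> - J"
  then obtain L where L: "L \<in> \<K>" "x \<in> L" "x \<notin> J" by blast
  show "\<exists>K\<in>\<K>. x \<in> K \<and> K \<subseteq> \<Union>\<K> - J"
    by (rule bexI[OF _ compact_ring_Diff[OF K L(1) J]]) (use L in blast)
qed blast

lemma compactin_ring:
  assumes J: "J \<in> \<K>" shows "compactin (ring_topology \<K>) J"
  unfolding compactin_def topspace_ring_topology
proof (intro conjI allI impI)
  show "J \<subseteq> \<Union>\<K>" using J by blast
  fix \<U> assume U: "(\<forall>U\<in>\<U>. openin (ring_topology \<K>) U) \<and> J \<subseteq> \<Union>\<U>"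
  let ?C = "{C \<in> \<K>. \<exists>U\<in>\<U>. C \<subseteq> U}"
  have "J \<subseteq> \<Union>?C"
  proof
    fix x assume "x \<in> J"
    then obtain U where V: "U \<in> \<U>" "x \<in> U" using U by blast
    then have "openin (ring_topology \<K>) U" using U by blast
    then have "\<forall>x\<in>U. \<exists>K\<in>\<K>. x \<in> K \<and> K \<subseteq> U" unfolding openin_ring_topology[OF K] by (rule conjunct2)
    from bspec[OF this V(2)] obtain C where "C \<in> \<K>" "x \<in> C" "C \<subseteq> U" by blast
    then have "C \<in> ?C" using V(1) by blast
    then show "x \<in> \<Union>?C" using \<open>x \<in> C\<close> by (rule UnionI)
  qed
  then have "\<exists>\<C>'\<subseteq>?C. finite \<C>' \<and> J \<subseteq> \<Union>\<C>'" by (intro compact_ring_compact[OF K J]) simp_all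
  then obtain \<C>' where C': "\<C>' \<subseteq> ?C" "finite \<C>'" "J \<subseteq> \<Union>\<C>'" by (elim exE conjE)
  have "\<forall>C\<in>\<C>'. \<exists>U. U \<in> \<U> \<and> C \<subseteq> U" using C'(1) by blast
  from bchoice[OF this] obtain u where u: "\<forall>C\<in>\<C>'. u C \<in> \<U> \<and> C \<subseteq> u C" by (rule exE)
  show "\<exists>\<F>. finite \<F> \<and> \<F> \<subseteq> \<U> \<and> J \<subseteq> \<Union>\<F>"
  proof (intro exI[of _ "u ` \<C>'"] conjI)
    show "J \<subseteq> \<Union>(u ` \<C>')"
    proof
      fix x assume "x \<in> J"
      then obtain C where "C \<in> \<C>'" "x \<in> C" using C'(3) by blast
      then show "x \<in> \<Union>(u ` \<C>')" using bspec[OF u \<open>C \<in> \<C>'\<close>] by blast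
    qed
  qed (use C' u in auto)
qed

lemma ring_topology_properties:
  "locally_compact_space (ring_topology \<K>)" "locally_countable_space (ring_topology \<K>)" "zero_dimensional (ring_topology \<K>)"
proof -
  show "locally_compact_space (ring_topology \<K>)"
    unfolding locally_compact_space_def topspace_ring_topology
  proof
    fix x assume "x \<in> \<Union>\<K>"
    then obtain J where J: "J \<in> \<K>" "x \<in> J" by blast
    show "\<exists>U L. openin (ring_topology \<K>) U \<and> compactin (ring_topology \<K>) L \<and> x \<in> U \<and> U \<subseteq> L"
      by (intro exI[of _ J] conjI openin_ring compactin_ring J subset_refl)
  qed
  show "locally_countable_space (ring_topology \<K>)"
    unfolding locally_countable_space_def topspace_ring_topology
  proof
    fix x assume "x \<in> \<Union>\<K>"
    then obtain J where J: "J \<in> \<K>" "x \<in> J" by blast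
    show "\<exists>U N. openin (ring_topology \<K>) U \<and> x \<in> U \<and> U \<subseteq> N \<and> N \<subseteq> \<Union>\<K> \<and> countable N"
      using J compact_ring_countable[OF K J(1)] by (intro exI[of _ J] conjI openin_ring) blast+
  qed
  show "zero_dimensional (ring_topology \<K>)"
    unfolding zero_dimensional_def
  proof (intro exI[of _ \<K>] conjI ballI)
    show "openin (ring_topology \<K>) J" "closedin (ring_topology \<K>) J" if "J \<in> \<K>" for J
      using openin_ring[OF that] closedin_ring[OF that] .
    show "openin (ring_topology \<K>) = arbitrary union_of (\<lambda>B. B \<in> \<K>)"
      unfolding openin_topology_base_unique
    proof (intro conjI allI impI)
      fix U x assume U: "openin (ring_topology \<K>) U \<and> x \<in> U"
      then have "\<forall>x\<in>U. \<exists>K\<in>\<K>. x \<in> K \<and> K \<subseteq> U" using openin_ring_topology[OF K] by blast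
      then show "\<exists>B. B \<in> \<K> \<and> x \<in> B \<and> B \<subseteq> U" using U by blast
    qed (rule openin_ring)
  qed
qed

end

lemma Field_ord_times:
  assumes "Well_order r" "Well_order s" shows "Field (ord_times r s) = Field r \<times> Field s"
proof
  show "Field (ord_times r s) \<subseteq> Field r \<times> Field s" unfolding ord_times_def Field_def by auto
  have "(x, x) \<in> r" if "x \<in> Field r" for x
    using assms(1) that by (simp add: order_on_defs refl_on_def)
  then have "((x, i), (x, i)) \<in> ord_times r s" if "x \<in> Field r" "i \<in> Field s" for x i
    using that unfolding ord_times_def by simp
  then show "Field r \<times> Field s \<subseteq> Field (ord_times r s)" unfolding Field_def[of "ord_times r s"] by blast
qed

lemma Well_order_ord_times:
  assumes r: "Well_order r" and s: "Well_order s" shows "Well_order (ord_times r s)"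
proof -
  have wr: "wo_rel r" and ws: "wo_rel s" using r s by (simp_all add: wo_rel_def)
  note R = wo_rel.REFL[OF wr] wo_rel.TRANS[OF wr] wo_rel.ANTISYM[OF wr] wo_rel.TOTALS[OF wr]
  note S = wo_rel.REFL[OF ws] wo_rel.TRANS[OF ws] wo_rel.ANTISYM[OF ws] wo_rel.TOTALS[OF ws]
  let ?T = "ord_times r s"
  have "?T \<subseteq> Field ?T \<times> Field ?T" unfolding Field_def by auto
  moreover have "Refl ?T"
    unfolding refl_on_def Field_ord_times[OF r s] using R(1) by (auto simp: ord_times_def refl_on_def)
  moreover have "trans ?T"
  proof (rule transI)
    fix u v w assume uv: "(u, v) \<in> ?T" and vw: "(v, w) \<in> ?T"
    obtain x i y j z k where e: "u = (x, i)" "v = (y, j)" "w = (z, k)" by (cases u, cases v, cases w)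
    have a: "x \<in> Field r" "y \<in> Field r" "(i, j) \<in> s \<and> i \<noteq> j \<or> i = j \<and> i \<in> Field s \<and> (x, y) \<in> r"
      using uv unfolding e ord_times_def by simp_all
    have b: "z \<in> Field r" "(j, k) \<in> s \<and> j \<noteq> k \<or> j = k \<and> j \<in> Field s \<and> (y, z) \<in> r"
      using vw unfolding e ord_times_def by simp_all
    have "(i, k) \<in> s \<and> i \<noteq> k \<or> i = k \<and> i \<in> Field s \<and> (x, z) \<in> r"
      using a(3) b(2) transD[OF S(2), of i j k] antisymD[OF S(3), of i j] transD[OF R(2), of x y z] by blast
    then show "(u, w) \<in> ?T" using a(1) b(1) unfolding e ord_times_def by simp
  qed
  moreover have "antisym ?T"
    using antisymD[OF R(3)] antisymD[OF S(3)] unfolding antisym_def ord_times_def by auto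
  moreover have "Total ?T"
    unfolding total_on_def Field_ord_times[OF r s]
  proof (intro ballI impI)
    fix u v assume u: "u \<in> Field r \<times> Field s" "v \<in> Field r \<times> Field s" "u \<noteq> v"
    obtain x i y j where e: "u = (x, i)" "v = (y, j)" by (cases u, cases v)
    have "(x, y) \<in> r \<or> (y, x) \<in> r" "(i, j) \<in> s \<or> (j, i) \<in> s" using R(4) S(4) u unfolding e by auto
    then show "(u, v) \<in> ?T \<or> (v, u) \<in> ?T" using u unfolding e ord_times_def by auto
  qed
  moreover have "wf (?T - Id)"
  proof (rule wf_subset)
    show "wf (inv_image ((s - Id) <*lex*> (r - Id)) (\<lambda>(x, i). (i, x)))"
      using wo_rel.WELL[OF wr] wo_rel.WELL[OF ws] unfolding well_order_on_def by (intro wf_inv_image wf_lex_prod) blast+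
    show "?T - Id \<subseteq> inv_image ((s - Id) <*lex*> (r - Id)) (\<lambda>(x, i). (i, x))"
      unfolding ord_times_def by auto
  qed
  ultimately show ?thesis unfolding order_on_defs by blast
qed

text \<open>An increasing map between well-orders does not decrease the order type: otherwise it would
  induce an increasing map of the larger order into a proper initial segment of itself.\<close>

lemma strict_mono_imp_ordLeq:
  assumes r: "Well_order r" and R: "Well_order R" and \<phi>: "\<phi> ` Field r \<subseteq> Field R"
    and mono: "\<And>x y. \<lbrakk>(x, y) \<in> r; x \<noteq> y\<rbrakk> \<Longrightarrow> (\<phi> x, \<phi> y) \<in> R \<and> \<phi> x \<noteq> \<phi> y"
  shows "r \<le>o R"
proof (rule ccontr)
  assume "\<not> r \<le>o R"
  then have "R <o r" using not_ordLeq_iff_ordLess[OF R r] by blast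
  then obtain a where a: "a \<in> Field r" "R =o Restr r (underS r a)" using ordLess_iff_ordIso_Restr[OF r R] by blast
  then obtain \<psi> where "iso R (Restr r (underS r a)) \<psi>" unfolding ordIso_def by blast
  then have bij: "bij_betw \<psi> (Field R) (underS r a)"
    and iso: "\<forall>x\<in>Field R. \<forall>y\<in>Field R. (x, y) \<in> R \<longleftrightarrow> (\<psi> x, \<psi> y) \<in> Restr r (underS r a)"
    unfolding iso_iff2 Field_initial_segment[OF r] by blast+
  define h where "h z = \<phi> (\<psi> z)" for z
  have \<psi>: "\<psi> z \<in> underS r a" if "z \<in> Field R" for z using bij_betwE[OF bij] that by blast
  have hF: "h z \<in> Field R" if "z \<in> Field R" for z
    using \<psi>[OF that] \<phi> unfolding h_def underS_def Field_def by blast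
  have h_mono: "(h z, h w) \<in> R \<and> h z \<noteq> h w" if zw: "(z, w) \<in> R" "z \<noteq> w" for z w
  proof -
    have F: "z \<in> Field R" "w \<in> Field R" using zw(1) unfolding Field_def by blast+
    have "(\<psi> z, \<psi> w) \<in> r" using iso F zw(1) by blast
    moreover have "\<psi> z \<noteq> \<psi> w" using inj_onD[OF bij_betw_imp_inj_on[OF bij] _ F] zw(2) by blast
    ultimately show ?thesis unfolding h_def by (rule mono)
  qed
  have wfR: "wf (R - Id)" using R unfolding well_order_on_def by blast
  have no: "z \<in> Field R \<longrightarrow> \<not> ((h z, z) \<in> R \<and> h z \<noteq> z)" for z
    using wfR
  proof (induction z rule: wf_induct_rule)
    case (less z)
    show ?case
    proof (intro impI notI)
      assume z: "z \<in> Field R" and hz: "(h z, z) \<in> R \<and> h z \<noteq> z"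
      have "(h (h z), h z) \<in> R \<and> h (h z) \<noteq> h z" using h_mono hz by blast
      then show False using less[of "h z"] hz hF[OF z] by blast
    qed
  qed
  have "\<phi> a \<in> Field R" using \<phi> a(1) by blast
  moreover have "(h (\<phi> a), \<phi> a) \<in> R \<and> h (\<phi> a) \<noteq> \<phi> a"
    using mono[of "\<psi> (\<phi> a)" a] \<psi>[OF \<open>\<phi> a \<in> Field R\<close>] unfolding h_def underS_def by blast
  ultimately show False using no by blast
qed

section \<open>The left-separating type of the sum of all stages\<close>

context left_types
begin

lemma well_\<kappa>: "Well_order \<kappa>"
  using card_\<kappa> by (rule card_order_on_well_order_on)

lemma well_ord_times: "Well_order (ord_times \<kappa> \<alpha>)"
  using well_\<kappa> well_\<alpha> by (rule Well_order_ord_times)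

text \<open>
  Points are sorted by level first and by an arbitrary injection into \<open>\<kappa>\<close> within a level; a neighbourhood in which the other points are on higher levels lies in the final segment of its point.
\<close>

lemma left_separating_from_levels:
  assumes K: "compact_ring \<K>" and small: "|\<Union>\<K>| \<le>o \<kappa>" and L: "\<And>x. x \<in> \<Union>\<K> \<Longrightarrow> L x \<in> Field \<alpha>"
    and nb: "\<And>x. x \<in> \<Union>\<K> \<Longrightarrow> \<exists>J\<in>\<K>. x \<in> J \<and> (\<forall>y\<in>J. y \<noteq> x \<longrightarrow> less (L x) (L y))"
  shows "\<exists>r. left_separating (ring_topology \<K>) r \<and> r \<le>o ord_times \<kappa> \<alpha>"
proof -
  let ?R = "ord_times \<kappa> \<alpha>" and ?X = "\<Union>\<K>"
  have "|?X| \<le>o |Field \<kappa>|"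
    using small ordIso_symmetric[OF card_of_Field_ordIso[OF card_\<kappa>]] by (rule ordLeq_ordIso_trans)
  then have "\<exists>e. inj_on e ?X \<and> e ` ?X \<subseteq> Field \<kappa>" by (rule iffD2[OF card_of_ordLeq])
  then obtain e where e: "inj_on e ?X" "e ` ?X \<subseteq> Field \<kappa>" by (elim exE conjE)
  define \<phi> where "\<phi> x = (e x, L x)" for x
  have \<phi>_inj: "inj_on \<phi> ?X" using e(1) unfolding \<phi>_def inj_on_def by blast
  have \<phi>_Field: "\<phi> ` ?X \<subseteq> Field ?R"
    unfolding Field_ord_times[OF well_\<kappa> well_\<alpha>] \<phi>_def using e(2) L by auto
  let ?S = "Restr ?R (\<phi> ` ?X)" and ?v = "inv_into ?X \<phi>"
  have v: "?v (\<phi> x) = x" if "x \<in> ?X" for x using \<phi>_inj that by (rule inv_into_f_f)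
  have reflR: "Refl ?R" using well_ord_times by (simp add: order_on_defs)
  have FS: "Field ?S = \<phi> ` ?X" by (rule Refl_Field_Restr2[OF reflR \<phi>_Field])
  have vinj: "inj_on ?v (Field ?S)" unfolding FS by (rule inj_on_inv_into) simp
  define r where "r = dir_image ?S ?v"
  have wr: "Well_order r" unfolding r_def using Well_order_Restr[OF well_ord_times] vinj by (rule Well_order_dir_image)
  have Fr: "Field r = ?X" unfolding r_def dir_image_Field FS using v by force
  have r_iff: "(x, y) \<in> r \<longleftrightarrow> x \<in> ?X \<and> y \<in> ?X \<and> (\<phi> x, \<phi> y) \<in> ?R" for x y
  proof
    assume "(x, y) \<in> r"
    then obtain a b where ab: "x = ?v a" "y = ?v b" "(a, b) \<in> ?S" unfolding r_def dir_image_def by blast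
    then obtain x' y' where "a = \<phi> x'" "x' \<in> ?X" "b = \<phi> y'" "y' \<in> ?X" by blast
    then show "x \<in> ?X \<and> y \<in> ?X \<and> (\<phi> x, \<phi> y) \<in> ?R" using ab v by simp
  next
    assume xy: "x \<in> ?X \<and> y \<in> ?X \<and> (\<phi> x, \<phi> y) \<in> ?R"
    then have "(\<phi> x, \<phi> y) \<in> ?S" by blast
    then have "(?v (\<phi> x), ?v (\<phi> y)) \<in> r"
      unfolding r_def dir_image_def by (intro CollectI exI[of _ "\<phi> x"] exI[of _ "\<phi> y"] conjI refl)
    then show "(x, y) \<in> r" using xy v by simp
  qed
  have "r \<le>o ?R"
  proof (rule strict_mono_imp_ordLeq[OF wr well_ord_times, of \<phi>])
    show "\<phi> ` Field r \<subseteq> Field ?R" unfolding Fr by (rule \<phi>_Field)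
    show "(\<phi> x, \<phi> y) \<in> ?R \<and> \<phi> x \<noteq> \<phi> y" if "(x, y) \<in> r" "x \<noteq> y" for x y
    proof -
      have xy: "x \<in> ?X" "y \<in> ?X" "(\<phi> x, \<phi> y) \<in> ?R" using that(1) unfolding r_iff by simp_all
      then show ?thesis using inj_onD[OF \<phi>_inj _ xy(1,2)] that(2) by (intro conjI notI) simp_all
    qed
  qed
  moreover have "left_separating (ring_topology \<K>) r"
    unfolding left_separating_def topspace_ring_topology[OF K]
  proof (intro conjI ballI)
    show "well_order_on ?X r" using wr unfolding Fr .
    fix y assume y: "y \<in> ?X"
    have sub: "underS r y \<subseteq> ?X" unfolding underS_def r_iff by blast
    have "openin (ring_topology \<K>) (?X - underS r y)"
      unfolding openin_ring_topology[OF K]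
    proof (intro conjI ballI)
      fix x assume x: "x \<in> ?X - underS r y"
      have wo: "wo_rel r" using wr by (simp add: wo_rel_def)
      have yx: "(y, x) \<in> r"
        using wo_rel.TOTALS[OF wo] x y Fr unfolding underS_def by blast
      obtain J where J: "J \<in> \<K>" "x \<in> J" "\<forall>z\<in>J. z \<noteq> x \<longrightarrow> less (L x) (L z)" using nb x by blast
      have "z \<notin> underS r y" if z: "z \<in> J" for z
      proof
        assume zy: "z \<in> underS r y"
        have "(x, z) \<in> r"
        proof (cases "z = x")
          case True
          then show ?thesis using zy x by blast
        next
          case False
          then have l: "less (L x) (L z)" using J(3) z by blast
          have "x \<in> ?X" "z \<in> ?X" using x z J(1) by blast+
          then have "e x \<in> Field \<kappa>" "e z \<in> Field \<kappa>" using e(2) by blast+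
          then have "(\<phi> x, \<phi> z) \<in> ?R" using l unfolding \<phi>_def ord_times_def less_def by simp
          then show ?thesis using r_iff \<open>x \<in> ?X\<close> \<open>z \<in> ?X\<close> by blast
        qed
        then have "(y, z) \<in> r" using transD[OF wo_rel.TRANS[OF wo] yx] by blast
        then show False using zy antisymD[OF wo_rel.ANTISYM[OF wo]] unfolding underS_def by blast
      qed
      then show "\<exists>K\<in>\<K>. x \<in> K \<and> K \<subseteq> ?X - underS r y"
        using J(1,2) by (intro bexI[of _ J] conjI) blast+
    qed blast
    then show "closedin (ring_topology \<K>) (underS r y)"
      unfolding closedin_def topspace_ring_topology[OF K] using sub by blast
  qed
  ultimately show ?thesis by blast
qed

text \<open>
  An order shorter than \<open>\<kappa> \<cdot> \<alpha>\<close> is isomorphic to the initial segment below some \<open>(a, \<gamma>)\<close>. Its positions on levels at least \<open>\<gamma>\<close> are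
  \<open>(b, \<gamma>)\<close> with \<open>b < a\<close>, and these are fewer than \<open>\<kappa>\<close>.
\<close>

lemma left_type_lower_bound:
  assumes K: "compact_ring \<K>"
    and forced: "\<And>\<gamma> p. \<lbrakk>\<gamma> \<in> Field \<alpha>; left_ranking \<K> p\<rbrakk> \<Longrightarrow> \<kappa> \<le>o |{x \<in> \<Union>\<K>. (\<gamma>, snd (p x)) \<in> \<alpha>}|"
    and r: "left_separating (ring_topology \<K>) r"
  shows "ord_times \<kappa> \<alpha> \<le>o r"
proof (rule ccontr)
  let ?R = "ord_times \<kappa> \<alpha>" and ?X = "\<Union>\<K>"
  have wX: "well_order_on ?X r" and cl: "\<forall>y\<in>?X. closedin (ring_topology \<K>) (underS r y)"
    using r unfolding left_separating_def topspace_ring_topology[OF K] by simp_all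
  have Fr: "Field r = ?X" using well_order_on_Field[OF wX] by simp
  have wr: "Well_order r" using wX unfolding Fr .
  assume "\<not> ?R \<le>o r"
  then have "r <o ?R" using not_ordLeq_iff_ordLess[OF wr well_ord_times] by blast
  then obtain w where w: "w \<in> Field ?R" "r =o Restr ?R (underS ?R w)"
    using ordLess_iff_ordIso_Restr[OF well_ord_times wr] by blast
  obtain a \<gamma> where w': "w = (a, \<gamma>)" by (cases w)
  have a: "a \<in> Field \<kappa>" "\<gamma> \<in> Field \<alpha>" using w(1) unfolding Field_ord_times[OF well_\<kappa> well_\<alpha>] w' by simp_all
  obtain p where "iso r (Restr ?R (underS ?R w)) p" using w(2) unfolding ordIso_def by blast
  then have bij: "bij_betw p ?X (underS ?R w)"
    and iso: "\<forall>x\<in>?X. \<forall>y\<in>?X. (x, y) \<in> r \<longleftrightarrow> (p x, p y) \<in> Restr ?R (underS ?R w)"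
    unfolding iso_iff2 Field_initial_segment[OF well_ord_times] Fr by blast+
  have px: "(p x, w) \<in> ?R" "p x \<noteq> w" if "x \<in> ?X" for x
    using bij_betwE[OF bij] that unfolding underS_def by blast+
  have rank: "left_ranking \<K> p"
    unfolding left_ranking_def
  proof (intro conjI ballI)
    show "inj_on p ?X" using bij by (rule bij_betw_imp_inj_on)
    show "p ` ?X \<subseteq> Field \<kappa> \<times> Field \<alpha>"
      unfolding Field_ord_times[OF well_\<kappa> well_\<alpha>, symmetric] using px unfolding Field_def by blast
    fix x assume x: "x \<in> ?X"
    then have "openin (ring_topology \<K>) (?X - underS r x)"
      using cl unfolding closedin_def topspace_ring_topology[OF K] by blast
    then have "\<forall>y\<in>?X - underS r x. \<exists>J\<in>\<K>. y \<in> J \<and> J \<subseteq> ?X - underS r x"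
      unfolding openin_ring_topology[OF K] by (rule conjunct2)
    moreover have "x \<in> ?X - underS r x" using x unfolding underS_def by blast
    ultimately have "\<exists>J\<in>\<K>. x \<in> J \<and> J \<subseteq> ?X - underS r x" by (rule bspec)
    then obtain J where J: "J \<in> \<K>" "x \<in> J" "J \<subseteq> ?X - underS r x" by blast
    have wo: "wo_rel r" using wr by (simp add: wo_rel_def)
    have "(p x, p y) \<in> ?R" if y: "y \<in> J" for y
    proof -
      have yX: "y \<in> ?X" "y \<notin> underS r x" using J(3) y by blast+
      then have "(x, y) \<in> r" using wo_rel.TOTALS[OF wo] x Fr unfolding underS_def by blast
      then show ?thesis using iso x yX(1) by blast
    qed
    then show "\<exists>J\<in>\<K>. x \<in> J \<and> (\<forall>y\<in>J. (p x, p y) \<in> ?R)" using J(1,2) by (intro bexI[of _ J] conjI ballI)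
  qed
  let ?H = "{x \<in> ?X. (\<gamma>, snd (p x)) \<in> \<alpha>}"
  have "|?H| \<le>o |{b. (b, a) \<in> \<kappa>}|"
  proof (rule card_of_ordLeqI[of "\<lambda>x. fst (p x)"])
    have top: "snd (p x) = \<gamma>" if x: "x \<in> ?H" for x
      using ord_times_snd[OF px(1)] x \<alpha>_antisym unfolding w' by simp
    show "inj_on (\<lambda>x. fst (p x)) ?H"
    proof (rule inj_onI)
      fix x y assume xy: "x \<in> ?H" "y \<in> ?H" "fst (p x) = fst (p y)"
      then have "p x = p y" using top[OF xy(1)] top[OF xy(2)] by (simp add: prod_eq_iff)
      then show "x = y" using inj_onD[OF bij_betw_imp_inj_on[OF bij]] xy(1,2) by blast
    qed
    show "fst (p x) \<in> {b. (b, a) \<in> \<kappa>}" if x: "x \<in> ?H" for x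
      using ord_times_fst[OF px(1)[of x]] top[OF x] x unfolding w' by simp
  qed
  then have "|?H| <o |Pow \<Lambda>|" using card_of_under by (rule ordLeq_ordLess_trans)
  moreover have "\<kappa> \<le>o |?H|" using forced[OF a(2) rank] .
  ultimately show False unfolding \<kappa>_le_iff using not_ordLess_ordLeq by blast
qed

theorem left_type_space_exists:
  "\<exists>X :: 'k topology. locally_compact_space X \<and> locally_countable_space X \<and> zero_dimensional X \<and>
     has_left_type X (ord_times \<kappa> \<alpha>)"
proof -
  have "\<forall>\<gamma>\<in>Field \<alpha>. \<exists>q. stage \<gamma> (fst q :: 'k set set) (fst (snd q)) (fst (snd (snd q))) (snd (snd (snd q)))"
  proof
    fix \<gamma> assume "\<gamma> \<in> Field \<alpha>"
    from stages_exist[OF this] obtain \<K> :: "'k set set" and N g L where "stage \<gamma> \<K> N g L" by (elim exE)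
    then show "\<exists>q. stage \<gamma> (fst q :: 'k set set) (fst (snd q)) (fst (snd (snd q))) (snd (snd (snd q)))"
      by (intro exI[of _ "(\<K>, N, g, L)"]) simp
  qed
  from bchoice[OF this] obtain q where
    q: "\<forall>\<gamma>\<in>Field \<alpha>. stage \<gamma> (fst (q \<gamma>) :: 'k set set) (fst (snd (q \<gamma>))) (fst (snd (snd (q \<gamma>)))) (snd (snd (snd (q \<gamma>))))"
    by (rule exE)
  define \<K> where "\<K> \<gamma> = fst (q \<gamma>)" for \<gamma>
  define N where "N \<gamma> = fst (snd (q \<gamma>))" for \<gamma>
  define g where "g \<gamma> = fst (snd (snd (q \<gamma>)))" for \<gamma>
  define L where "L \<gamma> = snd (snd (snd (q \<gamma>)))" for \<gamma>
  have st: "stage \<gamma> (\<K> \<gamma>) (N \<gamma>) (g \<gamma>) (L \<gamma>)" if "\<gamma> \<in> Field \<alpha>" for \<gamma>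
    using q that unfolding \<K>_def N_def g_def L_def by blast
  note lev = stageD(1)[OF st]
  note gr = graded_levelsD(1)[OF lev]
  define \<S> where "\<S> = sum_ring (Field \<alpha>) (\<lambda>\<gamma>. residue (\<K> \<gamma>) (N \<gamma>))"
  have res: "compact_ring (residue (\<K> \<gamma>) (N \<gamma>))" if "\<gamma> \<in> Field \<alpha>" for \<gamma>
    using graded.ring[OF gr[OF that]] graded.isolated[OF gr[OF that]] by (rule compact_ring_residue)
  have S: "compact_ring \<S>" unfolding \<S>_def using res by (rule compact_ring_sum_ring)
  have US: "\<Union>\<S> = (SIGMA \<gamma>:Field \<alpha>. \<Union>(\<K> \<gamma>) - N \<gamma>)"
    unfolding \<S>_def using Union_sum_ring[of "Field \<alpha>" "\<lambda>\<gamma>. residue (\<K> \<gamma>) (N \<gamma>)", OF compact_ring_empty[OF res]]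
    by (simp add: Union_residue)
  have "|\<Union>(\<K> \<gamma>) - N \<gamma>| \<le>o \<kappa>" if "\<gamma> \<in> Field \<alpha>" for \<gamma>
    using ordLeq_transitive[OF card_of_mono1 graded_levelsD(2)[OF lev[OF that]]] by blast
  then have S_small: "|\<Union>\<S>| \<le>o \<kappa>" unfolding US by (rule Sigma_le_\<kappa>[OF \<alpha>_small])
  then have "|\<Union>\<S>| \<le>o |Field \<kappa>|"
    using ordIso_symmetric[OF card_of_Field_ordIso[OF card_\<kappa>]] by (rule ordLeq_ordIso_trans)
  then have "\<exists>h :: 'a \<times> 'k \<Rightarrow> 'k. inj_on h (\<Union>\<S>) \<and> h ` \<Union>\<S> \<subseteq> Field \<kappa>" by (rule iffD2[OF card_of_ordLeq])
  then obtain h :: "'a \<times> 'k \<Rightarrow> 'k" where h: "inj_on h (\<Union>\<S>)" by (elim exE conjE)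
  define \<X> where "\<X> = (`) h ` \<S>"
  have X: "compact_ring \<X>" unfolding \<X>_def using S h by (rule compact_ring_image)
  have UX: "\<Union>\<X> = h ` \<Union>\<S>" unfolding \<X>_def by blast
  let ?v = "inv_into (\<Union>\<S>) h"
  have v: "?v (h x) = x" if "x \<in> \<Union>\<S>" for x using h that by (rule inv_into_f_f)
  define L' where "L' x = (\<lambda>(\<gamma>, y). L \<gamma> y) (?v x)" for x
  have upper: "\<exists>r. left_separating (ring_topology \<X>) r \<and> r \<le>o ord_times \<kappa> \<alpha>"
  proof (rule left_separating_from_levels[OF X, of L'])
    show "|\<Union>\<X>| \<le>o \<kappa>" unfolding UX using S_small by (rule image_le_\<kappa>)
    fix x assume "x \<in> \<Union>\<X>"
    then obtain \<gamma> y where xy: "x = h (\<gamma>, y)" "(\<gamma>, y) \<in> \<Union>\<S>" unfolding UX by auto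
    then have y: "\<gamma> \<in> Field \<alpha>" "y \<in> \<Union>(\<K> \<gamma>)" "y \<notin> N \<gamma>" unfolding US by auto
    have Lx: "L' x = L \<gamma> y" unfolding L'_def xy(1) v[OF xy(2)] by simp
    show "L' x \<in> Field \<alpha>" unfolding Lx using stageD(2)[OF st[OF y(1)] y(2,3)] by (rule FieldI1)
    obtain K where K: "K \<in> \<K> \<gamma>" "y \<in> K" "\<forall>z\<in>K - N \<gamma>. z \<noteq> y \<longrightarrow> less (L \<gamma> y) (L \<gamma> z)"
      using graded_levelsD(3)[OF lev[OF y(1)] y(2,3)] by blast
    have P: "Pair \<gamma> ` (K - N \<gamma>) \<in> \<S>" unfolding \<S>_def
    proof (rule sum_ring_Pair[OF compact_ring_empty[OF res] y(1)])
      show "K - N \<gamma> \<in> residue (\<K> \<gamma>) (N \<gamma>)" unfolding residue_def using K(1) by blast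
    qed
    then have "h ` Pair \<gamma> ` (K - N \<gamma>) \<in> \<X>" unfolding \<X>_def by blast
    then show "\<exists>J\<in>\<X>. x \<in> J \<and> (\<forall>u\<in>J. u \<noteq> x \<longrightarrow> less (L' x) (L' u))"
    proof (rule bexI[rotated], intro conjI ballI impI)
      show "x \<in> h ` Pair \<gamma> ` (K - N \<gamma>)" using xy(1) K(2) y(3) by blast
      fix u assume u: "u \<in> h ` Pair \<gamma> ` (K - N \<gamma>)" "u \<noteq> x"
      then obtain z where z: "u = h (\<gamma>, z)" "z \<in> K - N \<gamma>" by blast
      then have "(\<gamma>, z) \<in> \<Union>\<S>" using P by blast
      then have "L' u = L \<gamma> z" unfolding L'_def z(1) by (simp add: v)
      moreover have "z \<noteq> y" using u(2) z(1) xy(1) by blast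
      ultimately show "less (L' x) (L' u)" unfolding Lx using K(3) z(2) by simp
    qed
  qed
  have lower: "ord_times \<kappa> \<alpha> \<le>o r" if r: "left_separating (ring_topology \<X>) r" for r
  proof (rule left_type_lower_bound[OF X _ r])
    fix \<gamma> p assume \<gamma>: "\<gamma> \<in> Field \<alpha>" and p: "left_ranking \<X> p"
    have dom: "(\<gamma>, y) \<in> \<Union>\<S>" if "y \<in> \<Union>(\<K> \<gamma>) - N \<gamma>" for y unfolding US using that \<gamma> by simp
    have inj: "inj_on (\<lambda>y. h (\<gamma>, y)) (\<Union>(\<K> \<gamma>) - N \<gamma>)"
    proof (rule inj_onI)
      fix y z assume "y \<in> \<Union>(\<K> \<gamma>) - N \<gamma>" "z \<in> \<Union>(\<K> \<gamma>) - N \<gamma>" "h (\<gamma>, y) = h (\<gamma>, z)"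
      then show "y = z" using inj_onD[OF h _ dom dom] by blast
    qed
    have "left_ranking (residue (\<K> \<gamma>) (N \<gamma>)) (p \<circ> (\<lambda>y. h (\<gamma>, y)))"
    proof (rule left_ranking_pullback[OF p])
      show "inj_on (\<lambda>y. h (\<gamma>, y)) (\<Union>(residue (\<K> \<gamma>) (N \<gamma>)))" unfolding Union_residue by (rule inj)
      show "(\<lambda>y. h (\<gamma>, y)) ` \<Union>(residue (\<K> \<gamma>) (N \<gamma>)) \<subseteq> \<Union>\<X>" unfolding Union_residue UX using dom by blast
      fix K assume "K \<in> \<X>"
      then obtain P where P: "P \<in> \<S>" "K = h ` P" unfolding \<X>_def by blast
      have f: "Pair \<gamma> -` P \<in> residue (\<K> \<gamma>) (N \<gamma>)" using P(1) \<gamma> unfolding \<S>_def by (rule sum_ring_fiber)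
      have "{y \<in> \<Union>(residue (\<K> \<gamma>) (N \<gamma>)). h (\<gamma>, y) \<in> K} = Pair \<gamma> -` P"
      proof (intro equalityI subsetI)
        fix y assume "y \<in> {y \<in> \<Union>(residue (\<K> \<gamma>) (N \<gamma>)). h (\<gamma>, y) \<in> K}"
        then have y: "(\<gamma>, y) \<in> \<Union>\<S>" "h (\<gamma>, y) \<in> h ` P" using dom unfolding Union_residue P(2) by simp_all
        then obtain u where u: "u \<in> P" "h (\<gamma>, y) = h u" by blast
        then have "u \<in> \<Union>\<S>" using P(1) by blast
        then have "(\<gamma>, y) = u" using inj_onD[OF h u(2) y(1)] by blast
        then show "y \<in> Pair \<gamma> -` P" using u(1) by simp
      next
        fix y assume y: "y \<in> Pair \<gamma> -` P"
        then have "y \<in> \<Union>(residue (\<K> \<gamma>) (N \<gamma>))" using f by (rule UnionI[rotated])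
        then show "y \<in> {y \<in> \<Union>(residue (\<K> \<gamma>) (N \<gamma>)). h (\<gamma>, y) \<in> K}" using y P(2) by simp
      qed
      then show "{y \<in> \<Union>(residue (\<K> \<gamma>) (N \<gamma>)). h (\<gamma>, y) \<in> K} \<in> residue (\<K> \<gamma>) (N \<gamma>)" using f by simp
    qed
    from stageD(3)[OF st[OF \<gamma>] this]
    have "\<kappa> \<le>o |{y \<in> \<Union>(\<K> \<gamma>) - N \<gamma>. (\<gamma>, snd (p (h (\<gamma>, y)))) \<in> \<alpha>}|" by simp
    also have "|{y \<in> \<Union>(\<K> \<gamma>) - N \<gamma>. (\<gamma>, snd (p (h (\<gamma>, y)))) \<in> \<alpha>}| \<le>o |{x \<in> \<Union>\<X>. (\<gamma>, snd (p x)) \<in> \<alpha>}|"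
    proof (rule card_of_ordLeqI[of "\<lambda>y. h (\<gamma>, y)"])
      show "inj_on (\<lambda>y. h (\<gamma>, y)) {y \<in> \<Union>(\<K> \<gamma>) - N \<gamma>. (\<gamma>, snd (p (h (\<gamma>, y)))) \<in> \<alpha>}"
        using inj by (rule inj_on_subset) blast
      show "h (\<gamma>, y) \<in> {x \<in> \<Union>\<X>. (\<gamma>, snd (p x)) \<in> \<alpha>}"
        if "y \<in> {y \<in> \<Union>(\<K> \<gamma>) - N \<gamma>. (\<gamma>, snd (p (h (\<gamma>, y)))) \<in> \<alpha>}" for y
        using that imageI[OF dom[of y], of h] unfolding UX by simp
    qed
    finally show "\<kappa> \<le>o |{x \<in> \<Union>\<X>. (\<gamma>, snd (p x)) \<in> \<alpha>}|" .
  qed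
  obtain r where r: "left_separating (ring_topology \<X>) r" "r \<le>o ord_times \<kappa> \<alpha>" using upper by blast
  then have "r =o ord_times \<kappa> \<alpha>" using lower unfolding ordIso_iff_ordLeq by blast
  then have "has_left_type (ring_topology \<X>) (ord_times \<kappa> \<alpha>)"
    unfolding has_left_type_def using r(1) lower by blast
  then show ?thesis using ring_topology_properties[OF X] by blast
qed

end

theorem theorem1p3:
  fixes \<beta> :: "'b rel" and \<kappa> :: "'k rel" and \<alpha> :: "'a rel"
  assumes "Well_order \<beta>"
    and "\<beta> = {} \<or> is_cofinality \<beta> natLeq"
    and "is_beth (ord_succ \<beta>) \<kappa>"
    and "Well_order \<alpha>"
    and "\<alpha> <o cardSuc \<kappa>"
  shows "\<exists>X :: 'k topology. locally_compact_space X \<and> locally_countable_space X \<and>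
           zero_dimensional X \<and> has_left_type X (ord_times \<kappa> \<alpha>)"
proof -
  obtain l :: "'k rel" and B where l: "\<kappa> =o ctwo ^c l" "Card_order l" "strong_limit (Field l) B"
    using beth_successor_strong_limit[OF assms(1-3)] by blast
  have \<kappa>: "Card_order \<kappa>" using is_beth_infinite_card[OF assms(3)] ..
  have "ctwo ^c l =o ctwo ^c |Field l|"
    using ordIso_symmetric[OF card_of_Field_ordIso[OF l(2)]] by (rule ctwo_cexp_cong[OF l(2)])
  from ordIso_transitive[OF ordIso_transitive[OF l(1) this] ordIso_symmetric[OF card_of_Pow_ctwo]]
  have \<kappa>_Pow: "\<kappa> =o |Pow (Field l)|" .
  have "|Field \<alpha>| <o cardSuc \<kappa>" using assms(5) by (rule ordLess_Field)
  then have \<alpha>_small: "|Field \<alpha>| \<le>o \<kappa>" by (rule iffD1[OF cardSuc_ordLeq_ordLess[OF \<kappa> card_of_Card_order]])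
  interpret left_types "Field l" B \<kappa> \<alpha>
    using l(3) \<kappa> \<kappa>_Pow assms(4) \<alpha>_small by (intro left_types.intro left_types_axioms.intro)
  show ?thesis by (rule left_type_space_exists)
qed

end
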